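(* For every Coxeter system $(W,S)$ with $S$ finite, the set $L$ of all low elements of $W$ includes $S$, is finite, and is closed under join (taken in the right weak order) and under suffix. That is: $S\subseteq L$; $L$ is finite; if $u,v\in L$ and the join $u\vee v$ exists in $W$, then $u\vee v\in L$; and every suffix of an element of $L$ lies in $L$.
   Context: **Length, suffix, weak order, join.** Let $(W,S)$ be a Coxeter system, with Coxeter matrix $(m_{s,t})$ and length function $\ell$ with respect to $S$. An element $v\in W$ is a suffix of $w\in W$ if a reduced word for $v$ is a suffix of a reduced word for $w$, i.e. $w=uv$ with $\ell(w)=\ell(u)+\ell(v)$ for some $u\in W$. The right weak order on $W$ is: $u\le w$ if and only if there is $v\in W$ with $w=uv$ and $\ell(w)=\ell(u)+\ell(v)$. If $u,v\in W$ have a common upper bound for $\le$, they have a least one, the join $u\vee v$; otherwise the join does not exist. **Root system.** Let $(\Phi,\Delta)$ be a based root system in $(V,B)$ with associated Coxeter system $(W,S)$. Here $V$ is a real vector space, $B$ is a symmetric bilinear form on $V$, and $\Delta=\{\alpha_s\mid s\in S\}\subseteq V$ consists of one element (simple root) for each $s\in S$, such that: no nontrivial nonnegative linear combination of $\Delta$ is zero; $B(\alpha_s,\alpha_s)=1$; for $s\ne t$, $B(\alpha_s,\alpha_t)=-\cos(\pi/m_{s,t})$ if $m_{s,t}<\infty$ and $B(\alpha_s,\alpha_t)\le -1$ if $m_{s,t}=\infty$. (For example, the standard geometric representation.) Mapping each $s\in S$ to the $B$-reflection $v\mapsto v-2B(\alpha_s,v)\alpha_s$ defines a faithful representation of $W$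 on $V$. Put $\Phi=W(\Delta)$ (roots), $\Phi^+=\operatorname{cone}(\Delta)\cap\Phi$ (positive roots) and $\Phi^-=-\Phi^+$ (negative roots), where $\operatorname{cone}(X)$ is the set of all nonnegative linear combinations of elements of $X$. For $\alpha\in\Phi$, let $s_\alpha\in W$ be the element acting as the $B$-reflection in $\alpha$. **Inversion sets.** For $w\in W$ put $N(w)=\Phi^+\cap w(\Phi^-)=\{\alpha\in\Phi^+\mid \ell(s_\alpha w)<\ell(w)\}$ and $N^1(w)=\{\alpha\in\Phi^+\mid \ell(s_\alpha w)=\ell(w)-1\}$. **Small roots.** The dominance order $\preccurlyeq$ on $\Phi$ is defined by: $\alpha\preccurlyeq\beta$ ($\beta$ dominates $\alpha$) if and only if for all $w\in W$, $w(\beta)\in\Phi^-$ implies $w(\alpha)\in\Phi^-$. A positive root $\beta$ is small if for all $\alpha\in\Phi^+$, $\alpha\preccurlyeq\beta$ implies $\alpha=\beta$. Let $\Sigma$ be the set of small roots. **Low elements.** An element $w\in W$ is low if $N^1(w)\subseteq\Sigma$; equivalently, if $N(w)=\operatorname{cone}(A)\cap\Phi$ for some set $A$ of small roots. *)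

theory Defs
  imports "HOL-Analysis.Analysis" "HOL-Algebra.Generated_Groups" "HOL-Library.Extended_Nat"
begin

section \<open>Coxeter systems\<close>

text \<open>
  The group presented by generators \<open>S\<close> and relations \<open>(st)^m(s,t) = 1\<close>, for \<open>m(s,t)\<close> finite, is
  described through words, i.e. lists of
  generators. Formal inverses of generators are not needed: since \<open>m(s,s) = 1\<close>, the relations
  include \<open>ss = 1\<close>, so that the monoid with this presentation is already the group with this
  presentation.
\<close>

inductive coxeter_equiv :: "'w set \<Rightarrow> ('w \<Rightarrow> 'w \<Rightarrow> enat) \<Rightarrow> 'w list \<Rightarrow> 'w list \<Rightarrow> bool"
  for S :: "'w set" and m :: "'w \<Rightarrow> 'w \<Rightarrow> enat" where
  refl: "set xs \<subseteq> S \<Longrightarrow> coxeter_equiv S m xs xs"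
| relation: "\<lbrakk>set xs \<subseteq> S; set ys \<subseteq> S; s \<in> S; t \<in> S; m s t = enat k\<rbrakk> \<Longrightarrow>
    coxeter_equiv S m (xs @ concat (replicate k [s, t]) @ ys) (xs @ ys)"
| sym: "coxeter_equiv S m xs ys \<Longrightarrow> coxeter_equiv S m ys xs"
| trans: "\<lbrakk>coxeter_equiv S m xs ys; coxeter_equiv S m ys zs\<rbrakk> \<Longrightarrow> coxeter_equiv S m xs zs"

definition word_prod :: "('w, 'x) monoid_scheme \<Rightarrow> 'w list \<Rightarrow> 'w" where
  "word_prod W xs = foldr (\<lambda>s w. s \<otimes>\<^bsub>W\<^esub> w) xs \<one>\<^bsub>W\<^esub>"

locale coxeter_system = group W
  for W :: "('w, 'x) monoid_scheme" (structure) +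
  fixes S :: "'w set"
    and m :: "'w \<Rightarrow> 'w \<Rightarrow> enat"
  assumes S_subset: "S \<subseteq> carrier W"
    and m_diag: "s \<in> S \<Longrightarrow> m s s = 1"
    and m_sym: "\<lbrakk>s \<in> S; t \<in> S\<rbrakk> \<Longrightarrow> m s t = m t s"
    and m_off_diag: "\<lbrakk>s \<in> S; t \<in> S; s \<noteq> t\<rbrakk> \<Longrightarrow> 2 \<le> m s t"
    and generates: "generate W S = carrier W"
    and presentation: "\<lbrakk>set xs \<subseteq> S; set ys \<subseteq> S\<rbrakk> \<Longrightarrow>
      word_prod W xs = word_prod W ys \<longleftrightarrow> coxeter_equiv S m xs ys"
begin

definition len :: "'w \<Rightarrow> nat" where
  "len w = (LEAST n. \<exists>xs. set xs \<subseteq> S \<and> length xs = n \<and> word_prod W xs = w)"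

definition is_suffix :: "'w \<Rightarrow> 'w \<Rightarrow> bool" where
  "is_suffix v w \<longleftrightarrow> v \<in> carrier W \<and> (\<exists>u \<in> carrier W. w = u \<otimes> v \<and> len w = len u + len v)"

definition right_weak_order :: "'w gorder" where
  "right_weak_order = \<lparr>carrier = carrier W, eq = (=),
     le = (\<lambda>u w. \<exists>v \<in> carrier W. w = u \<otimes> v \<and> len w = len u + len v)\<rparr>"

definition is_join :: "'w \<Rightarrow> 'w \<Rightarrow> 'w \<Rightarrow> bool" where
  "is_join j u v \<longleftrightarrow> least right_weak_order j (Upper right_weak_order {u, v})"

end


section \<open>Based root systems\<close>

definition nonneg_cone :: "'v::real_vector set \<Rightarrow> 'v set" where
  "nonneg_cone X = {(\<Sum>x\<in>F. c x *\<^sub>R x) | F c. finite F \<and> F \<subseteq> X \<and> (\<forall>x\<in>F. 0 \<le> c x)}"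

text \<open>The vector space \<open>V\<close> is the whole type \<open>'v\<close>; it may be infinite-dimensional.\<close>

locale based_root_system = coxeter_system W S m
  for W :: "('w, 'x) monoid_scheme" (structure)
    and S :: "'w set"
    and m :: "'w \<Rightarrow> 'w \<Rightarrow> enat" +
  fixes B :: "'v::real_vector \<Rightarrow> 'v \<Rightarrow> real"
    and \<alpha> :: "'w \<Rightarrow> 'v"
  assumes B_bilinear: "bilinear B"
    and B_sym: "B x y = B y x"
    and no_nonneg_relation:
      "\<lbrakk>finite F; F \<subseteq> S; \<And>s. s \<in> F \<Longrightarrow> 0 \<le> c s; (\<Sum>s\<in>F. c s *\<^sub>R \<alpha> s) = 0; s \<in> F\<rbrakk> \<Longrightarrow> c s = 0"
    and B_diag: "s \<in> S \<Longrightarrow> B (\<alpha> s) (\<alpha> s) = 1"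
    and B_finite: "\<lbrakk>s \<in> S; t \<in> S; s \<noteq> t; m s t = enat k\<rbrakk> \<Longrightarrow> B (\<alpha> s) (\<alpha> t) = - cos (pi / real k)"
    and B_infinite: "\<lbrakk>s \<in> S; t \<in> S; s \<noteq> t; m s t = \<infinity>\<rbrakk> \<Longrightarrow> B (\<alpha> s) (\<alpha> t) \<le> - 1"
begin

definition B_reflection :: "'v \<Rightarrow> 'v \<Rightarrow> 'v" where
  "B_reflection \<beta> v = v - (2 * B \<beta> v) *\<^sub>R \<beta>"

text \<open>
  The action of \<open>W\<close> on \<open>V\<close> extending \<open>s \<mapsto> B_reflection (\<alpha> s)\<close>. It does not depend on the choice
  of the word, because the reflections satisfy the Coxeter relations.
\<close>

definition act :: "'w \<Rightarrow> 'v \<Rightarrow> 'v" where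
  "act w = (THE f. \<exists>xs. set xs \<subseteq> S \<and> word_prod W xs = w \<and>
     f = foldr (\<lambda>s g. B_reflection (\<alpha> s) \<circ> g) xs id)"

definition roots :: "'v set" where
  "roots = {act w (\<alpha> s) | w s. w \<in> carrier W \<and> s \<in> S}"

definition pos_roots :: "'v set" where
  "pos_roots = nonneg_cone (\<alpha> ` S) \<inter> roots"

definition neg_roots :: "'v set" where
  "neg_roots = uminus ` pos_roots"

text \<open>Uniqueness of the element acting as the given reflection is faithfulness of the action.\<close>

definition root_reflection :: "'v \<Rightarrow> 'w" where
  "root_reflection \<beta> = (THE w. w \<in> carrier W \<and> act w = B_reflection \<beta>)"

definition N1 :: "'w \<Rightarrow> 'v set" where
  "N1 w = {\<beta> \<in> pos_roots. len (root_reflection \<beta> \<otimes> w) + 1 = len w}"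

definition dominated_by :: "'v \<Rightarrow> 'v \<Rightarrow> bool" where
  "dominated_by \<beta> \<gamma> \<longleftrightarrow> (\<forall>w \<in> carrier W. act w \<gamma> \<in> neg_roots \<longrightarrow> act w \<beta> \<in> neg_roots)"

definition small_roots :: "'v set" where
  "small_roots = {\<beta> \<in> pos_roots. \<forall>\<gamma> \<in> pos_roots. dominated_by \<gamma> \<beta> \<longrightarrow> \<gamma> = \<beta>}"

definition low_elements :: "'w set" where
  "low_elements = {w \<in> carrier W. N1 w \<subseteq> small_roots}"

end

end

theory Submission
  imports Defs
begin

text \<open>
  A strictly positive functional \<open>lam\<close> on the simple roots separates positive from negative roots.
  The cone over the short inversions of \<open>w\<close> contains all inversions of \<open>w\<close>, so \<open>N\<^sup>1(w)\<close>
  determines \<open>w\<close>, and there are finitely many low elements once there are finitely many small roots.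
  For the latter (Brink and Howlett), a non-simple small root lies one simple reflection above another
  small root; along such an ascending path the vectors \<open>(B(\<alpha>\<^sub>s, \<beta>))\<^sub>s\<close>, with values at most \<open>-1\<close>
  identified, are pairwise distinct, and the values of \<open>B\<close> on roots in \<open>(-1, 1)\<close> form a finite set.
  For joins, induction over a common upper bound gives
  \<open>N\<^sup>1(u \<or> v) \<subseteq> N(u) \<union> N(v)\<close>, and a short inversion of \<open>u \<or> v\<close> in \<open>N(u)\<close> is short for \<open>u\<close>.
  For suffixes, let \<open>w = sv\<close> be low and \<open>\<beta>\<close> a short inversion of \<open>v\<close>. Either \<open>s\<beta>\<close> is a short inversion
  of \<open>w\<close>, or a short inversion of \<open>w\<close> in the plane of \<open>\<alpha>\<^sub>s\<close> and \<open>\<beta>\<close> is a positive combination of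
  these two canonical roots; then \<open>\<beta>\<close> is small by bipodality (Dyer), which is reduced to rank three.
\<close>

section \<open>Gordan's theorem\<close>

text \<open>The simple roots may be linearly dependent and V may be infinite-dimensional, so
  coefficients of a root are not unique. Signs are read off from one functional, and every
  comparison of coefficients is replaced by an argument with \<open>lam\<close>, with
  \<open>B\<close>, or inside a plane. Dihedral subsystems are treated through Chebyshev values at
  \<open>- B\<close> instead of angles: one recursion serves finite and infinite dihedral groups,
  and the fact that a root of a plane has coefficients of one sign stands in for c = cos(pi/k).
  Finiteness of the values of \<open>B\<close> below 1: two roots with |B| < 1 span a positive
  definite plane whose rotation has finite order on it. Averaging gives a functional that vanishes
  on the plane and is positive on almost all positive roots; a conjugation then moves both roots
  into one of finitely many finite standard subsystems. Bipodality concerns planes whose canonical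
  roots need not be simple. The conjugation is therefore done inside a three-dimensional subsystem,
  whose canonical roots act as simple roots. The threshold 3/4 is cos^2(pi/6), where the rank three
  diagram with labels 3 and k passes from finite to affine type.\<close>

lemma gordan:
  fixes v :: "'i \<Rightarrow> 'v::real_vector"
  assumes "finite I"
    and "\<And>c i. \<lbrakk>\<And>i. i \<in> I \<Longrightarrow> 0 \<le> c i; (\<Sum>i\<in>I. c i *\<^sub>R v i) = 0; i \<in> I\<rbrakk> \<Longrightarrow> c i = 0"
  shows "\<exists>f. linear f \<and> (\<forall>i\<in>I. (0::real) < f (v i))"
  using assms
proof (induction I arbitrary: v rule: finite_induct)
  case empty
  show ?case by (rule exI[of _ "\<lambda>_. 0"]) (simp add: linear_iff)
next
  case (insert a F)
  have sum_ext: "(\<Sum>i\<in>insert a F. (c(a := k)) i *\<^sub>R v i) = k *\<^sub>R v a + (\<Sum>i\<in>F. c i *\<^sub>R v i)" for c k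
  proof -
    have "(\<Sum>i\<in>F. (c(a := k)) i *\<^sub>R v i) = (\<Sum>i\<in>F. c i *\<^sub>R v i)"
      using insert.hyps by (intro sum.cong) auto
    then show ?thesis using insert.hyps by simp
  qed
  have rel: "k = 0 \<and> (\<forall>i\<in>F. c i = 0)"
    if "0 \<le> k" "\<And>i. i \<in> F \<Longrightarrow> 0 \<le> c i" "k *\<^sub>R v a + (\<Sum>i\<in>F. c i *\<^sub>R v i) = 0" for c k
  proof -
    have "(c(a := k)) i = 0" if "i \<in> insert a F" for i
    proof (rule insert.prems)
      show "0 \<le> (c(a := k)) j" if "j \<in> insert a F" for j
        using that \<open>0 \<le> k\<close> \<open>\<And>i. i \<in> F \<Longrightarrow> 0 \<le> c i\<close> by (cases "j = a") auto
      show "(\<Sum>i\<in>insert a F. (c(a := k)) i *\<^sub>R v i) = 0"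
        unfolding sum_ext by fact
    qed fact
    then show ?thesis using insert.hyps by (metis fun_upd_other fun_upd_same insertCI)
  qed
  have "v a \<noteq> 0"
    using rel[of 1 "\<lambda>_. 0"] by auto
  then obtain \<phi> :: "'v \<Rightarrow> real" where \<phi>: "linear \<phi>" "\<phi> (v a) = 1"
    using linear_independent_extend[of "{v a}" "\<lambda>_. 1"] by auto
  have IH: "\<exists>f. linear f \<and> (\<forall>i\<in>F. (0::real) < f (v i))"
  proof (rule insert.IH)
    fix c i assume c: "\<And>i. i \<in> F \<Longrightarrow> 0 \<le> c i" "(\<Sum>i\<in>F. c i *\<^sub>R v i) = 0" "i \<in> F"
    have "(0::real) = 0 \<and> (\<forall>i\<in>F. c i = 0)" by (rule rel) (use c(1,2) in simp_all)
    then show "c i = 0" using c(3) by blast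
  qed
  \<comment> \<open>Projection along \<open>v a\<close> onto the kernel of \<open>\<phi>\<close>.
    Either the projections again satisfy no nonnegative relation, and a functional for them is
    perturbed by a small multiple of \<open>\<phi>\<close>; or such a relation writes a positive
    multiple of \<open>v a\<close> through the other vectors, and any functional positive on those
    will do.\<close>
  define v' where "v' i = v i - \<phi> (v i) *\<^sub>R v a" for i
  show ?case
  proof (cases "\<forall>c i. (\<forall>i\<in>F. 0 \<le> c i) \<longrightarrow> (\<Sum>i\<in>F. c i *\<^sub>R v' i) = 0 \<longrightarrow> i \<in> F \<longrightarrow> c i = (0::real)")
    case True
    then have "\<exists>f. linear f \<and> (\<forall>i\<in>F. (0::real) < f (v' i))"
      by (intro insert.IH) auto
    then obtain g :: "'v \<Rightarrow> real" where g: "linear g" "\<And>i. i \<in> F \<Longrightarrow> 0 < g (v' i)" by blast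
    \<comment> \<open>Finitely many strict inequalities survive a small perturbation; the 1 in the
      bound for \<open>e'\<close> avoids a division by zero.\<close>
    have "\<exists>e>0. \<forall>i\<in>F. 0 < g (v' i) + e * \<phi> (v i)"
      using insert.hyps(1) g(2)
    proof (induction F rule: finite_induct)
      case empty
      show ?case by (intro exI[of _ 1]) auto
    next
      case (insert j F)
      then obtain e where e: "e > 0" "\<forall>i\<in>F. 0 < g (v' i) + e * \<phi> (v i)" by auto
      define e' where "e' = min e (g (v' j) / (1 + \<bar>\<phi> (v j)\<bar>))"
      have pos: "g (v' j) > 0" using insert.prems by simp
      then have e'0: "e' > 0" using e by (simp add: e'_def add_pos_nonneg)
      have "e' * \<bar>\<phi> (v j)\<bar> \<le> (g (v' j) / (1 + \<bar>\<phi> (v j)\<bar>)) * \<bar>\<phi> (v j)\<bar>"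
        by (intro mult_right_mono) (auto simp: e'_def)
      also have "\<dots> < g (v' j)"
        using pos by (simp add: field_simps add_pos_nonneg)
      finally have "0 < g (v' j) + e' * \<phi> (v j)"
        using e'0 by (smt (verit) mult_minus_right mult_left_mono abs_ge_minus_self)
      moreover have "0 < g (v' i) + e' * \<phi> (v i)" if "i \<in> F" for i
      proof (cases "\<phi> (v i) \<ge> 0")
        case True
        then show ?thesis using insert.prems[of i] that e'0 by (simp add: add_pos_nonneg)
      next
        case False
        then have "e * \<phi> (v i) \<le> e' * \<phi> (v i)"
          by (intro mult_right_mono_neg) (auto simp: e'_def)
        then show ?thesis using e(2) that by force
      qed
      ultimately show ?case using e'0 by auto
    qed
    then obtain e where e: "e > 0" "\<forall>i\<in>F. 0 < g (v' i) + e * \<phi> (v i)" by blast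
    define f where "f x = g (x - \<phi> x *\<^sub>R v a) + e * \<phi> x" for x
    have "linear f"
      by (rule linearI)
        (simp_all add: f_def linear_diff[OF g(1)] linear_add[OF g(1)] linear_cmul[OF g(1)]
          linear_add[OF \<phi>(1)] linear_cmul[OF \<phi>(1)] algebra_simps)
    moreover have "0 < f (v a)"
      using \<phi> e(1) g(1) by (simp add: f_def linear_0)
    moreover have "0 < f (v i)" if "i \<in> F" for i
      using e(2) that by (simp add: f_def v'_def)
    ultimately show ?thesis by auto
  next
    case False
    then obtain c i0 where c: "\<And>i. i \<in> F \<Longrightarrow> 0 \<le> c i" "(\<Sum>i\<in>F. c i *\<^sub>R v' i) = 0" "i0 \<in> F" "c i0 \<noteq> 0"
      by blast
    define k where "k = (\<Sum>i\<in>F. c i * \<phi> (v i))"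
    have eq: "(\<Sum>i\<in>F. c i *\<^sub>R v i) = k *\<^sub>R v a"
      using c(2) by (simp add: v'_def k_def scaleR_diff_right sum_subtractf scaleR_sum_left)
    obtain f where f: "linear f" "\<And>i. i \<in> F \<Longrightarrow> (0::real) < f (v i)" using IH by blast
    \<comment> \<open>Otherwise \<open>- k\<close> would be a nonnegative coefficient of
      \<open>v a\<close> in a relation, and all \<open>c i\<close> would vanish.\<close>
    have "k > 0"
    proof (rule ccontr)
      assume "\<not> k > 0"
      then have "- k = 0 \<and> (\<forall>i\<in>F. c i = 0)" by (intro rel) (use c(1) eq in simp_all)
      then show False using c by blast
    qed
    have "k * f (v a) = (\<Sum>i\<in>F. c i * f (v i))"
      using arg_cong[OF eq, of f] f(1) by (simp add: linear_sum linear_cmul)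
    also have "\<dots> > 0"
      using c f(2) insert.hyps(1) by (intro sum_pos2[of F i0]) (auto simp: less_imp_le order.not_eq_order_implies_strict)
    finally have "f (v a) > 0" using \<open>k > 0\<close> by (simp add: zero_less_mult_iff)
    then show ?thesis using f by auto
  qed
qed


section \<open>The action of a Coxeter group on a based root system\<close>

context based_root_system
begin

section \<open>Calculus of the form and of its reflections\<close>

lemma B_add_left: "B (x + y) z = B x z + B y z"
  and B_add_right: "B z (x + y) = B z x + B z y"
  and B_diff_left: "B (x - y) z = B x z - B y z"
  and B_diff_right: "B z (x - y) = B z x - B z y"
  and B_minus_left: "B (- x) z = - B x z"
  and B_minus_right: "B z (- x) = - B z x"
  and B_scale_left: "B (c *\<^sub>R x) z = c * B x z"
  and B_scale_right: "B z (c *\<^sub>R x) = c * B z x"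
  and B_zero_left: "B 0 z = 0"
  and B_zero_right: "B z 0 = 0"
  using B_bilinear
  by (simp_all add: bilinear_ladd bilinear_radd bilinear_lsub bilinear_rsub bilinear_lneg bilinear_rneg
      bilinear_lmul bilinear_rmul bilinear_lzero bilinear_rzero)

lemmas B_simps = B_add_left B_add_right B_diff_left B_diff_right B_minus_left B_minus_right
  B_scale_left B_scale_right B_zero_left B_zero_right

lemma B_sum_left: "B (\<Sum>i\<in>I. f i) z = (\<Sum>i\<in>I. B (f i) z)"
  by (induction I rule: infinite_finite_induct) (simp_all add: B_simps)

lemma linear_reflection: "linear (B_reflection \<beta>)"
  by (auto simp: linear_iff B_reflection_def B_simps algebra_simps)

lemma reflection_invariant:
  assumes "B \<beta> \<beta> = 1"
  shows "B (B_reflection \<beta> x) (B_reflection \<beta> y) = B x y"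
  using assms B_sym[of x \<beta>] by (simp add: B_reflection_def B_simps algebra_simps)

lemma reflection_involutive:
  assumes "B \<beta> \<beta> = 1"
  shows "B_reflection \<beta> (B_reflection \<beta> x) = x"
  using assms by (simp add: B_reflection_def B_simps algebra_simps)

lemma m_ge_2:
  assumes "s \<in> S" "t \<in> S" "s \<noteq> t" "m s t = enat k"
  shows "2 \<le> k"
  using m_off_diag[OF assms(1-3)] assms(4) by (simp add: numeral_eq_enat)

text \<open>For distinct \<open>s\<close>, \<open>t\<close>, the product rotates the plane of the
  two simple roots by 2 pi/k and fixes its orthogonal complement. The Gram determinant sin^2(pi/k)
  is positive, so plane and complement together give all of V.\<close>

lemma reflection_relation:
  assumes "s \<in> S" "t \<in> S" "m s t = enat k"
  shows "((B_reflection (\<alpha> s) \<circ> B_reflection (\<alpha> t)) ^^ k) v = v"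
proof (cases "s = t")
  case True
  then have "k = 1" using assms m_diag[of s] by (simp add: one_enat_def)
  then show ?thesis using True assms by (simp add: reflection_involutive B_diag)
next
  case False
  let ?R = "B_reflection (\<alpha> s) \<circ> B_reflection (\<alpha> t)"
  have k: "k \<ge> 2" using m_ge_2 False assms by blast
  define \<phi> where "\<phi> = pi / real k"
  have \<phi>: "0 < \<phi>" "\<phi> < pi" using k by (auto simp: \<phi>_def field_simps)
  then have sin0: "sin \<phi> > 0" by (intro sin_gt_zero) auto
  have B1: "B (\<alpha> s) (\<alpha> s) = 1" "B (\<alpha> t) (\<alpha> t) = 1" using assms B_diag by auto
  have B2: "B (\<alpha> s) (\<alpha> t) = - cos \<phi>" using B_finite[OF assms(1,2) False assms(3)] by (simp add: \<phi>_def)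
  then have B3: "B (\<alpha> t) (\<alpha> s) = - cos \<phi>" using B_sym by metis
  \<comment> \<open>Vectors of the plane spaced by the angle \<open>\<phi>\<close>. Both simple
    roots occur, up to a nonzero factor, as \<open>E 1\<close> and \<open>E 0\<close>, and the
    product of the reflections shifts \<open>j\<close> by 2.\<close>
  define E where "E j = sin (j * \<phi>) *\<^sub>R \<alpha> s + sin ((j - 1) * \<phi>) *\<^sub>R \<alpha> t" for j :: real
  have sin_rec: "2 * cos \<phi> * sin x - sin (x - \<phi>) = sin (x + \<phi>)" for x
    by (simp add: sin_add sin_diff)
  have two: "(2 * y) *\<^sub>R x = y *\<^sub>R x + y *\<^sub>R x" for y :: real and x :: 'v
    by (simp flip: scaleR_add_left)
  have RE: "?R (E j) = E (j + 2)" for j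
  proof -
    have a1: "2 * cos \<phi> * sin (j * \<phi>) - sin ((j - 1) * \<phi>) = sin ((j + 1) * \<phi>)"
      using sin_rec[of "j * \<phi>"] by (simp add: algebra_simps)
    have a2: "2 * cos \<phi> * sin ((j + 1) * \<phi>) - sin (j * \<phi>) = sin ((j + 2) * \<phi>)"
      using sin_rec[of "(j + 1) * \<phi>"] by (simp add: algebra_simps)
    have "B_reflection (\<alpha> t) (E j) = sin (j * \<phi>) *\<^sub>R \<alpha> s + (2 * cos \<phi> * sin (j * \<phi>) - sin ((j - 1) * \<phi>)) *\<^sub>R \<alpha> t"
      by (simp add: B_reflection_def E_def B_simps B1 B3 algebra_simps two)
    also have "\<dots> = sin (j * \<phi>) *\<^sub>R \<alpha> s + sin ((j + 1) * \<phi>) *\<^sub>R \<alpha> t" by (simp add: a1)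
    finally have "?R (E j) = B_reflection (\<alpha> s) \<dots>" by simp
    also have "\<dots> = (2 * cos \<phi> * sin ((j + 1) * \<phi>) - sin (j * \<phi>)) *\<^sub>R \<alpha> s + sin ((j + 1) * \<phi>) *\<^sub>R \<alpha> t"
      by (simp add: B_reflection_def B_simps B1 B2 algebra_simps two)
    also have "\<dots> = E (j + 2)"
      unfolding a2 by (simp add: E_def algebra_simps)
    finally show ?thesis .
  qed
  have RnE: "(?R ^^ n) (E j) = E (j + 2 * real n)" for n j
  proof (induction n)
    case (Suc n)
    have "(?R ^^ Suc n) (E j) = ?R ((?R ^^ n) (E j))" by simp
    also have "\<dots> = ?R (E (j + 2 * real n))" by (simp only: Suc)
    also have "\<dots> = E (j + 2 * real n + 2)" by (rule RE)
    also have "\<dots> = E (j + 2 * real (Suc n))" by (simp add: algebra_simps)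
    finally show ?case .
  qed simp
  have "real k * \<phi> = pi" using k by (simp add: \<phi>_def)
  then have per: "(j + 2 * real k) * \<phi> = j * \<phi> + 2 * pi" "(j + 2 * real k - 1) * \<phi> = (j - 1) * \<phi> + 2 * pi" for j
    by (simp_all add: algebra_simps)
  have RkE: "(?R ^^ k) (E j) = E j" for j
    unfolding RnE by (simp only: E_def per sin_periodic)
  have lin: "linear (?R ^^ n)" for n
  proof (induction n)
    case (Suc n)
    show ?case unfolding funpow.simps
      by (intro linear_compose[OF Suc] linear_compose[OF linear_reflection linear_reflection])
  qed (simp add: linear_iff)
  have "E 1 = sin \<phi> *\<^sub>R \<alpha> s" "E 0 = - sin \<phi> *\<^sub>R \<alpha> t" by (simp_all add: E_def)
  then have Ra: "(?R ^^ k) (\<alpha> s) = \<alpha> s" and Rb: "(?R ^^ k) (\<alpha> t) = \<alpha> t"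
    using RkE[of 1] RkE[of 0] linear_cmul[OF lin, of k "sin \<phi>" "\<alpha> s"] linear_cmul[OF lin, of k "- sin \<phi>" "\<alpha> t"] sin0
    by auto
  \<comment> \<open>The Gram determinant; \<open>p\<close> and \<open>q\<close> come from Cramer's
    rule and make \<open>x\<close> orthogonal to both simple roots.\<close>
  define D where "D = 1 - (cos \<phi>)\<^sup>2"
  have D: "D > 0" using sin0 by (simp add: D_def sin_squared_eq[symmetric])
  define p where "p = (B (\<alpha> s) v + cos \<phi> * B (\<alpha> t) v) / D"
  define q where "q = (B (\<alpha> t) v + cos \<phi> * B (\<alpha> s) v) / D"
  have pq: "p - cos \<phi> * q = B (\<alpha> s) v" "q - cos \<phi> * p = B (\<alpha> t) v"
  proof -
    have Dp: "D * p = B (\<alpha> s) v + cos \<phi> * B (\<alpha> t) v"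
      and Dq: "D * q = B (\<alpha> t) v + cos \<phi> * B (\<alpha> s) v"
      using D by (simp_all add: p_def q_def)
    have "D * (p - cos \<phi> * q) = D * p - cos \<phi> * (D * q)" "D * (q - cos \<phi> * p) = D * q - cos \<phi> * (D * p)"
      by (simp_all add: algebra_simps)
    then have "D * (p - cos \<phi> * q) = D * B (\<alpha> s) v" "D * (q - cos \<phi> * p) = D * B (\<alpha> t) v"
      unfolding Dp Dq by (simp_all add: D_def algebra_simps power2_eq_square)
    then show "p - cos \<phi> * q = B (\<alpha> s) v" "q - cos \<phi> * p = B (\<alpha> t) v" using D by simp_all
  qed
  define x where "x = v - p *\<^sub>R \<alpha> s - q *\<^sub>R \<alpha> t"
  have "B (\<alpha> s) x = 0" "B (\<alpha> t) x = 0"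
    by (simp_all add: x_def B_simps B1 B2 B3 pq[symmetric] algebra_simps)
  then have "?R x = x" by (simp add: B_reflection_def)
  then have Rx: "(?R ^^ n) x = x" for n by (induction n) auto
  have v: "v = x + (p *\<^sub>R \<alpha> s + q *\<^sub>R \<alpha> t)" by (simp add: x_def)
  have "(?R ^^ k) (x + (p *\<^sub>R \<alpha> s + q *\<^sub>R \<alpha> t)) = x + (p *\<^sub>R \<alpha> s + q *\<^sub>R \<alpha> t)"
    by (simp only: linear_add[OF lin] linear_cmul[OF lin] Ra Rb Rx)
  then show ?thesis unfolding v[symmetric] .
qed

section \<open>Action of words; well-definedness, linearity and invariance of
  \<open>act\<close>\<close>

definition word_act :: "'w list \<Rightarrow> 'v \<Rightarrow> 'v" where
  "word_act xs = foldr (\<lambda>s g. B_reflection (\<alpha> s) \<circ> g) xs id"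

lemma word_act_Nil [simp]: "word_act [] = id"
  and word_act_Cons [simp]: "word_act (s # xs) = B_reflection (\<alpha> s) \<circ> word_act xs"
  by (simp_all add: word_act_def)

lemma word_act_append: "word_act (xs @ ys) = word_act xs \<circ> word_act ys"
  by (induction xs) (auto simp: fun_eq_iff)

lemma word_act_replicate:
  "word_act (concat (replicate k [s, t])) = (B_reflection (\<alpha> s) \<circ> B_reflection (\<alpha> t)) ^^ k"
  by (induction k) (auto simp: fun_eq_iff)

lemma coxeter_equiv_word_act: "coxeter_equiv S m xs ys \<Longrightarrow> word_act xs = word_act ys"
proof (induction rule: coxeter_equiv.induct)
  case (relation xs ys s t k)
  then show ?case
    using reflection_relation[of s t k] by (simp add: word_act_append word_act_replicate fun_eq_iff)
qed auto

lemma coxeter_equiv_parity: "coxeter_equiv S m xs ys \<Longrightarrow> even (length xs) = even (length ys)"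
proof (induction rule: coxeter_equiv.induct)
  case (relation xs ys s t k)
  have "length (concat (replicate k [s, t])) = 2 * k" by (induction k) auto
  then show ?case by simp
qed auto

lemma word_prod_Nil [simp]: "word_prod W [] = \<one>"
  and word_prod_Cons [simp]: "word_prod W (s # xs) = s \<otimes> word_prod W xs"
  by (simp_all add: word_prod_def)

lemma S_closed [simp, intro]: "s \<in> S \<Longrightarrow> s \<in> carrier W"
  using S_subset by auto

lemma word_prod_closed [simp, intro]: "set xs \<subseteq> S \<Longrightarrow> word_prod W xs \<in> carrier W"
  by (induction xs) auto

lemma word_prod_append:
  "\<lbrakk>set xs \<subseteq> S; set ys \<subseteq> S\<rbrakk> \<Longrightarrow> word_prod W (xs @ ys) = word_prod W xs \<otimes> word_prod W ys"
  by (induction xs) (auto simp: m_assoc)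

lemma S_square: "s \<in> S \<Longrightarrow> s \<otimes> s = \<one>"
  using presentation[of "[s, s]" "[]"] coxeter_equiv.relation[of "[]" S "[]" s s m 1] m_diag[of s]
  by (auto simp: one_enat_def S_closed)

lemma S_inv: "s \<in> S \<Longrightarrow> inv s = s"
  using S_square S_closed by (metis inv_equality)

lemma S_cancel: "\<lbrakk>s \<in> S; w \<in> carrier W\<rbrakk> \<Longrightarrow> s \<otimes> (s \<otimes> w) = w"
  using S_square by (simp add: m_assoc[symmetric])

lemma S_cancel_right: "\<lbrakk>s \<in> S; w \<in> carrier W\<rbrakk> \<Longrightarrow> w \<otimes> s \<otimes> s = w"
  using S_square by (simp add: m_assoc)

lemma word_exists:
  assumes "w \<in> carrier W"
  shows "\<exists>xs. set xs \<subseteq> S \<and> word_prod W xs = w"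
proof -
  have "w \<in> generate W S" using assms generates by simp
  then show ?thesis
  proof (induction rule: generate.induct)
    case one
    show ?case by (intro exI[of _ "[]"]) simp
  next
    case (incl h)
    then show ?case by (intro exI[of _ "[h]"]) auto
  next
    case (inv h)
    then show ?case by (intro exI[of _ "[h]"]) (auto simp: S_inv)
  next
    case (eng h1 h2)
    then obtain xs ys where "set xs \<subseteq> S" "word_prod W xs = h1" "set ys \<subseteq> S" "word_prod W ys = h2" by auto
    then show ?case by (intro exI[of _ "xs @ ys"]) (auto simp: word_prod_append)
  qed
qed

lemma act_word: "set xs \<subseteq> S \<Longrightarrow> act (word_prod W xs) = word_act xs"
  unfolding act_def word_act_def[symmetric]
  using presentation coxeter_equiv_word_act by (intro the_equality) blast+

lemma act_one [simp]: "act \<one> = id"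
  using act_word[of "[]"] by simp

lemma act_mult: "\<lbrakk>u \<in> carrier W; v \<in> carrier W\<rbrakk> \<Longrightarrow> act (u \<otimes> v) x = act u (act v x)"
  using word_exists[of u] word_exists[of v]
  by (metis act_word comp_apply word_act_append word_prod_append set_append Un_subset_iff)

lemma act_simple: "s \<in> S \<Longrightarrow> act s = B_reflection (\<alpha> s)"
  using act_word[of "[s]"] by simp

lemma linear_act: "w \<in> carrier W \<Longrightarrow> linear (act w)"
proof -
  have "linear (word_act xs)" for xs
  proof (induction xs)
    case Nil
    show ?case by (simp add: linear_iff)
  next
    case (Cons a xs)
    then show ?case unfolding word_act_Cons by (intro linear_compose linear_reflection)
  qed
  then show "w \<in> carrier W \<Longrightarrow> linear (act w)" using word_exists act_word by metis
qed

lemma B_act: "w \<in> carrier W \<Longrightarrow> B (act w x) (act w y) = B x y"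
proof -
  have "set xs \<subseteq> S \<Longrightarrow> B (word_act xs x) (word_act xs y) = B x y" for xs
    by (induction xs) (auto simp: reflection_invariant B_diag)
  then show "w \<in> carrier W \<Longrightarrow> B (act w x) (act w y) = B x y" using word_exists act_word by metis
qed

lemma act_inv_act [simp]: "w \<in> carrier W \<Longrightarrow> act (inv w) (act w x) = x"
  and act_act_inv [simp]: "w \<in> carrier W \<Longrightarrow> act w (act (inv w) x) = x"
  using act_mult[of "inv w" w x] act_mult[of w "inv w" x] by auto

lemma act_eq_iff: "w \<in> carrier W \<Longrightarrow> act w x = act w y \<longleftrightarrow> x = y"
  by (metis act_inv_act)

lemmas act_add = linear_add[OF linear_act]
  and act_diff = linear_diff[OF linear_act]
  and act_minus = linear_neg[OF linear_act]
  and act_scale = linear_cmul[OF linear_act]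
  and act_zero = linear_0[OF linear_act]

end

section \<open>Length\<close>

text \<open>Chebyshev polynomials of the second kind with the index shifted by one, so that the
  value at cos \<phi> is sin(n \<phi>) / sin \<phi>. The recursion also covers arguments at least 1,
  which belong to infinite dihedral groups.\<close>

fun chebyshev_U :: "real \<Rightarrow> nat \<Rightarrow> real" where
  "chebyshev_U d 0 = 0"
| "chebyshev_U d (Suc 0) = 1"
| "chebyshev_U d (Suc (Suc n)) = 2 * d * chebyshev_U d (Suc n) - chebyshev_U d n"

lemma sin_chebyshev_U: "sin \<phi> * chebyshev_U (cos \<phi>) n = sin (real n * \<phi>)"
proof (induction "cos \<phi>" n rule: chebyshev_U.induct)
  case (3 n)
  have "sin \<phi> * chebyshev_U (cos \<phi>) (Suc (Suc n)) =
      2 * cos \<phi> * sin (real (Suc n) * \<phi>) - sin (real n * \<phi>)"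
    by (simp only: 3[symmetric] chebyshev_U.simps) (simp add: algebra_simps)
  also have "\<dots> = sin (real (Suc n) * \<phi> + \<phi>)"
  proof -
    have "sin (real n * \<phi>) = sin (real (Suc n) * \<phi> - \<phi>)" by (simp add: algebra_simps)
    then show ?thesis by (simp only: sin_diff sin_add) (simp add: algebra_simps)
  qed
  finally show ?case by (simp add: algebra_simps)
qed simp_all

text \<open>The increments grow by (2d - 2) times the current value; the second conjunct supplies
  the nonnegativity of that value in the induction.\<close>

lemma chebyshev_U_increasing:
  assumes "1 \<le> d"
  shows "chebyshev_U d n + 1 \<le> chebyshev_U d (Suc n) \<and> real n \<le> chebyshev_U d n"
proof (induction n)
  case (Suc n)
  have "chebyshev_U d (Suc n) \<ge> 0" using Suc by (smt (verit) of_nat_0_le_iff)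
  then have "1 * chebyshev_U d (Suc n) \<le> d * chebyshev_U d (Suc n)"
    using assms by (intro mult_right_mono) auto
  then show ?case using Suc unfolding chebyshev_U.simps mult.assoc of_nat_Suc by linarith
qed simp

text \<open>Letters are prepended: the last letter is always the second argument and only the first
  letter depends on the parity. This is the shape of alternating suffixes of a word.\<close>

fun alt :: "'a \<Rightarrow> 'a \<Rightarrow> nat \<Rightarrow> 'a list" where
  "alt s t 0 = []"
| "alt s t (Suc n) = (if even n then t else s) # alt s t n"

lemma length_alt [simp]: "length (alt s t n) = n"
  by (induction n) auto

lemma set_alt: "set (alt s t n) \<subseteq> {s, t}"
  by (induction n) auto

lemma alt_snoc: "alt s t (Suc n) = alt t s n @ [t]"
  by (induction n) auto

lemma alt_add: "alt s t (n + k) = (if even k then alt s t n else alt t s n) @ alt s t k"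
  by (induction n) auto

lemma rev_alt: "rev (alt s t n) = (if even n then alt t s n else alt s t n)"
proof (induction n arbitrary: s t)
  case (Suc n)
  have "rev (alt s t (Suc n)) = t # rev (alt t s n)" by (simp only: alt_snoc rev_append) simp
  then show ?case using Suc[of t s] by simp
qed simp

lemma alt_double: "alt s t (2 * k) = concat (replicate k [s, t])"
  by (induction k) auto

locale finite_based_root_system = based_root_system W S m B \<alpha>
  for W :: "('w, 'x) monoid_scheme" (structure)
    and S :: "'w set"
    and m :: "'w \<Rightarrow> 'w \<Rightarrow> enat"
    and B :: "'v::real_vector \<Rightarrow> 'v \<Rightarrow> real"
    and \<alpha> :: "'w \<Rightarrow> 'v" +
  assumes finite_S: "finite S"
begin

section \<open>Length and parity\<close>

lemma word_prod_len: "set xs \<subseteq> S \<Longrightarrow> len (word_prod W xs) \<le> length xs"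
  unfolding len_def by (rule Least_le) auto

lemma reduced_word:
  assumes "w \<in> carrier W"
  obtains xs where "set xs \<subseteq> S" "word_prod W xs = w" "length xs = len w"
proof -
  have "\<exists>n xs. set xs \<subseteq> S \<and> length xs = n \<and> word_prod W xs = w"
    using word_exists[OF assms] by auto
  from LeastI_ex[OF this] show ?thesis using that unfolding len_def by blast
qed

lemma len_one [simp]: "len \<one> = 0"
  using word_prod_len[of "[]"] by simp

lemma len_eq_0: "w \<in> carrier W \<Longrightarrow> len w = 0 \<longleftrightarrow> w = \<one>"
  by (metis len_one length_0_conv reduced_word word_prod_Nil)

lemma len_parity: "set xs \<subseteq> S \<Longrightarrow> even (len (word_prod W xs)) = even (length xs)"
  by (metis coxeter_equiv_parity presentation reduced_word word_prod_closed)

lemma len_mult_le: "\<lbrakk>u \<in> carrier W; v \<in> carrier W\<rbrakk> \<Longrightarrow> len (u \<otimes> v) \<le> len u + len v"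
  by (metis length_append reduced_word word_prod_append word_prod_len set_append Un_subset_iff)

lemma len_mult_parity: "\<lbrakk>u \<in> carrier W; v \<in> carrier W\<rbrakk> \<Longrightarrow> even (len (u \<otimes> v)) = even (len u + len v)"
  by (metis length_append reduced_word word_prod_append len_parity set_append Un_subset_iff)

lemma word_prod_rev: "set xs \<subseteq> S \<Longrightarrow> word_prod W (rev xs) = inv (word_prod W xs)"
  by (induction xs) (auto simp: word_prod_append inv_mult_group S_inv)

lemma len_inv_le: "w \<in> carrier W \<Longrightarrow> len (inv w) \<le> len w"
  by (metis length_rev reduced_word set_rev word_prod_len word_prod_rev)

lemma len_inv [simp]: "w \<in> carrier W \<Longrightarrow> len (inv w) = len w"
  by (metis inv_closed inv_inv len_inv_le le_antisym)

lemma len_simple [simp]: "s \<in> S \<Longrightarrow> len s = 1"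
  using word_prod_len[of "[s]"] len_parity[of "[s]"] by (auto simp: le_Suc_eq)

lemma len_mult_simple:
  assumes "s \<in> S" "w \<in> carrier W"
  shows "len (s \<otimes> w) = len w + 1 \<or> len (s \<otimes> w) + 1 = len w"
proof -
  have "len (s \<otimes> w) \<le> len w + 1" using len_mult_le[of s w] assms by simp
  moreover have "len w \<le> len (s \<otimes> w) + 1"
    using len_mult_le[of s "s \<otimes> w"] assms by (simp add: S_cancel)
  moreover have "even (len (s \<otimes> w)) \<noteq> even (len w)"
    using len_mult_parity[of s w] assms by simp
  ultimately show ?thesis by presburger
qed

lemma len_mult_simple_right:
  assumes "s \<in> S" "w \<in> carrier W"
  shows "len (w \<otimes> s) = len w + 1 \<or> len (w \<otimes> s) + 1 = len w"
  using len_mult_simple[of s "inv w"] assms len_inv[of "w \<otimes> s"]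
  by (simp add: inv_mult_group S_inv)

lemma left_descent_exists:
  assumes "w \<in> carrier W" "w \<noteq> \<one>"
  obtains s where "s \<in> S" "len (s \<otimes> w) + 1 = len w"
proof -
  obtain xs where xs: "set xs \<subseteq> S" "word_prod W xs = w" "length xs = len w"
    using reduced_word assms by blast
  with assms obtain s ys where "xs = s # ys" by (cases xs) auto
  with xs have "s \<in> S" "len (s \<otimes> w) < len w"
    using word_prod_len[of ys] by (auto simp: S_cancel)
  then show ?thesis using that len_mult_simple[of s w] assms by force
qed

lemma right_descent_exists:
  assumes "w \<in> carrier W" "w \<noteq> \<one>"
  obtains s where "s \<in> S" "len (w \<otimes> s) + 1 = len w"
proof -
  have "inv w \<noteq> \<one>" using assms by (metis inv_inv inv_one)
  then obtain s where "s \<in> S" "len (s \<otimes> inv w) + 1 = len w"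
    using left_descent_exists[of "inv w"] assms by auto
  then show ?thesis using that[of s] len_inv[of "w \<otimes> s"] assms by (simp add: inv_mult_group S_inv)
qed

text \<open>Cut the word for (st)^k = 1 in the middle: each half is the inverse of the other, and
  inverting a word in involutions reverses it.\<close>

lemma braid:
  assumes "s \<in> S" "t \<in> S" "m s t = enat k"
  shows "word_prod W (alt s t k) = word_prod W (alt t s k)"
proof -
  have sets: "set (alt s t k) \<subseteq> S" "set (alt t s k) \<subseteq> S" "set (alt s t (2 * k)) \<subseteq> S"
    using set_alt[of s t] set_alt[of t s] assms(1,2) by blast+
  have "coxeter_equiv S m (alt s t (2 * k)) []"
    using coxeter_equiv.relation[of "[]" S "[]" s t m k] assms by (simp add: alt_double)
  then have 1: "word_prod W (alt s t (2 * k)) = \<one>"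
    using presentation[of "alt s t (2 * k)" "[]"] sets by simp
  have split: "alt s t (2 * k) = (if even k then alt s t k else alt t s k) @ alt s t k"
    using alt_add[of s t k k] by (simp add: mult_2)
  have "word_prod W (if even k then alt s t k else alt t s k) \<otimes> word_prod W (alt s t k) = \<one>"
    using 1 word_prod_append[of "if even k then alt s t k else alt t s k" "alt s t k"] sets
    by (simp add: split split: if_splits)
  then have eq: "word_prod W (if even k then alt s t k else alt t s k) = word_prod W (rev (alt s t k))"
    using sets by (simp add: word_prod_rev inv_equality split: if_splits)
  show ?thesis
    using eq by (simp add: rev_alt split: if_splits)
qed

section \<open>The positive functional and the cone of the simple roots\<close>

definition lam :: "'v \<Rightarrow> real" where
  "lam = (SOME f. linear f \<and> (\<forall>s\<in>S. 0 < f (\<alpha> s)))"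

lemma linear_lam: "linear lam" and lam_simple: "s \<in> S \<Longrightarrow> 0 < lam (\<alpha> s)"
proof -
  have "\<exists>f :: 'v \<Rightarrow> real. linear f \<and> (\<forall>s\<in>S. 0 < f (\<alpha> s))"
  proof (rule gordan[OF finite_S])
    fix c s assume "\<And>s. s \<in> S \<Longrightarrow> 0 \<le> c s" "(\<Sum>s\<in>S. c s *\<^sub>R \<alpha> s) = 0" "s \<in> S"
    then show "c s = 0" by (rule no_nonneg_relation[OF finite_S subset_refl])
  qed
  from someI_ex[OF this] show "linear lam" "s \<in> S \<Longrightarrow> 0 < lam (\<alpha> s)"
    unfolding lam_def by blast+
qed

lemmas lam_simps = linear_add[OF linear_lam] linear_diff[OF linear_lam] linear_neg[OF linear_lam]
  linear_cmul[OF linear_lam] linear_0[OF linear_lam] linear_sum[OF linear_lam]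

text \<open>Coefficients are indexed by all of \<open>S\<close> rather than by finite sets of
  vectors, so that sums can be formed coefficientwise; \<open>nonneg_cone_simple\<close> links this
  to the definition of positive roots.\<close>

definition simple_cone :: "'v set" where
  "simple_cone = {(\<Sum>s\<in>S. c s *\<^sub>R \<alpha> s) | c. \<forall>s\<in>S. 0 \<le> c s}"

lemma simple_cone_add: "\<lbrakk>x \<in> simple_cone; y \<in> simple_cone\<rbrakk> \<Longrightarrow> x + y \<in> simple_cone"
proof -
  assume "x \<in> simple_cone" "y \<in> simple_cone"
  then obtain c d where "x = (\<Sum>s\<in>S. c s *\<^sub>R \<alpha> s)" "y = (\<Sum>s\<in>S. d s *\<^sub>R \<alpha> s)"
    "\<forall>s\<in>S. 0 \<le> c s" "\<forall>s\<in>S. 0 \<le> d s" unfolding simple_cone_def by blast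
  then show ?thesis unfolding simple_cone_def
    by (intro CollectI exI[of _ "\<lambda>s. c s + d s"]) (auto simp: scaleR_add_left sum.distrib)
qed

lemma simple_cone_scale: "\<lbrakk>x \<in> simple_cone; 0 \<le> k\<rbrakk> \<Longrightarrow> k *\<^sub>R x \<in> simple_cone"
proof -
  assume "x \<in> simple_cone" "0 \<le> k"
  then obtain c where "x = (\<Sum>s\<in>S. c s *\<^sub>R \<alpha> s)" "\<forall>s\<in>S. 0 \<le> c s" unfolding simple_cone_def by blast
  then show ?thesis using \<open>0 \<le> k\<close> unfolding simple_cone_def
    by (intro CollectI exI[of _ "\<lambda>s. k * c s"]) (auto simp: scaleR_sum_right)
qed

lemma simple_in_cone: "s \<in> S \<Longrightarrow> \<alpha> s \<in> simple_cone"
  unfolding simple_cone_def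
  by (intro CollectI exI[of _ "\<lambda>t. if t = s then 1 else 0"])
    (auto simp: finite_S if_distrib[of "\<lambda>x. x *\<^sub>R _"] cong: if_cong)

lemma lam_cone: "x \<in> simple_cone \<Longrightarrow> 0 \<le> lam x"
  by (auto simp: simple_cone_def lam_simps intro!: sum_nonneg mult_nonneg_nonneg less_imp_le[OF lam_simple])

lemma lam_cone_0:
  assumes "x \<in> simple_cone" "lam x = 0"
  shows "x = 0"
proof -
  obtain c where c: "x = (\<Sum>s\<in>S. c s *\<^sub>R \<alpha> s)" "\<forall>s\<in>S. 0 \<le> c s"
    using assms unfolding simple_cone_def by blast
  have "(\<Sum>s\<in>S. c s * lam (\<alpha> s)) = 0" using assms c by (simp add: lam_simps)
  then have "\<forall>s\<in>S. c s * lam (\<alpha> s) = 0"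
    using c lam_simple by (subst (asm) sum_nonneg_eq_0_iff[OF finite_S]) (auto intro: mult_nonneg_nonneg less_imp_le)
  then have "\<forall>s\<in>S. c s = 0" using lam_simple by force
  then show ?thesis using c by simp
qed

lemma B_simple_le_0:
  assumes "s \<in> S" "t \<in> S" "s \<noteq> t"
  shows "B (\<alpha> s) (\<alpha> t) \<le> 0"
proof (cases "m s t")
  case (enat k)
  have k: "2 \<le> k" using m_ge_2[OF assms enat] .
  have "0 \<le> pi / real k" by simp
  moreover have "pi / real k \<le> pi / 2" using k by (auto simp: field_simps)
  ultimately have "0 \<le> cos (pi / real k)" using pi_ge_zero by (intro cos_ge_zero) linarith+
  then show ?thesis using B_finite[OF assms enat] by simp
next
  case infinity
  then show ?thesis using B_infinite[OF assms] by simp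
qed

lemma inj_on_simple: "inj_on \<alpha> S"
  by (rule inj_onI) (metis B_diag B_simple_le_0 not_one_le_zero)

lemma nonneg_cone_simple: "nonneg_cone (\<alpha> ` S) = simple_cone"
proof (intro subset_antisym subsetI)
  fix x assume "x \<in> nonneg_cone (\<alpha> ` S)"
  then obtain F c where F: "finite F" "F \<subseteq> \<alpha> ` S" "\<forall>x\<in>F. 0 \<le> c x" "x = (\<Sum>x\<in>F. c x *\<^sub>R x)"
    unfolding nonneg_cone_def by blast
  have "x \<in> simple_cone" unfolding F(4) using F(1-3)
  proof (induction F rule: finite_induct)
    case empty
    show ?case unfolding simple_cone_def by (intro CollectI exI[of _ "\<lambda>_. 0"]) auto
  next
    case (insert y F)
    then show ?case by (auto intro!: simple_cone_add simple_cone_scale simple_in_cone)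
  qed
  then show "x \<in> simple_cone" .
next
  fix x assume "x \<in> simple_cone"
  then obtain c where c: "x = (\<Sum>s\<in>S. c s *\<^sub>R \<alpha> s)" "\<forall>s\<in>S. 0 \<le> c s" unfolding simple_cone_def by blast
  have "x = (\<Sum>y\<in>\<alpha> ` S. c (inv_into S \<alpha> y) *\<^sub>R y)"
    unfolding c(1) by (simp add: sum.reindex[OF inj_on_simple] inv_into_f_f[OF inj_on_simple])
  then show "x \<in> nonneg_cone (\<alpha> ` S)"
    unfolding nonneg_cone_def using c(2) finite_S
    by (intro CollectI exI[of _ "\<alpha> ` S"] exI[of _ "\<lambda>y. c (inv_into S \<alpha> y)"])
      (auto simp: inv_into_f_f[OF inj_on_simple])
qed

text \<open>One further reflection changes one of the two coefficients, and it does so by exactly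
  the Chebyshev recursion; the parity tells which one.\<close>

lemma word_act_alt:
  assumes "s \<in> S" "t \<in> S"
  shows "word_act (alt s t n) (\<alpha> s) =
    (if even n then chebyshev_U (- B (\<alpha> s) (\<alpha> t)) (Suc n) *\<^sub>R \<alpha> s + chebyshev_U (- B (\<alpha> s) (\<alpha> t)) n *\<^sub>R \<alpha> t
     else chebyshev_U (- B (\<alpha> s) (\<alpha> t)) n *\<^sub>R \<alpha> s + chebyshev_U (- B (\<alpha> s) (\<alpha> t)) (Suc n) *\<^sub>R \<alpha> t)"
proof (induction n)
  case (Suc n)
  have two: "(2 * y) *\<^sub>R x = y *\<^sub>R x + y *\<^sub>R x" for y :: real and x :: 'v
    by (simp flip: scaleR_add_left)
  have B: "B (\<alpha> s) (\<alpha> s) = 1" "B (\<alpha> t) (\<alpha> t) = 1" "B (\<alpha> t) (\<alpha> s) = B (\<alpha> s) (\<alpha> t)"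
    using assms B_diag B_sym by auto
  show ?case
    by (simp add: Suc B_reflection_def B_simps B algebra_simps two)
qed simp

section \<open>Roots and inversion sets\<close>

text \<open>For finite order n, sin(k pi/n) is nonnegative up to k = n; for infinite order the
  argument is at least 1 and the values increase.\<close>

lemma chebyshev_U_simple_nonneg:
  assumes "s \<in> S" "t \<in> S" "s \<noteq> t" "enat k \<le> m s t"
  shows "0 \<le> chebyshev_U (- B (\<alpha> s) (\<alpha> t)) k"
proof (cases "m s t")
  case (enat n)
  have n: "2 \<le> n" using m_ge_2[OF assms(1-3) enat] .
  have \<phi>: "0 < pi / real n" "pi / real n < pi" using n by (auto simp: field_simps)
  then have "0 < sin (pi / real n)" by (intro sin_gt_zero) auto
  moreover have "0 \<le> sin (real k * (pi / real n))"
    using assms(4) enat n by (intro sin_ge_zero) (auto simp: field_simps)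
  ultimately show ?thesis
    using sin_chebyshev_U[of "pi / real n" k] B_finite[OF assms(1-3) enat]
    by (metis minus_minus zero_le_mult_iff not_less)
next
  case infinity
  then have "1 \<le> - B (\<alpha> s) (\<alpha> t)" using B_infinite[OF assms(1-3)] by simp
  from chebyshev_U_increasing[OF this, of k] show ?thesis
    by (meson of_nat_0_le_iff order.trans)
qed

text \<open>
  The maximal alternating suffix of \<open>w\<close> in the letters \<open>s\<close> and \<open>t\<close>, \<open>t\<close> a right descent of \<open>w\<close>,
  reduces the claim to the shorter prefix and to the dihedral group of \<open>s\<close> and \<open>t\<close>.
\<close>

lemma act_simple_in_cone:
  assumes "w \<in> carrier W" "s \<in> S" "len (w \<otimes> s) = len w + 1"
  shows "act w (\<alpha> s) \<in> simple_cone"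
  using assms
proof (induction "len w" arbitrary: w s rule: less_induct)
  case less
  show ?case
  proof (cases "w = \<one>")
    case True
    then show ?thesis using less.prems by (simp add: simple_in_cone)
  next
    case False
    then obtain t where t: "t \<in> S" "len (w \<otimes> t) + 1 = len w"
      using right_descent_exists less.prems by blast
    have st: "s \<noteq> t" using t less.prems by auto
    have set_S: "set (alt s t n) \<subseteq> S" "set (alt t s n) \<subseteq> S" for n
      using set_alt[of s t n] set_alt[of t s n] t less.prems by blast+
    \<comment> \<open>Lengths of the alternating suffixes ending in \<open>t\<close> that split off
      from \<open>w\<close> with additive length. For the greatest one, neither \<open>s\<close> nor
      \<open>t\<close> is a right descent of the remaining prefix \<open>v\<close>, so the induction
      hypothesis applies to \<open>v\<close> twice.\<close>
    define P where "P n \<longleftrightarrow> (\<exists>v\<in>carrier W. w = v \<otimes> word_prod W (alt s t n) \<and> len w = len v + n)" for n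
    have "P 1" unfolding P_def
      by (rule bexI[of _ "w \<otimes> t"]) (use t less.prems in \<open>auto simp: S_cancel_right\<close>)
    moreover have bound: "\<And>n. P n \<Longrightarrow> n \<le> len w" by (auto simp: P_def)
    ultimately have PG: "P (GREATEST n. P n)" "1 \<le> (GREATEST n. P n)" "\<And>k. P k \<Longrightarrow> k \<le> (GREATEST n. P n)"
      using GreatestI_nat[of P 1 "len w"] Greatest_le_nat[of P _ "len w"] by blast+
    define n where "n = (GREATEST n. P n)"
    have n: "P n" "1 \<le> n" "\<not> P (Suc n)" using PG(1,2) PG(3)[of "Suc n"] by (auto simp: n_def)
    then obtain v where v: "v \<in> carrier W" "w = v \<otimes> word_prod W (alt s t n)" "len w = len v + n"
      unfolding P_def by blast
    \<comment> \<open>\<open>q\<close> is the first letter of \<open>alt s t n\<close>, so a descent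
      \<open>q\<close> of \<open>v\<close> would shorten \<open>w\<close>; \<open>q'\<close> is the
      letter that would extend the suffix, so a descent \<open>q'\<close> would contradict
      maximality.\<close>
    define q where "q = (if even n then s else t)"
    define q' where "q' = (if even n then t else s)"
    have q: "q \<in> S" "q' \<in> S" "{q, q'} = {s, t}" using t less.prems by (auto simp: q_def q'_def)
    have "len (v \<otimes> q') = len v + 1"
    proof (rule ccontr)
      assume "len (v \<otimes> q') \<noteq> len v + 1"
      then have l: "len (v \<otimes> q') + 1 = len v" using len_mult_simple_right[of q' v] q v by blast
      have "v \<otimes> q' \<otimes> word_prod W (alt s t (Suc n)) = v \<otimes> q' \<otimes> q' \<otimes> word_prod W (alt s t n)"
        using set_S q v(1) by (simp add: q'_def m_assoc)
      then have "P (Suc n)"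
        unfolding P_def using v q l by (intro bexI[of _ "v \<otimes> q'"]) (auto simp: S_cancel_right)
      then show False using n by blast
    qed
    moreover have "len (v \<otimes> q) = len v + 1"
    proof (rule ccontr)
      assume "len (v \<otimes> q) \<noteq> len v + 1"
      then have l: "len (v \<otimes> q) + 1 = len v" using len_mult_simple_right[of q v] q v by blast
      obtain n' where n': "n = Suc n'" using n(2) by (cases n) auto
      have "w = v \<otimes> q \<otimes> word_prod W (alt s t n')"
        using set_S q v(1) unfolding v(2) n' by (simp add: q_def n' m_assoc)
      then have "len w \<le> len (v \<otimes> q) + n'"
        using len_mult_le[of "v \<otimes> q" "word_prod W (alt s t n')"] word_prod_len[of "alt s t n'"] set_S q v(1)
        by fastforce
      then show False using l v(3) n' by linarith
    qed
    ultimately have vcone: "act v (\<alpha> q) \<in> simple_cone" "act v (\<alpha> q') \<in> simple_cone"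
      using less.hyps[of v] v n(2) q by auto
    then have vst: "act v (\<alpha> s) \<in> simple_cone" "act v (\<alpha> t) \<in> simple_cone"
      using q(3) by (auto simp: q_def q'_def split: if_splits)
    \<comment> \<open>If the order were at most \<open>n\<close>, the braid relation would produce
      an expression of \<open>w\<close> of the same length ending in \<open>s\<close>, although
      \<open>w \<otimes> s\<close> is longer than \<open>w\<close>.\<close>
    have "enat (Suc n) \<le> m s t"
    proof (rule ccontr)
      assume "\<not> enat (Suc n) \<le> m s t"
      then obtain k where k: "m s t = enat k" "k \<le> n" by (cases "m s t") auto
      have k2: "2 \<le> k" using m_ge_2[OF _ _ st k(1)] t less.prems by blast
      define p where "p = (if even k then alt s t (n - k) else alt t s (n - k))"
      have p: "set p \<subseteq> S" "length p = n - k" "alt s t n = p @ alt s t k"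
        using alt_add[of s t "n - k" k] k(2) set_S by (simp_all add: p_def)
      obtain k' where k': "k = Suc k'" using k2 by (cases k) auto
      have "w = v \<otimes> (word_prod W p \<otimes> word_prod W (alt t s k))"
        using v(2) p set_S braid[of s t k] k(1) t less.prems by (simp add: word_prod_append)
      also have "word_prod W (alt t s k) = word_prod W (alt s t k') \<otimes> s"
        unfolding k' alt_snoc using word_prod_append[of "alt s t k'" "[s]"] set_S less.prems by simp
      finally have "w \<otimes> s = v \<otimes> (word_prod W p \<otimes> word_prod W (alt s t k'))"
        using v(1) p(1) set_S less.prems by (simp add: m_assoc S_square)
      also have "len \<dots> \<le> len v + (length p + k')"
        using v(1) p(1) set_S word_prod_len[of "p @ alt s t k'"]
          len_mult_le[of v "word_prod W (p @ alt s t k')"]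
        by (simp add: word_prod_append)
      finally show False using v(3) p(2) k' k(2) less.prems by linarith
    qed
    then have "0 \<le> chebyshev_U (- B (\<alpha> s) (\<alpha> t)) (Suc n)" "0 \<le> chebyshev_U (- B (\<alpha> s) (\<alpha> t)) n"
      using chebyshev_U_simple_nonneg[of s t] st t less.prems
      by (metis, metis eSuc_enat ile_eSuc order_trans)
    then have "act v (word_act (alt s t n) (\<alpha> s)) \<in> simple_cone"
      using vst v(1) t less.prems
      by (auto simp: word_act_alt act_add act_scale intro!: simple_cone_add simple_cone_scale)
    then show ?thesis
      using v(1) set_S by (simp add: v(2) act_mult act_word)
  qed
qed

lemma root_act: "\<lbrakk>\<beta> \<in> roots; w \<in> carrier W\<rbrakk> \<Longrightarrow> act w \<beta> \<in> roots"
  unfolding roots_def using act_mult[symmetric] by fastforce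

lemma simple_root: "s \<in> S \<Longrightarrow> \<alpha> s \<in> roots"
  unfolding roots_def by (intro CollectI exI[of _ "\<one>"] exI[of _ s]) simp

lemma root_obtain:
  assumes "\<beta> \<in> roots"
  obtains w s where "w \<in> carrier W" "s \<in> S" "\<beta> = act w (\<alpha> s)"
  using assms unfolding roots_def by blast

lemma root_B [simp]: "\<beta> \<in> roots \<Longrightarrow> B \<beta> \<beta> = 1"
  by (auto simp: roots_def B_act B_diag)

lemma act_mult_simple: "\<lbrakk>w \<in> carrier W; s \<in> S\<rbrakk> \<Longrightarrow> act (w \<otimes> s) (\<alpha> s) = - act w (\<alpha> s)"
  by (simp add: act_mult act_simple B_reflection_def B_diag act_minus scaleR_2)

lemma root_minus: "\<beta> \<in> roots \<Longrightarrow> - \<beta> \<in> roots"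
  by (metis act_mult_simple m_closed root_obtain S_closed root_act simple_root)

lemma root_minus_iff [simp]: "- \<beta> \<in> roots \<longleftrightarrow> \<beta> \<in> roots"
  using root_minus[of \<beta>] root_minus[of "- \<beta>"] by auto

lemma root_cone:
  assumes "\<beta> \<in> roots"
  shows "\<beta> \<in> simple_cone \<or> - \<beta> \<in> simple_cone"
proof -
  obtain w s where ws: "w \<in> carrier W" "s \<in> S" "\<beta> = act w (\<alpha> s)" using root_obtain[OF assms] .
  show ?thesis
  proof (cases "len (w \<otimes> s) = len w + 1")
    case True
    then show ?thesis using act_simple_in_cone ws by blast
  next
    case False
    then have "len (w \<otimes> s \<otimes> s) = len (w \<otimes> s) + 1"
      using len_mult_simple_right[of s w] ws by (simp add: S_cancel_right)
    then have "act (w \<otimes> s) (\<alpha> s) \<in> simple_cone" using act_simple_in_cone ws by blast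
    then show ?thesis using ws by (simp add: act_mult_simple)
  qed
qed

lemma root_lam_nz: "\<beta> \<in> roots \<Longrightarrow> lam \<beta> \<noteq> 0"
proof
  assume "\<beta> \<in> roots" "lam \<beta> = 0"
  moreover from this have "\<beta> = 0"
    using root_cone[of \<beta>] lam_cone_0[of \<beta>] lam_cone_0[of "- \<beta>"] by (auto simp: lam_simps)
  ultimately show False using root_B[of \<beta>] by (simp add: B_simps)
qed

lemma root_pos_cone: "\<lbrakk>\<beta> \<in> roots; 0 < lam \<beta>\<rbrakk> \<Longrightarrow> \<beta> \<in> simple_cone"
  using root_cone[of \<beta>] lam_cone[of "- \<beta>"] by (auto simp: lam_simps)

lemma pos_roots_iff: "\<beta> \<in> pos_roots \<longleftrightarrow> \<beta> \<in> roots \<and> 0 < lam \<beta>"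
  using root_pos_cone[of \<beta>] lam_cone[of \<beta>] root_lam_nz[of \<beta>]
  by (auto simp: pos_roots_def nonneg_cone_simple)

lemma neg_roots_iff: "\<beta> \<in> neg_roots \<longleftrightarrow> \<beta> \<in> roots \<and> lam \<beta> < 0"
proof -
  have "\<beta> \<in> neg_roots \<longleftrightarrow> - \<beta> \<in> pos_roots" unfolding neg_roots_def by force
  then show ?thesis by (auto simp: pos_roots_iff lam_simps)
qed

text \<open>Simple roots span extreme rays even if they are dependent. Pairing with
  \<open>\<alpha> s\<close> shows that the total coefficient of \<open>\<alpha> s\<close> is at
  least \<open>k\<close>, since the other simple roots contribute nonpositively; subtracting
  \<open>k\<close> leaves a nonnegative relation, which must be trivial.\<close>

lemma simple_extreme:
  assumes s: "s \<in> S" and k: "0 < k" and x: "x \<in> simple_cone" and y: "y \<in> simple_cone"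
    and eq: "x + y = k *\<^sub>R \<alpha> s"
  shows "\<exists>a\<ge>0. x = a *\<^sub>R \<alpha> s"
proof -
  obtain c where c: "x = (\<Sum>s\<in>S. c s *\<^sub>R \<alpha> s)" "\<forall>s\<in>S. 0 \<le> c s" using x unfolding simple_cone_def by blast
  obtain d where d: "y = (\<Sum>s\<in>S. d s *\<^sub>R \<alpha> s)" "\<forall>s\<in>S. 0 \<le> d s" using y unfolding simple_cone_def by blast
  define b where "b t = c t + d t" for t
  have b: "(\<Sum>t\<in>S. b t *\<^sub>R \<alpha> t) = k *\<^sub>R \<alpha> s" "\<forall>t\<in>S. 0 \<le> b t"
    using eq c d by (auto simp: b_def scaleR_add_left sum.distrib)
  have "k = B (\<Sum>t\<in>S. b t *\<^sub>R \<alpha> t) (\<alpha> s)" using b s by (simp add: B_simps B_diag)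
  also have "\<dots> = (\<Sum>t\<in>S. b t * B (\<alpha> t) (\<alpha> s))" by (simp add: B_sum_left B_simps)
  also have "\<dots> \<le> (\<Sum>t\<in>S. if t = s then b s else 0)"
    using b(2) s B_simple_le_0 by (intro sum_mono) (auto simp: B_diag mult_nonneg_nonpos)
  also have "\<dots> = b s" using s finite_S by simp
  finally have bs: "k \<le> b s" .
  have "(b(s := b s - k)) t = 0" if "t \<in> S" for t
  proof (rule no_nonneg_relation[OF finite_S subset_refl])
    show "0 \<le> (b(s := b s - k)) t" if "t \<in> S" for t using that b(2) bs by auto
    have "(\<Sum>t\<in>S. (b(s := b s - k)) t *\<^sub>R \<alpha> t) = (\<Sum>t\<in>S. b t *\<^sub>R \<alpha> t - (if t = s then k *\<^sub>R \<alpha> s else 0))"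
      by (intro sum.cong) (auto simp: scaleR_diff_left)
    also have "\<dots> = 0" using b(1) s finite_S by (simp add: sum_subtractf)
    finally show "(\<Sum>t\<in>S. (b(s := b s - k)) t *\<^sub>R \<alpha> t) = 0" .
  qed fact
  then have "c t = 0" if "t \<in> S" "t \<noteq> s" for t
    using that c(2) d(2) by (force simp: b_def add_nonneg_eq_0_iff)
  then have "x = (\<Sum>t\<in>S. if t = s then c s *\<^sub>R \<alpha> s else 0)"
    unfolding c(1) by (intro sum.cong) auto
  also have "\<dots> = c s *\<^sub>R \<alpha> s" using s finite_S by simp
  finally show ?thesis using c(2) s by auto
qed

lemma root_multiple:
  assumes "\<beta> \<in> roots" "\<gamma> \<in> roots" "\<beta> = a *\<^sub>R \<gamma>" "0 \<le> a"
  shows "\<beta> = \<gamma>"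
proof -
  have "a * a = 1" using root_B[OF assms(1)] root_B[OF assms(2)] assms(3) by (simp add: B_simps)
  then have "a = 1" using assms(4) by (metis abs_of_nonneg power2_eq_1_iff power2_eq_square abs_minus_cancel abs_one)
  then show ?thesis using assms by simp
qed

text \<open>If both \<beta> and -s\<beta> were positive, their sum would be a positive multiple of
  \<open>\<alpha> s\<close>; extremality then makes \<beta> a multiple of
  \<open>\<alpha> s\<close>.\<close>

lemma simple_permutes:
  assumes "s \<in> S" "\<beta> \<in> roots" "0 < lam \<beta>" "\<beta> \<noteq> \<alpha> s"
  shows "0 < lam (act s \<beta>)"
proof (rule ccontr)
  assume "\<not> 0 < lam (act s \<beta>)"
  then have neg: "0 < lam (- act s \<beta>)"
    using root_lam_nz[of "act s \<beta>"] assms root_act[of \<beta> s] by (auto simp: lam_simps)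
  have r: "- act s \<beta> \<in> roots" using assms root_act by auto
  have eq: "\<beta> + (- act s \<beta>) = (2 * B (\<alpha> s) \<beta>) *\<^sub>R \<alpha> s"
    using assms by (simp add: act_simple B_reflection_def)
  have "0 < lam (\<beta> + (- act s \<beta>))" using neg assms by (simp add: lam_simps)
  then have "0 < 2 * B (\<alpha> s) \<beta>"
    unfolding eq using lam_simple[OF assms(1)] by (simp add: lam_simps zero_less_mult_iff)
  then obtain a where "a \<ge> 0" "\<beta> = a *\<^sub>R \<alpha> s"
    using simple_extreme[OF assms(1) _ root_pos_cone[OF assms(2,3)] root_pos_cone[OF r neg] eq] by blast
  then show False using root_multiple[OF assms(2) simple_root[OF assms(1)]] assms by blast
qed

lemma lam_act_simple_iff:
  assumes "w \<in> carrier W" "s \<in> S"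
  shows "0 < lam (act w (\<alpha> s)) \<longleftrightarrow> len (w \<otimes> s) = len w + 1"
proof
  have r: "act w (\<alpha> s) \<in> roots" "lam (act w (\<alpha> s)) \<noteq> 0" using assms root_act simple_root root_lam_nz by auto
  show "0 < lam (act w (\<alpha> s))" if "len (w \<otimes> s) = len w + 1"
    using act_simple_in_cone[OF assms that] lam_cone r by fastforce
  show "len (w \<otimes> s) = len w + 1" if p: "0 < lam (act w (\<alpha> s))"
  proof (rule ccontr)
    assume "len (w \<otimes> s) \<noteq> len w + 1"
    then have "len (w \<otimes> s \<otimes> s) = len (w \<otimes> s) + 1"
      using len_mult_simple_right[of s w] assms by (simp add: S_cancel_right)
    then have "act (w \<otimes> s) (\<alpha> s) \<in> simple_cone" using act_simple_in_cone assms by blast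
    then show False using lam_cone p assms by (fastforce simp: act_mult_simple lam_simps)
  qed
qed

lemma lam_act_simple_inv_iff:
  assumes "w \<in> carrier W" "s \<in> S"
  shows "0 < lam (act (inv w) (\<alpha> s)) \<longleftrightarrow> len (s \<otimes> w) = len w + 1"
  using lam_act_simple_iff[of "inv w" s] len_inv[of "s \<otimes> w"] assms
  by (simp add: inv_mult_group S_inv)

text \<open>Faithfulness: a nontrivial element has a right descent and sends that simple root to a
  negative root.\<close>

lemma act_eq_imp_eq:
  assumes "u \<in> carrier W" "v \<in> carrier W" "act u = act v"
  shows "u = v"
proof (rule ccontr)
  assume "u \<noteq> v"
  define w where "w = inv v \<otimes> u"
  have w: "w \<in> carrier W" "w \<noteq> \<one>"
    using assms \<open>u \<noteq> v\<close> by (auto simp: w_def) (metis inv_equality inv_inv inv_closed)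
  have "act w x = x" for x using assms by (simp add: w_def act_mult)
  moreover obtain s where "s \<in> S" "len (w \<otimes> s) + 1 = len w" using right_descent_exists w by blast
  ultimately show False using lam_act_simple_iff[of w s] lam_simple[of s] w by auto
qed

text \<open>The set N(w) of the theory, with signs expressed by \<open>lam\<close>.\<close>

definition inv_set :: "'w \<Rightarrow> 'v set" where
  "inv_set w = {\<beta> \<in> roots. 0 < lam \<beta> \<and> lam (act (inv w) \<beta>) < 0}"

lemma inv_set_one [simp]: "inv_set \<one> = {}"
  by (auto simp: inv_set_def)

text \<open>A consequence of \<open>simple_permutes\<close>: apart from \<open>\<alpha> s\<close>,
  the reflection \<open>s\<close> preserves positivity.\<close>

lemma inv_set_simple_mult:
  assumes w: "w \<in> carrier W" and s: "s \<in> S" and l: "len (s \<otimes> w) = len w + 1"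
  shows "inv_set (s \<otimes> w) = insert (\<alpha> s) (act s ` inv_set w)" "\<alpha> s \<notin> act s ` inv_set w"
proof -
  have ss: "act s (act s x) = x" for x using s by (metis S_closed S_inv act_inv_act)
  have i: "act (inv (s \<otimes> w)) x = act (inv w) (act s x)" for x
    using w s by (simp add: inv_mult_group S_inv act_mult)
  have ssim: "act s (\<alpha> s) = - \<alpha> s"
    using act_mult_simple[of "\<one>" s] s by simp
  have p: "0 < lam (act (inv w) (\<alpha> s))" using lam_act_simple_inv_iff w s l by simp
  show "\<alpha> s \<notin> act s ` inv_set w"
  proof
    assume "\<alpha> s \<in> act s ` inv_set w"
    then have "act s (\<alpha> s) \<in> inv_set w" using ss by auto
    then show False using lam_simple[OF s] by (auto simp: inv_set_def ssim lam_simps)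
  qed
  show "inv_set (s \<otimes> w) = insert (\<alpha> s) (act s ` inv_set w)"
  proof (intro subset_antisym subsetI)
    fix \<beta> assume \<beta>: "\<beta> \<in> inv_set (s \<otimes> w)"
    show "\<beta> \<in> insert (\<alpha> s) (act s ` inv_set w)"
    proof (cases "\<beta> = \<alpha> s")
      case False
      then have "act s \<beta> \<in> inv_set w"
        using \<beta> s root_act simple_permutes[OF s, of \<beta>] by (auto simp: inv_set_def i)
      then show ?thesis using ss by (metis image_eqI insertCI)
    qed simp
  next
    fix \<beta> assume "\<beta> \<in> insert (\<alpha> s) (act s ` inv_set w)"
    then show "\<beta> \<in> inv_set (s \<otimes> w)"
    proof
      assume "\<beta> = \<alpha> s"
      then show ?thesis using s w p by (simp add: inv_set_def simple_root lam_simple i ssim act_minus lam_simps)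
    next
      assume "\<beta> \<in> act s ` inv_set w"
      then obtain \<gamma> where \<gamma>: "\<gamma> \<in> inv_set w" "\<beta> = act s \<gamma>" by blast
      moreover from \<gamma> p have "\<gamma> \<noteq> \<alpha> s" by (auto simp: inv_set_def)
      ultimately show ?thesis
        using s root_act simple_permutes[OF s, of \<gamma>] by (auto simp: inv_set_def i ss)
    qed
  qed
qed

lemma inv_set_card:
  assumes "w \<in> carrier W"
  shows "finite (inv_set w)" "card (inv_set w) = len w"
proof -
  have "finite (inv_set w) \<and> card (inv_set w) = len w"
    using assms
  proof (induction "len w" arbitrary: w rule: less_induct)
    case less
    show ?case
    proof (cases "w = \<one>")
      case False
      then obtain s where s: "s \<in> S" "len (s \<otimes> w) + 1 = len w" using left_descent_exists less.prems by blast
      define v where "v = s \<otimes> w"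
      have v: "v \<in> carrier W" "w = s \<otimes> v" "len (s \<otimes> v) = len v + 1"
        using s less.prems by (auto simp: v_def S_cancel)
      have "len v < len w" using s by (simp add: v_def)
      then have IH: "finite (inv_set v) \<and> card (inv_set v) = len v" using less.hyps v(1) by blast
      have "inj_on (act s) (inv_set v)" using s by (intro inj_onI) (simp add: act_eq_iff)
      then show ?thesis
        unfolding v(2) using inv_set_simple_mult[OF v(1) s(1) v(3)] IH v(3) by (simp add: card_image)
    qed simp
  qed
  then show "finite (inv_set w)" "card (inv_set w) = len w" by auto
qed

text \<open>Apply the letters to \<beta> one after the other: a positive root can turn negative at a
  letter only if it is the simple root of that letter.\<close>

lemma word_inversion:
  assumes "set xs \<subseteq> S" "\<beta> \<in> roots" "0 < lam \<beta>" "lam (act (inv (word_prod W xs)) \<beta>) < 0"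
  shows "\<exists>us t vs. xs = us @ t # vs \<and> \<beta> = act (word_prod W us) (\<alpha> t)"
  using assms
proof (induction xs arbitrary: \<beta>)
  case (Cons x xs)
  show ?case
  proof (cases "\<beta> = \<alpha> x")
    case True
    then show ?thesis by (intro exI[of _ "[]"]) auto
  next
    case False
    have x: "x \<in> S" "set xs \<subseteq> S" using Cons.prems by auto
    have "act (inv (word_prod W (x # xs))) \<beta> = act (inv (word_prod W xs)) (act x \<beta>)"
      using x by (simp add: inv_mult_group S_inv act_mult)
    then obtain us t vs where "xs = us @ t # vs" "act x \<beta> = act (word_prod W us) (\<alpha> t)"
      using Cons.IH[of "act x \<beta>"] Cons.prems simple_permutes[of x \<beta>] False x root_act by auto
    moreover have "act x (act x \<beta>) = \<beta>" using x by (metis S_closed S_inv act_inv_act)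
    ultimately show ?thesis
      using x by (intro exI[of _ "x # us"]) (auto simp: act_mult)
  qed
qed simp

section \<open>Reflections in arbitrary roots and the strong exchange condition\<close>

lemma root_reflection_unique:
  assumes "w \<in> carrier W" "act w = B_reflection \<beta>"
  shows "root_reflection \<beta> = w"
  unfolding root_reflection_def using assms act_eq_imp_eq by (intro the_equality) auto

lemma conj_acts_as_reflection:
  assumes "g \<in> carrier W" "s \<in> carrier W" "act s = B_reflection \<gamma>"
  shows "act (g \<otimes> s \<otimes> inv g) = B_reflection (act g \<gamma>)"
proof
  fix x
  have "act (g \<otimes> s \<otimes> inv g) x = act g (B_reflection \<gamma> (act (inv g) x))"
    using assms by (simp add: act_mult)
  also have "\<dots> = x - (2 * B \<gamma> (act (inv g) x)) *\<^sub>R act g \<gamma>"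
    using assms by (simp add: B_reflection_def act_diff act_scale)
  also have "B \<gamma> (act (inv g) x) = B (act g \<gamma>) x"
    using B_act[of g \<gamma> "act (inv g) x"] assms by simp
  finally show "act (g \<otimes> s \<otimes> inv g) x = B_reflection (act g \<gamma>) x" by (simp add: B_reflection_def)
qed

lemma root_reflection_simple: "s \<in> S \<Longrightarrow> root_reflection (\<alpha> s) = s"
  by (intro root_reflection_unique act_simple) auto

lemma root_reflection_act_simple:
  "\<lbrakk>g \<in> carrier W; s \<in> S\<rbrakk> \<Longrightarrow> root_reflection (act g (\<alpha> s)) = g \<otimes> s \<otimes> inv g"
  by (intro root_reflection_unique conj_acts_as_reflection act_simple) auto

lemma root_reflection_closed [simp, intro]: "\<beta> \<in> roots \<Longrightarrow> root_reflection \<beta> \<in> carrier W"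
  by (auto elim!: root_obtain simp: root_reflection_act_simple)

lemma act_root_reflection: "\<beta> \<in> roots \<Longrightarrow> act (root_reflection \<beta>) = B_reflection \<beta>"
  by (auto elim!: root_obtain simp: root_reflection_act_simple intro!: conj_acts_as_reflection act_simple)

lemma act_root_reflection_apply: "\<beta> \<in> roots \<Longrightarrow> act (root_reflection \<beta>) x = x - (2 * B \<beta> x) *\<^sub>R \<beta>"
  by (simp add: act_root_reflection B_reflection_def)

lemma root_reflection_self: "\<beta> \<in> roots \<Longrightarrow> act (root_reflection \<beta>) \<beta> = - \<beta>"
  by (simp add: act_root_reflection_apply scaleR_2)

lemma root_reflection_act:
  "\<lbrakk>\<beta> \<in> roots; g \<in> carrier W\<rbrakk> \<Longrightarrow> root_reflection (act g \<beta>) = g \<otimes> root_reflection \<beta> \<otimes> inv g"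
  by (intro root_reflection_unique conj_acts_as_reflection act_root_reflection) auto

lemma root_reflection_square: "\<beta> \<in> roots \<Longrightarrow> root_reflection \<beta> \<otimes> root_reflection \<beta> = \<one>"
  by (intro act_eq_imp_eq) (auto simp: fun_eq_iff act_mult act_root_reflection reflection_involutive)

lemma root_reflection_inv: "\<beta> \<in> roots \<Longrightarrow> inv (root_reflection \<beta>) = root_reflection \<beta>"
  by (simp add: inv_equality root_reflection_square)

lemma root_reflection_cancel:
  "\<lbrakk>\<beta> \<in> roots; w \<in> carrier W\<rbrakk> \<Longrightarrow> root_reflection \<beta> \<otimes> (root_reflection \<beta> \<otimes> w) = w"
  by (simp add: m_assoc[symmetric] root_reflection_square)

lemma root_reflection_parity:
  assumes "\<beta> \<in> roots" "w \<in> carrier W"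
  shows "even (len (root_reflection \<beta> \<otimes> w)) \<noteq> even (len w)"
proof -
  obtain g s where "g \<in> carrier W" "s \<in> S" "\<beta> = act g (\<alpha> s)" using root_obtain[OF assms(1)] .
  then show ?thesis
    using len_mult_parity[of "g \<otimes> s \<otimes> inv g" w] len_mult_parity[of "g \<otimes> s" "inv g"] len_mult_parity[of g s] assms
    by (simp add: root_reflection_act_simple)
qed

lemma act_inv_reflection_mult:
  assumes "\<beta> \<in> roots" "w \<in> carrier W"
  shows "act (inv (root_reflection \<beta> \<otimes> w)) x = act (inv w) (act (root_reflection \<beta>) x)"
  using assms by (simp add: inv_mult_group root_reflection_inv act_mult)

text \<open>Strong exchange: multiplying by the reflection deletes from a reduced word the letter
  found by \<open>word_inversion\<close>.\<close>

lemma len_reflection_less: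
  assumes "\<beta> \<in> roots" "0 < lam \<beta>" "w \<in> carrier W" "lam (act (inv w) \<beta>) < 0"
  shows "len (root_reflection \<beta> \<otimes> w) < len w"
proof -
  obtain xs where xs: "set xs \<subseteq> S" "word_prod W xs = w" "length xs = len w"
    using reduced_word assms by blast
  obtain us t vs where d: "xs = us @ t # vs" "\<beta> = act (word_prod W us) (\<alpha> t)"
    using word_inversion[of xs \<beta>] xs assms by blast
  have S: "set us \<subseteq> S" "t \<in> S" "set vs \<subseteq> S" using xs d by auto
  have "root_reflection \<beta> \<otimes> w = word_prod W us \<otimes> t \<otimes> inv (word_prod W us) \<otimes> (word_prod W us \<otimes> (t \<otimes> word_prod W vs))"
    using d xs S by (simp add: root_reflection_act_simple word_prod_append flip: xs(2))
  also have "\<dots> = word_prod W us \<otimes> t \<otimes> (t \<otimes> word_prod W vs)"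
    using S by (simp add: m_assoc) (simp add: m_assoc[symmetric])
  also have "\<dots> = word_prod W (us @ vs)"
    using S by (simp add: m_assoc word_prod_append S_cancel)
  finally show ?thesis using word_prod_len[of "us @ vs"] S xs(3) d(1) by simp
qed

text \<open>For the converse, strong exchange is applied to the reflected element, for which \<beta>
  has the opposite sign.\<close>

lemma len_reflection_less_iff:
  assumes "\<beta> \<in> roots" "0 < lam \<beta>" "w \<in> carrier W"
  shows "lam (act (inv w) \<beta>) < 0 \<longleftrightarrow> len (root_reflection \<beta> \<otimes> w) < len w"
proof
  assume l: "len (root_reflection \<beta> \<otimes> w) < len w"
  show "lam (act (inv w) \<beta>) < 0"
  proof (rule ccontr)
    assume "\<not> lam (act (inv w) \<beta>) < 0"
    then have "0 < lam (act (inv w) \<beta>)"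
      using root_lam_nz[of "act (inv w) \<beta>"] assms root_act by force
    then have "lam (act (inv (root_reflection \<beta> \<otimes> w)) \<beta>) < 0"
      using assms by (simp add: act_inv_reflection_mult root_reflection_self act_minus lam_simps)
    from len_reflection_less[OF assms(1,2) _ this] l assms show False
      by (simp add: root_reflection_cancel)
  qed
qed (use len_reflection_less assms in blast)

lemma N1_iff:
  assumes "w \<in> carrier W"
  shows "\<beta> \<in> N1 w \<longleftrightarrow> \<beta> \<in> inv_set w \<and> len (root_reflection \<beta> \<otimes> w) + 1 = len w"
  using len_reflection_less_iff[of \<beta> w] assms by (auto simp: N1_def pos_roots_iff inv_set_def)

text \<open>A left descent can be read off from the inversion set, so both elements lose the same
  first letter.\<close>

lemma inv_set_inj:
  assumes "u \<in> carrier W" "v \<in> carrier W" "inv_set u = inv_set v"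
  shows "u = v"
  using assms
proof (induction "len u" arbitrary: u v rule: less_induct)
  case less
  show ?case
  proof (cases "u = \<one>")
    case True
    then have "len v = 0" using less.prems inv_set_card(2)[of v] by simp
    then show ?thesis using True len_eq_0 less.prems by blast
  next
    case False
    then obtain s where s: "s \<in> S" "len (s \<otimes> u) + 1 = len u" using left_descent_exists less.prems by blast
    have lens: "len u = len v" using less.prems inv_set_card(2) by metis
    have "\<alpha> s \<in> inv_set u"
      using s less.prems(1) len_reflection_less_iff[of "\<alpha> s" u]
      by (simp add: inv_set_def simple_root lam_simple root_reflection_simple)
    then have "\<alpha> s \<in> inv_set v" using less.prems(3) by simp
    then have "len (s \<otimes> v) < len v"
      using s less.prems(2) len_reflection_less_iff[of "\<alpha> s" v]
      by (simp add: inv_set_def simple_root lam_simple root_reflection_simple)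
    then have sv: "len (s \<otimes> v) + 1 = len v" using len_mult_simple[of s v] s less.prems by linarith
    define a where "a = s \<otimes> u"
    define b where "b = s \<otimes> v"
    have ab: "a \<in> carrier W" "b \<in> carrier W" "u = s \<otimes> a" "v = s \<otimes> b"
      using s less.prems by (auto simp: a_def b_def S_cancel)
    have la: "len (s \<otimes> a) = len a + 1" "len (s \<otimes> b) = len b + 1"
      using s(1) s(2)[symmetric] sv[symmetric] ab(3,4)[symmetric] by (simp_all add: a_def[symmetric] b_def[symmetric])
    have "insert (\<alpha> s) (act s ` inv_set a) = insert (\<alpha> s) (act s ` inv_set b)"
      using less.prems(3) inv_set_simple_mult(1)[OF ab(1) s(1) la(1)] inv_set_simple_mult(1)[OF ab(2) s(1) la(2)] ab
      by simp
    then have "act s ` inv_set a = act s ` inv_set b"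
      using inv_set_simple_mult(2)[OF ab(1) s(1) la(1)] inv_set_simple_mult(2)[OF ab(2) s(1) la(2)]
      by (meson insert_ident)
    moreover have "inj (act s)" using s by (intro injI) (simp add: act_eq_iff)
    ultimately have "inv_set a = inv_set b" by (simp add: inj_image_eq_iff)
    moreover have "len a < len u" using la(1) ab(3) by simp
    ultimately have "a = b" using less.hyps ab(1,2) by blast
    then show ?thesis using ab by simp
  qed
qed

section \<open>Subsystems cut out by a subspace\<close>

lemma inversion_split:
  assumes "g \<in> carrier W" "\<beta> \<in> inv_set g"
  obtains h t v where "h \<in> carrier W" "t \<in> S" "v \<in> carrier W" "g = h \<otimes> t \<otimes> v"
    "len g = len h + 1 + len v" "\<beta> = act h (\<alpha> t)"
proof -
  obtain xs where xs: "set xs \<subseteq> S" "word_prod W xs = g" "length xs = len g"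
    using reduced_word assms by blast
  obtain us t vs where d: "xs = us @ t # vs" "\<beta> = act (word_prod W us) (\<alpha> t)"
    using word_inversion[of xs \<beta>] xs assms unfolding inv_set_def by blast
  have S: "set us \<subseteq> S" "t \<in> S" "set vs \<subseteq> S" using xs d by auto
  have g: "g = word_prod W us \<otimes> t \<otimes> word_prod W vs"
    using xs(2) S by (simp add: d(1) word_prod_append m_assoc)
  have "len g \<le> len (word_prod W us) + 1 + len (word_prod W vs)"
    using len_mult_le[of "word_prod W us \<otimes> t" "word_prod W vs"] len_mult_le[of "word_prod W us" t] S g by simp
  moreover have "len g = length us + 1 + length vs" using xs(3) d(1) by simp
  ultimately have "len g = len (word_prod W us) + 1 + len (word_prod W vs)"
    using word_prod_len[OF S(1)] word_prod_len[OF S(3)] by linarith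
  then show ?thesis using that[of "word_prod W us" t "word_prod W vs"] S g d(2) by blast
qed

lemma inversion_of_split:
  assumes "h \<in> carrier W" "t \<in> S" "v \<in> carrier W" "len (h \<otimes> t \<otimes> v) = len h + 1 + len v"
  shows "act h (\<alpha> t) \<in> inv_set (h \<otimes> t \<otimes> v)"
proof -
  have "len (h \<otimes> t) = len h + 1" "len (t \<otimes> v) = len v + 1"
    using assms len_mult_le[of "h \<otimes> t" v] len_mult_le[of h "t \<otimes> v"]
      len_mult_simple[of t v] len_mult_simple_right[of t h] by (auto simp: m_assoc)
  moreover have "act (inv (h \<otimes> t \<otimes> v)) (act h (\<alpha> t)) = - act (inv v) (\<alpha> t)"
    using assms act_mult_simple[of "\<one>" t] by (simp add: inv_mult_group S_inv act_mult m_assoc act_minus)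
  ultimately show ?thesis
    using assms lam_act_simple_iff[of h t] lam_act_simple_inv_iff[of v t] root_act simple_root
    by (simp add: inv_set_def lam_simps)
qed

section \<open>Canonical roots of a subsystem\<close>

definition sub_pos :: "'v set \<Rightarrow> 'v set" where
  "sub_pos U = {\<beta> \<in> roots. \<beta> \<in> U \<and> 0 < lam \<beta>}"

text \<open>The canonical roots, in Dyer's sense, of the reflection subgroup generated by the
  reflections in the roots of \<open>U\<close>: the property that \<open>simple_permutes\<close>
  proves for simple roots is taken as the definition.\<close>

definition canonical :: "'v set \<Rightarrow> 'v set" where
  "canonical U = {\<delta> \<in> sub_pos U. \<forall>\<beta> \<in> sub_pos U. \<beta> \<noteq> \<delta> \<longrightarrow> 0 < lam (act (root_reflection \<delta>) \<beta>)}"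

lemma sub_posD: "\<beta> \<in> sub_pos U \<Longrightarrow> \<beta> \<in> roots" "\<beta> \<in> sub_pos U \<Longrightarrow> \<beta> \<in> U" "\<beta> \<in> sub_pos U \<Longrightarrow> 0 < lam \<beta>"
  by (auto simp: sub_pos_def)

lemma canonical_sub_pos: "\<delta> \<in> canonical U \<Longrightarrow> \<delta> \<in> sub_pos U"
  by (simp add: canonical_def)

lemma canonical_mono: "\<lbrakk>\<delta> \<in> canonical U; \<delta> \<in> P; P \<subseteq> U\<rbrakk> \<Longrightarrow> \<delta> \<in> canonical P"
  by (auto simp: canonical_def sub_pos_def)

lemma reflection_in_subspace:
  "\<lbrakk>subspace U; \<delta> \<in> roots; \<delta> \<in> U\<rbrakk> \<Longrightarrow> act (root_reflection \<delta>) x \<in> U \<longleftrightarrow> x \<in> U"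
  using subspace_add[of U "x - (2 * B \<delta> x) *\<^sub>R \<delta>" "(2 * B \<delta> x) *\<^sub>R \<delta>"]
  by (auto simp: act_root_reflection_apply intro: subspace_diff subspace_scale)

lemma canonical_permutes:
  assumes "subspace U" "\<delta> \<in> canonical U" "\<beta> \<in> sub_pos U" "\<beta> \<noteq> \<delta>"
  shows "act (root_reflection \<delta>) \<beta> \<in> sub_pos U"
  using assms reflection_in_subspace[of U \<delta> \<beta>] root_act[of \<beta> "root_reflection \<delta>"]
  by (auto simp: canonical_def sub_pos_def)

lemma simple_canonical: "\<lbrakk>s \<in> S; \<alpha> s \<in> U\<rbrakk> \<Longrightarrow> \<alpha> s \<in> canonical U"
  using simple_permutes[of s] by (auto simp: canonical_def sub_pos_def simple_root lam_simple root_reflection_simple)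

text \<open>The first inversion of a reduced word that lies in \<open>U\<close> is canonical.\<close>

lemma canonical_inversion:
  assumes U: "subspace U" and g: "g \<in> carrier W" and \<beta>: "\<beta> \<in> inv_set g" "\<beta> \<in> U"
  obtains \<delta> where "\<delta> \<in> canonical U" "\<delta> \<in> inv_set g"
proof -
  \<comment> \<open>\<open>n\<close> is the length of a prefix preceding an inversion of
    \<open>g\<close> in \<open>U\<close>; the least such prefix \<open>h\<close> has no inversion in
    \<open>U\<close>, since one could be split off earlier.\<close>
  define Q where "Q n \<longleftrightarrow> (\<exists>h t v. h \<in> carrier W \<and> t \<in> S \<and> v \<in> carrier W \<and> g = h \<otimes> t \<otimes> v \<and>
      len g = len h + 1 + len v \<and> act h (\<alpha> t) \<in> U \<and> len h = n)" for n
  have "\<exists>n. Q n"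
    using inversion_split[OF g \<beta>(1)] \<beta>(2) unfolding Q_def by metis
  then have QL: "Q (LEAST n. Q n)" by (rule LeastI_ex)
  then obtain h t v where h: "h \<in> carrier W" "t \<in> S" "v \<in> carrier W" "g = h \<otimes> t \<otimes> v"
    "len g = len h + 1 + len v" "act h (\<alpha> t) \<in> U" "len h = (LEAST n. Q n)" unfolding Q_def by blast
  have free: "\<gamma> \<notin> U" if \<gamma>: "\<gamma> \<in> inv_set h" for \<gamma>
  proof
    assume "\<gamma> \<in> U"
    obtain h' t' v' where h': "h' \<in> carrier W" "t' \<in> S" "v' \<in> carrier W" "h = h' \<otimes> t' \<otimes> v'"
      "len h = len h' + 1 + len v'" "\<gamma> = act h' (\<alpha> t')" using inversion_split[OF h(1) \<gamma>] .
    have g': "g = h' \<otimes> t' \<otimes> (v' \<otimes> t \<otimes> v)" using h h' by (simp add: m_assoc)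
    have "len g \<le> len h' + 1 + len (v' \<otimes> t \<otimes> v)"
      unfolding g' using len_mult_le[of "h' \<otimes> t'" "v' \<otimes> t \<otimes> v"] len_mult_le[of h' t'] h h' by simp
    moreover have "len (v' \<otimes> t \<otimes> v) \<le> len v' + 1 + len v"
      using len_mult_le[of "v' \<otimes> t" v] len_mult_le[of v' t] h h' by simp
    ultimately have "len g = len h' + 1 + len (v' \<otimes> t \<otimes> v)" using h(5) h'(5) by linarith
    moreover have "v' \<otimes> t \<otimes> v \<in> carrier W" using h h' by simp
    ultimately have "Q (len h')" unfolding Q_def using h' g' \<open>\<gamma> \<in> U\<close> by blast
    then have "(LEAST n. Q n) \<le> len h'" by (rule Least_le)
    then show False using h(7) h'(5) by linarith
  qed
  define \<delta> where "\<delta> = act h (\<alpha> t)"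
  have \<delta>: "\<delta> \<in> inv_set g" unfolding \<delta>_def h(4) by (rule inversion_of_split) (use h in auto)
  have \<delta>r: "\<delta> \<in> roots" "0 < lam \<delta>" "\<delta> \<in> U" using \<delta> h(6) by (auto simp: inv_set_def \<delta>_def)
  have "0 < lam (act (root_reflection \<delta>) \<gamma>)" if \<gamma>: "\<gamma> \<in> sub_pos U" "\<gamma> \<noteq> \<delta>" for \<gamma>
  proof (rule ccontr)
    assume neg: "\<not> 0 < lam (act (root_reflection \<delta>) \<gamma>)"
    define y where "y = act t (act (inv h) \<gamma>)"
    have \<gamma>r: "\<gamma> \<in> roots" "0 < lam \<gamma>" "\<gamma> \<in> U" using \<gamma>(1) by (auto simp: sub_pos_def)
    have sy: "act (root_reflection \<delta>) \<gamma> = act h y"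
      unfolding \<delta>_def y_def using h by (simp add: root_reflection_act_simple act_mult)
    have "0 < lam (act (inv h) \<gamma>)"
      using free[of \<gamma>] \<gamma>r root_lam_nz[of "act (inv h) \<gamma>"] root_act h(1) by (force simp: inv_set_def)
    moreover have "act (inv h) \<gamma> \<noteq> \<alpha> t" using \<gamma>(2) act_act_inv[OF h(1), of \<gamma>] by (auto simp: \<delta>_def)
    ultimately have y: "0 < lam y" "y \<in> roots"
      unfolding y_def using simple_permutes h \<gamma>r root_act by auto
    \<comment> \<open>A second root of \<open>U\<close> made negative by the reflection in \<delta>
      would yield an inversion of \<open>h\<close> lying in \<open>U\<close>.\<close>
    have "- act h y \<in> inv_set h"
      using neg sy y h(1) root_act[of y h] root_lam_nz[of "act h y"]
      by (auto simp: inv_set_def act_minus lam_simps)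
    moreover have "- act h y \<in> U"
      using reflection_in_subspace[OF U \<delta>r(1,3), of \<gamma>] \<gamma>r(3) sy subspace_neg[OF U] by simp
    ultimately show False using free by blast
  qed
  then have "\<delta> \<in> canonical U" using \<delta>r by (auto simp: canonical_def sub_pos_def)
  then show ?thesis using \<delta> that by blast
qed

text \<open>A canonical inversion \<delta> of the reflection in \<beta> serves: that reflection
  makes \<delta> negative, hence \<open>B \<delta> \<beta>\<close> is positive. The number of
  inversions in \<open>U\<close> plays the role of the depth of a root.\<close>

lemma sub_pos_decompose:
  assumes U: "subspace U" and \<beta>: "\<beta> \<in> sub_pos U" "\<beta> \<notin> canonical U"
  obtains \<delta> \<beta>' where "\<delta> \<in> canonical U" "\<beta>' \<in> sub_pos U" "\<beta>' = act (root_reflection \<delta>) \<beta>"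
    "0 < B \<delta> \<beta>" "card (inv_set (root_reflection \<beta>') \<inter> U) < card (inv_set (root_reflection \<beta>) \<inter> U)"
proof -
  note \<beta>r = sub_posD[OF \<beta>(1)]
  have "\<beta> \<in> inv_set (root_reflection \<beta>)"
    using \<beta>r by (simp add: inv_set_def root_reflection_inv root_reflection_self lam_simps)
  then obtain \<delta> where \<delta>: "\<delta> \<in> canonical U" "\<delta> \<in> inv_set (root_reflection \<beta>)"
    using canonical_inversion[OF U root_reflection_closed[OF \<beta>r(1)] _ \<beta>r(2)] by blast
  have \<delta>r: "\<delta> \<in> roots" "\<delta> \<in> U" "0 < lam \<delta>" using canonical_sub_pos[OF \<delta>(1)] by (auto simp: sub_pos_def)
  have ne: "\<beta> \<noteq> \<delta>" using \<delta> \<beta> by blast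
  have neg: "lam (act (root_reflection \<beta>) \<delta>) < 0" using \<delta>(2) \<beta>r by (simp add: inv_set_def root_reflection_inv)
  then have "lam \<delta> < 2 * B \<beta> \<delta> * lam \<beta>" using \<beta>r by (simp add: act_root_reflection_apply lam_simps)
  then have "0 < 2 * B \<beta> \<delta> * lam \<beta>" using \<delta>r by linarith
  then have Bpos: "0 < B \<delta> \<beta>" using \<beta>r B_sym[of \<beta> \<delta>] by (simp add: zero_less_mult_iff)
  define \<beta>' where "\<beta>' = act (root_reflection \<delta>) \<beta>"
  have \<beta>': "\<beta>' \<in> sub_pos U" unfolding \<beta>'_def by (rule canonical_permutes[OF U \<delta>(1) \<beta>(1) ne])
  let ?d = "act (root_reflection \<delta>)" and ?b = "act (root_reflection \<beta>)"
  have dd: "?d (?d x) = x" for x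
    using \<delta>r(1) by (simp add: act_root_reflection reflection_involutive)
  have bb: "?b (?b x) = x" for x
    using \<beta>r(1) by (simp add: act_root_reflection reflection_involutive)
  have R\<beta>': "act (inv (root_reflection \<beta>')) x = ?d (?b (?d x))" for x
    using \<beta>r(1) \<delta>r(1) by (simp add: \<beta>'_def root_reflection_inv root_act root_reflection_act act_mult inv_mult_group)
  \<comment> \<open>The reflection in \<delta> maps the inversions for \<beta>' injectively into
    those for \<beta> and misses \<delta>, so the count drops.\<close>
  have sub: "?d ` (inv_set (root_reflection \<beta>') \<inter> U) \<subseteq> (inv_set (root_reflection \<beta>) \<inter> U) - {\<delta>}"
  proof (rule image_subsetI)
    fix \<gamma> assume "\<gamma> \<in> inv_set (root_reflection \<beta>') \<inter> U"
    then have \<gamma>: "\<gamma> \<in> sub_pos U" and g: "lam (?d (?b (?d \<gamma>))) < 0"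
      by (auto simp: inv_set_def sub_pos_def R\<beta>')
    have "\<gamma> \<noteq> \<delta>"
    proof
      assume "\<gamma> = \<delta>"
      \<comment> \<open>If \<delta> were an inversion for \<beta>', then \<tau>, a positive root of
        \<open>U\<close> other than \<delta>, would be made negative by the canonical
        reflection.\<close>
      define \<tau> where "\<tau> = - ?b \<delta>"
      have \<tau>: "\<tau> \<in> sub_pos U"
        using \<delta>r \<beta>r neg root_act reflection_in_subspace[OF U \<beta>r(1,2), of \<delta>] subspace_neg[OF U]
        by (auto simp: sub_pos_def \<tau>_def lam_simps)
      have "\<tau> \<noteq> \<delta>"
      proof
        assume "\<tau> = \<delta>"
        then have "(2 * B \<beta> \<delta>) *\<^sub>R \<beta> = \<delta> + \<delta>"
          using \<beta>r(1) by (simp add: \<tau>_def act_root_reflection_apply algebra_simps)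
        then have "(1 / 2) *\<^sub>R ((2 * B \<beta> \<delta>) *\<^sub>R \<beta>) = (1 / 2) *\<^sub>R (\<delta> + \<delta>)" by simp
        then have "\<delta> = B \<beta> \<delta> *\<^sub>R \<beta>" by (simp only: scaleR_half_double) simp
        then show False using root_multiple[OF \<delta>r(1) \<beta>r(1)] Bpos B_sym[of \<beta> \<delta>] ne by force
      qed
      then have "0 < lam (?d \<tau>)" using canonical_permutes[OF U \<delta>(1) \<tau>] by (simp add: sub_pos_def)
      then show False using g \<delta>r by (simp add: \<open>\<gamma> = \<delta>\<close> root_reflection_self \<tau>_def act_minus \<beta>r)
    qed
    then have d\<gamma>: "?d \<gamma> \<in> sub_pos U" using canonical_permutes[OF U \<delta>(1) \<gamma>] by blast
    have "lam (?b (?d \<gamma>)) < 0"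
    proof (rule ccontr)
      assume n: "\<not> lam (?b (?d \<gamma>)) < 0"
      have "?b (?d \<gamma>) \<in> sub_pos U"
        using n d\<gamma> \<beta>r root_lam_nz[of "?b (?d \<gamma>)"] root_act reflection_in_subspace[OF U \<beta>r(1,2)]
        by (auto simp: sub_pos_def)
      moreover have "?b (?d \<gamma>) \<noteq> \<delta>"
      proof
        assume "?b (?d \<gamma>) = \<delta>"
        then have "?d \<gamma> = ?b \<delta>" by (metis bb)
        then show False using neg d\<gamma> by (simp add: sub_pos_def)
      qed
      ultimately have "0 < lam (?d (?b (?d \<gamma>)))" using canonical_permutes[OF U \<delta>(1)] by (simp add: sub_pos_def)
      then show False using g by simp
    qed
    moreover have "?d \<gamma> \<noteq> \<delta>"
    proof
      assume "?d \<gamma> = \<delta>"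
      then have "\<gamma> = - \<delta>" using dd[of \<gamma>] \<delta>r by (simp add: root_reflection_self)
      then show False using \<gamma> \<delta>r by (simp add: sub_pos_def lam_simps)
    qed
    ultimately show "?d \<gamma> \<in> (inv_set (root_reflection \<beta>) \<inter> U) - {\<delta>}"
      using d\<gamma> \<beta>r(1) by (auto simp: sub_pos_def inv_set_def root_reflection_inv)
  qed
  have fin: "finite (inv_set (root_reflection \<beta>) \<inter> U)" using inv_set_card(1) \<beta>r(1) by blast
  have "inj_on ?d A" for A using dd by (metis inj_onI)
  then have "card (inv_set (root_reflection \<beta>') \<inter> U) = card (?d ` (inv_set (root_reflection \<beta>') \<inter> U))"
    by (simp add: card_image)
  also have "\<dots> \<le> card ((inv_set (root_reflection \<beta>) \<inter> U) - {\<delta>})"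
    using sub fin by (intro card_mono) auto
  also have "\<dots> < card (inv_set (root_reflection \<beta>) \<inter> U)"
    using fin \<delta>(2) \<delta>r by (intro psubset_card_mono) auto
  finally show ?thesis using that \<delta>(1) \<beta>' Bpos \<beta>'_def by blast
qed

text \<open>\<open>sub_pos_decompose\<close> run backwards. The condition
  \<open>B \<delta> \<gamma> < 0\<close> means that each step adds a positive multiple of a
  canonical root, so nonnegativity statements pass through the induction.\<close>

lemma sub_pos_induct [consumes 2, case_names canonical reflect]:
  assumes U: "subspace U" and \<beta>: "\<beta> \<in> sub_pos U"
    and can: "\<And>\<delta>. \<delta> \<in> canonical U \<Longrightarrow> P \<delta>"
    and refl: "\<And>\<gamma> \<delta>. \<lbrakk>\<gamma> \<in> sub_pos U; \<delta> \<in> canonical U; \<gamma> - (2 * B \<delta> \<gamma>) *\<^sub>R \<delta> \<in> sub_pos U; B \<delta> \<gamma> < 0; P \<gamma>\<rbrakk>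
      \<Longrightarrow> P (\<gamma> - (2 * B \<delta> \<gamma>) *\<^sub>R \<delta>)"
  shows "P \<beta>"
  using \<beta>
proof (induction "card (inv_set (root_reflection \<beta>) \<inter> U)" arbitrary: \<beta> rule: less_induct)
  case less
  show ?case
  proof (cases "\<beta> \<in> canonical U")
    case False
    obtain \<delta> \<beta>' where d: "\<delta> \<in> canonical U" "\<beta>' \<in> sub_pos U" "\<beta>' = act (root_reflection \<delta>) \<beta>" "0 < B \<delta> \<beta>"
      "card (inv_set (root_reflection \<beta>') \<inter> U) < card (inv_set (root_reflection \<beta>) \<inter> U)"
      using sub_pos_decompose[OF U less.prems False] .
    have \<delta>: "\<delta> \<in> roots" using d(1) by (simp add: canonical_def sub_pos_def)
    have \<beta>': "\<beta>' = \<beta> - (2 * B \<delta> \<beta>) *\<^sub>R \<delta>" using d(3) \<delta> by (simp add: act_root_reflection_apply)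
    have B': "B \<delta> \<beta>' = - B \<delta> \<beta>" using \<delta> by (simp add: \<beta>' B_simps)
    have \<beta>: "\<beta> = \<beta>' - (2 * B \<delta> \<beta>') *\<^sub>R \<delta>" unfolding B' by (simp add: \<beta>')
    have "P (\<beta>' - (2 * B \<delta> \<beta>') *\<^sub>R \<delta>)"
      by (rule refl) (use d less.hyps[OF d(5) d(2)] B' less.prems \<beta>[symmetric] in auto)
    then show ?thesis using \<beta> by simp
  qed (rule can)
qed

text \<open>Neither summand can be \<delta>, so the reflection in \<delta> keeps both positive,
  while it sends their combination to the negative root -\<delta>.\<close>

lemma canonical_indecomposable:
  assumes U: "subspace U" and \<delta>: "\<delta> \<in> canonical U" and x: "x \<in> sub_pos U" and y: "y \<in> sub_pos U"
    and k: "0 < k" and eq: "\<delta> = x + k *\<^sub>R y"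
  shows False
proof -
  have \<delta>r: "\<delta> \<in> roots" "0 < lam \<delta>" using \<delta> by (auto simp: canonical_def sub_pos_def)
  have xy: "0 < lam x" "0 < lam y" "x \<in> roots" "y \<in> roots" using x y by (auto simp: sub_pos_def)
  have "x \<noteq> \<delta>" using eq k xy by (auto simp: lam_simps)
  moreover have "y \<noteq> \<delta>"
  proof
    assume "y = \<delta>"
    then have e: "x = (1 - k) *\<^sub>R \<delta>" using eq by (simp add: algebra_simps)
    have "0 < (1 - k) * lam \<delta>" using xy(1) e by (simp add: lam_simps)
    then have "0 \<le> 1 - k" using \<delta>r by (simp add: zero_less_mult_iff)
    then have "x = \<delta>" using root_multiple[OF xy(3) \<delta>r(1) e] by blast
    then show False using \<open>x \<noteq> \<delta>\<close> by blast
  qed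
  ultimately have "0 < lam (act (root_reflection \<delta>) x)" "0 < lam (act (root_reflection \<delta>) y)"
    using canonical_permutes[OF U \<delta>] x y by (auto simp: sub_pos_def)
  moreover have "act (root_reflection \<delta>) x + k *\<^sub>R act (root_reflection \<delta>) y = - \<delta>"
    using root_reflection_self[OF \<delta>r(1)] \<delta>r(1) by (metis act_add act_scale eq root_reflection_closed)
  moreover from calculation(1,2) have "0 < lam (act (root_reflection \<delta>) x + k *\<^sub>R act (root_reflection \<delta>) y)"
    using k by (simp add: lam_simps add_pos_pos)
  ultimately have "0 < lam (- \<delta>)" by simp
  then show False using \<delta>r by (simp add: lam_simps)
qed

text \<open>With a positive product, \<delta>' would be its own reflection in \<delta> plus a
  positive multiple of \<delta>, which is impossible for a canonical root.\<close>

lemma canonical_B_le_0: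
  assumes U: "subspace U" and \<delta>: "\<delta> \<in> canonical U" and \<delta>': "\<delta>' \<in> canonical U" and ne: "\<delta> \<noteq> \<delta>'"
  shows "B \<delta> \<delta>' \<le> 0"
proof (rule ccontr)
  assume "\<not> B \<delta> \<delta>' \<le> 0"
  then have b: "0 < B \<delta> \<delta>'" by simp
  note d = canonical_sub_pos[OF \<delta>] and d' = canonical_sub_pos[OF \<delta>']
  have "act (root_reflection \<delta>) \<delta>' \<in> sub_pos U" using canonical_permutes[OF U \<delta> d'] ne by auto
  moreover have "\<delta>' = act (root_reflection \<delta>) \<delta>' + (2 * B \<delta> \<delta>') *\<^sub>R \<delta>"
    using d by (simp add: act_root_reflection_apply sub_pos_def)
  ultimately show False using canonical_indecomposable[OF U \<delta>' _ d, of "act (root_reflection \<delta>) \<delta>'" "2 * B \<delta> \<delta>'"] b by simp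
qed

text \<open>A positive coefficient forces, through \<open>lam\<close>, the other one to be negative;
  pairing with the first root then gives a positive number, since \<open>B\<close> is nonpositive on
  the pair.\<close>

lemma canonical_independent:
  assumes U: "subspace U" and \<delta>: "\<delta> \<in> canonical U" and \<delta>': "\<delta>' \<in> canonical U" and ne: "\<delta> \<noteq> \<delta>'"
    and eq: "x *\<^sub>R \<delta> + y *\<^sub>R \<delta>' = 0"
  shows "x = 0 \<and> y = 0"
proof -
  note d = canonical_sub_pos[OF \<delta>] and d' = canonical_sub_pos[OF \<delta>']
  have l: "0 < lam \<delta>" "0 < lam \<delta>'" "\<delta> \<in> roots" "\<delta>' \<in> roots" using d d' by (auto simp: sub_pos_def)
  have le: "B \<delta> \<delta>' \<le> 0" by (rule canonical_B_le_0[OF U \<delta> \<delta>' ne])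
  have e1: "x * lam \<delta> + y * lam \<delta>' = 0" using eq by (metis lam_simps(1,4,5) real_scaleR_def)
  have e2: "x + y * B \<delta> \<delta>' = 0" using arg_cong[OF eq, of "B \<delta>"] l by (simp add: B_simps)
  have e3: "x * B \<delta> \<delta>' + y = 0" using arg_cong[OF eq, of "B \<delta>'"] l B_sym[of \<delta> \<delta>'] by (simp add: B_simps)
  have "x \<le> 0"
  proof (rule ccontr)
    assume "\<not> x \<le> 0"
    then have "0 < x * lam \<delta>" using l by simp
    then have "y * lam \<delta>' < 0" using e1 by linarith
    then have "y < 0" using l by (simp add: mult_less_0_iff)
    then have "0 \<le> y * B \<delta> \<delta>'" using le by (simp add: mult_nonpos_nonpos)
    then show False using e2 \<open>\<not> x \<le> 0\<close> by linarith
  qed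
  moreover have "y \<le> 0"
  proof (rule ccontr)
    assume "\<not> y \<le> 0"
    then have "0 < y * lam \<delta>'" using l by simp
    then have "x * lam \<delta> < 0" using e1 by linarith
    then have "x < 0" using l by (simp add: mult_less_0_iff)
    then have "0 \<le> x * B \<delta> \<delta>'" using le by (simp add: mult_nonpos_nonpos)
    then show False using e3 \<open>\<not> y \<le> 0\<close> by linarith
  qed
  ultimately have "x * lam \<delta> \<le> 0" "y * lam \<delta>' \<le> 0" using l by (auto simp: mult_nonpos_nonneg)
  then have "x * lam \<delta> = 0" "y * lam \<delta>' = 0" using e1 by linarith+
  then show ?thesis using l by simp
qed

lemma canonical_independent_eq:
  assumes "subspace U" "\<delta> \<in> canonical U" "\<delta>' \<in> canonical U" "\<delta> \<noteq> \<delta>'"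
    and "x *\<^sub>R \<delta> + y *\<^sub>R \<delta>' = x' *\<^sub>R \<delta> + y' *\<^sub>R \<delta>'"
  shows "x = x' \<and> y = y'"
  using canonical_independent[OF assms(1-4), of "x - x'" "y - y'"] assms(5) by (simp add: algebra_simps)

section \<open>Subsystems of rank two\<close>

lemma plane_elem: "x \<in> span {a, b} \<longleftrightarrow> (\<exists>p q. x = p *\<^sub>R a + q *\<^sub>R b)" for a b :: "'a::real_vector"
proof
  assume "x \<in> span {a, b}"
  then obtain p where "x - p *\<^sub>R a \<in> span {b}" using span_breakdown_eq[of x a "{b}"] by auto
  then obtain q where "x - p *\<^sub>R a = q *\<^sub>R b" by (auto simp: span_singleton)
  then have "x = p *\<^sub>R a + q *\<^sub>R b" by (simp add: algebra_simps)
  then show "\<exists>p q. x = p *\<^sub>R a + q *\<^sub>R b" by blast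
qed (auto intro!: span_add span_scale intro: span_base)

text \<open>A third canonical root would have nonnegative coefficients, because its products with
  the two are nonpositive and it is positive. Then its product with itself would be at most 0
  instead of 1.\<close>

lemma plane_canonical:
  assumes U: "subspace U" and \<delta>1: "\<delta>1 \<in> canonical U" and \<delta>2: "\<delta>2 \<in> canonical U" and ne: "\<delta>1 \<noteq> \<delta>2"
    and span: "U \<subseteq> span {\<delta>1, \<delta>2}"
  shows "canonical U = {\<delta>1, \<delta>2}"
proof -
  have "\<kappa> \<in> {\<delta>1, \<delta>2}" if \<kappa>: "\<kappa> \<in> canonical U" for \<kappa>
  proof (rule ccontr)
    assume nk: "\<kappa> \<notin> {\<delta>1, \<delta>2}"
    have l: "0 < lam \<delta>1" "0 < lam \<delta>2" "0 < lam \<kappa>" "\<delta>1 \<in> roots" "\<delta>2 \<in> roots" "\<kappa> \<in> roots" "\<kappa> \<in> U"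
      using canonical_sub_pos \<delta>1 \<delta>2 \<kappa> by (auto simp: sub_pos_def)
    obtain p q where pq: "\<kappa> = p *\<^sub>R \<delta>1 + q *\<^sub>R \<delta>2" using l(7) span plane_elem by blast
    have b: "B \<kappa> \<delta>1 \<le> 0" "B \<kappa> \<delta>2 \<le> 0" "B \<delta>1 \<delta>2 \<le> 0"
      using canonical_B_le_0[OF U] \<kappa> \<delta>1 \<delta>2 nk ne by auto
    have "B \<kappa> \<kappa> = p * B \<kappa> \<delta>1 + q * B \<kappa> \<delta>2" by (simp add: B_simps pq)
    then have e1: "p * B \<kappa> \<delta>1 + q * B \<kappa> \<delta>2 = 1" using l by simp
    have e2: "B \<kappa> \<delta>1 = p + q * B \<delta>1 \<delta>2" "B \<kappa> \<delta>2 = p * B \<delta>1 \<delta>2 + q"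
      using l B_sym[of \<delta>1 \<delta>2] by (simp_all add: B_simps pq)
    have e3: "0 < p * lam \<delta>1 + q * lam \<delta>2" using l(3) by (simp add: pq lam_simps)
    have "p \<ge> 0"
    proof (rule ccontr)
      assume p: "\<not> p \<ge> 0"
      then have "p * lam \<delta>1 < 0" using l by (simp add: mult_less_0_iff)
      then have "0 < q * lam \<delta>2" using e3 by linarith
      then have "0 < q" using l by (simp add: zero_less_mult_iff)
      moreover have "0 \<le> p * B \<delta>1 \<delta>2" using p b by (simp add: mult_nonpos_nonpos)
      ultimately show False using e2(2) b(2) by linarith
    qed
    moreover have "q \<ge> 0"
    proof (rule ccontr)
      assume p: "\<not> q \<ge> 0"
      then have "q * lam \<delta>2 < 0" using l by (simp add: mult_less_0_iff)
      then have "0 < p * lam \<delta>1" using e3 by linarith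
      then have "0 < p" using l by (simp add: zero_less_mult_iff)
      moreover have "0 \<le> q * B \<delta>1 \<delta>2" using p b by (simp add: mult_nonpos_nonpos)
      ultimately show False using e2(1) b(1) by linarith
    qed
    ultimately have "p * B \<kappa> \<delta>1 \<le> 0" "q * B \<kappa> \<delta>2 \<le> 0" using b by (auto simp: mult_nonneg_nonpos)
    then show False using e1 by linarith
  qed
  then show ?thesis using \<delta>1 \<delta>2 by blast
qed

text \<open>Within the plane the two roots are all the canonical ones, so
  \<open>sub_pos_induct\<close> builds \<beta> from them with nonnegative coefficients.\<close>

lemma plane_coherent:
  assumes U: "subspace U" and \<delta>1: "\<delta>1 \<in> canonical U" and \<delta>2: "\<delta>2 \<in> canonical U" and ne: "\<delta>1 \<noteq> \<delta>2"
    and \<beta>: "\<beta> \<in> roots" "0 < lam \<beta>" "\<beta> = p *\<^sub>R \<delta>1 + q *\<^sub>R \<delta>2"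
  shows "0 \<le> p \<and> 0 \<le> q"
proof -
  define P where "P = span {\<delta>1, \<delta>2}"
  have P: "subspace P" by (simp add: P_def)
  have PU: "P \<subseteq> U" unfolding P_def
    using canonical_sub_pos[OF \<delta>1] canonical_sub_pos[OF \<delta>2] by (intro span_minimal U) (auto simp: sub_pos_def)
  have c: "\<delta>1 \<in> canonical P" "\<delta>2 \<in> canonical P"
    using canonical_mono[OF \<delta>1 _ PU] canonical_mono[OF \<delta>2 _ PU] by (auto simp: P_def span_base)
  have can: "canonical P = {\<delta>1, \<delta>2}" using plane_canonical[OF P c ne] by (simp add: P_def)
  have "\<beta> \<in> sub_pos P" using \<beta> by (auto simp: sub_pos_def P_def plane_elem)
  with P have "\<exists>a b. 0 \<le> a \<and> 0 \<le> b \<and> \<beta> = a *\<^sub>R \<delta>1 + b *\<^sub>R \<delta>2"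
  proof (induction rule: sub_pos_induct)
    case (canonical \<delta>)
    then have "\<delta> = \<delta>1 \<or> \<delta> = \<delta>2" by (simp add: can)
    then show ?case
    proof
      assume "\<delta> = \<delta>1" then show ?thesis by (intro exI[of _ 1] exI[of _ 0]) simp
    next
      assume "\<delta> = \<delta>2" then show ?thesis by (intro exI[of _ 0] exI[of _ 1]) simp
    qed
  next
    case (reflect \<gamma> \<delta>)
    then obtain a b where ab: "0 \<le> a" "0 \<le> b" "\<gamma> = a *\<^sub>R \<delta>1 + b *\<^sub>R \<delta>2" by blast
    define k where "k = - (2 * B \<delta> \<gamma>)"
    have k: "k \<ge> 0" "\<gamma> - (2 * B \<delta> \<gamma>) *\<^sub>R \<delta> = \<gamma> + k *\<^sub>R \<delta>" using reflect by (auto simp: k_def)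
    have "\<delta> = \<delta>1 \<or> \<delta> = \<delta>2" using reflect by (simp add: can)
    then show ?case
    proof
      assume "\<delta> = \<delta>1" then show ?thesis unfolding k(2)
        using ab k(1) by (intro exI[of _ "a + k"] exI[of _ b]) (simp add: algebra_simps)
    next
      assume "\<delta> = \<delta>2" then show ?thesis unfolding k(2)
        using ab k(1) by (intro exI[of _ a] exI[of _ "b + k"]) (simp add: algebra_simps)
    qed
  qed
  then obtain a b where "0 \<le> a" "0 \<le> b" "\<beta> = a *\<^sub>R \<delta>1 + b *\<^sub>R \<delta>2" by blast
  then show ?thesis using canonical_independent_eq[OF U \<delta>1 \<delta>2 ne] \<beta>(3) by metis
qed

text \<open>The roots \<open>dihedral \<gamma> \<delta> k\<close> are the images of \<open>\<gamma>\<close> and \<open>\<delta>\<close>, in order, under the alternating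
  products of the two reflections.\<close>

definition dihedral :: "'v \<Rightarrow> 'v \<Rightarrow> nat \<Rightarrow> 'v" where
  "dihedral \<gamma> \<delta> k = chebyshev_U (- B \<gamma> \<delta>) (Suc k) *\<^sub>R \<gamma> + chebyshev_U (- B \<gamma> \<delta>) k *\<^sub>R \<delta>"

lemma dihedral_0 [simp]: "dihedral \<gamma> \<delta> 0 = \<gamma>"
  and dihedral_1: "dihedral \<gamma> \<delta> (Suc 0) = \<delta> - (2 * B \<gamma> \<delta>) *\<^sub>R \<gamma>"
  and dihedral_Suc: "dihedral \<gamma> \<delta> (Suc (Suc k)) = (- 2 * B \<gamma> \<delta>) *\<^sub>R dihedral \<gamma> \<delta> (Suc k) - dihedral \<gamma> \<delta> k"
  by (simp_all add: dihedral_def algebra_simps)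

text \<open>Consecutive roots have constant product \<open>- B \<gamma> \<delta>\<close>, so the
  recursion amounts to reflecting the previous root in the current one and negating.\<close>

lemma dihedral_root:
  assumes "\<gamma> \<in> roots" "\<delta> \<in> roots"
  shows "dihedral \<gamma> \<delta> k \<in> roots \<and> dihedral \<gamma> \<delta> (Suc k) \<in> roots \<and>
    B (dihedral \<gamma> \<delta> k) (dihedral \<gamma> \<delta> (Suc k)) = - B \<gamma> \<delta>"
proof (induction k)
  case 0
  have "dihedral \<gamma> \<delta> (Suc 0) = act (root_reflection \<gamma>) \<delta>"
    using assms by (simp add: dihedral_1 act_root_reflection_apply)
  then have "dihedral \<gamma> \<delta> (Suc 0) \<in> roots" using assms root_act[of \<delta> "root_reflection \<gamma>"] by simp
  moreover have "B \<gamma> (dihedral \<gamma> \<delta> (Suc 0)) = - B \<gamma> \<delta>" using assms by (simp add: dihedral_1 B_simps)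
  ultimately show ?case using assms by simp
next
  case (Suc k)
  let ?a = "dihedral \<gamma> \<delta> k" and ?b = "dihedral \<gamma> \<delta> (Suc k)"
  have B: "B ?b ?a = - B \<gamma> \<delta>" using Suc B_sym by metis
  have "dihedral \<gamma> \<delta> (Suc (Suc k)) = - act (root_reflection ?b) ?a"
    using Suc B by (simp add: dihedral_Suc act_root_reflection_apply)
  moreover have "act (root_reflection ?b) ?a \<in> roots" using Suc root_act by blast
  ultimately have "dihedral \<gamma> \<delta> (Suc (Suc k)) \<in> roots" by simp
  moreover have "B ?b (dihedral \<gamma> \<delta> (Suc (Suc k))) = - B \<gamma> \<delta>"
    using Suc B by (simp add: dihedral_Suc B_simps)
  ultimately show ?case using Suc by blast
qed

text \<open>Consecutive values are the coefficients of one root of the plane, hence of equal sign.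
  This is how discreteness of the dihedral group enters without angles.\<close>

lemma chebyshev_U_canonical:
  assumes U: "subspace U" and \<delta>1: "\<delta>1 \<in> canonical U" and \<delta>2: "\<delta>2 \<in> canonical U" and ne: "\<delta>1 \<noteq> \<delta>2"
    and pos: "0 < chebyshev_U (- B \<delta>1 \<delta>2) k"
  shows "0 \<le> chebyshev_U (- B \<delta>1 \<delta>2) (Suc k)"
proof -
  have r: "\<delta>1 \<in> roots" "\<delta>2 \<in> roots" using canonical_sub_pos \<delta>1 \<delta>2 by (auto simp: sub_pos_def)
  let ?E = "dihedral \<delta>1 \<delta>2 k"
  have E: "?E \<in> roots" using dihedral_root[OF r] by blast
  have "0 < lam ?E"
  proof (rule ccontr)
    assume "\<not> 0 < lam ?E"
    then have "0 < lam (- ?E)" using root_lam_nz[OF E] by (simp add: lam_simps)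
    moreover have "- ?E = (- chebyshev_U (- B \<delta>1 \<delta>2) (Suc k)) *\<^sub>R \<delta>1 + (- chebyshev_U (- B \<delta>1 \<delta>2) k) *\<^sub>R \<delta>2"
      by (simp add: dihedral_def)
    ultimately have "0 \<le> - chebyshev_U (- B \<delta>1 \<delta>2) k"
      using plane_coherent[OF U \<delta>1 \<delta>2 ne root_minus[OF E]] by blast
    then show False using pos by simp
  qed
  then show ?thesis using plane_coherent[OF U \<delta>1 \<delta>2 ne E _ dihedral_def] by blast
qed

end

section \<open>Finiteness of the values of the form below one\<close>

text \<open>A positive solution is strictly concave. If some increment is negative, the sequence
  falls at least linearly; otherwise it stays above its first term, and then the increments
  themselves fall at least linearly.\<close>

lemma chebyshev_not_always_pos:
  fixes u :: "nat \<Rightarrow> real"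
  assumes d: "d < 1" and rec: "\<And>k. u (Suc (Suc k)) = 2 * d * u (Suc k) - u k"
  shows "\<exists>k. u k \<le> 0"
proof (rule ccontr)
  assume "\<not> ?thesis"
  then have pos: "0 < u k" for k by (simp add: not_le)
  define D where "D k = u (Suc k) - u k" for k
  have D: "D (Suc k) = D k - (2 - 2 * d) * u (Suc k)" for k by (simp add: D_def rec algebra_simps)
  have dec: "D (Suc k) \<le> D k" for k using D[of k] pos[of "Suc k"] d by simp
  have anti: "D (k + n) \<le> D k" for k n by (induction n) (auto intro: order.trans[OF dec])
  show False
  proof (cases "\<exists>k. D k < 0")
    case True
    then obtain k where k: "D k < 0" by blast
    have "u (k + n) \<le> u k + real n * D k" for n
    proof (induction n)
      case (Suc n)
      have "u (k + Suc n) = u (k + n) + D (k + n)" by (simp add: D_def)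
      then show ?case using Suc anti[of k n] by (simp add: algebra_simps)
    qed simp
    moreover obtain n where "u k < real n * (- D k)" using k reals_Archimedean3[of "- D k"] by auto
    ultimately have "u (k + n) < 0" by (smt (verit) mult_minus_right)
    then show False using pos[of "k + n"] by simp
  next
    case False
    then have Dn: "0 \<le> D k" for k by (simp add: not_less)
    have u0: "u 0 \<le> u k" for k
    proof (induction k)
      case (Suc k)
      then show ?case using Dn[of k] by (simp add: D_def)
    qed simp
    have "D n \<le> D 0 - real n * ((2 - 2 * d) * u 0)" for n
    proof (induction n)
      case (Suc n)
      have "(2 - 2 * d) * u 0 \<le> (2 - 2 * d) * u (Suc n)" using d u0 by (intro mult_left_mono) auto
      then show ?case using Suc D[of n] by (simp add: algebra_simps)
    qed simp
    moreover have "0 < (2 - 2 * d) * u 0" using d pos by simp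
    then obtain n where "D 0 < real n * ((2 - 2 * d) * u 0)" using reals_Archimedean3 by blast
    ultimately have "D n < 0" by (smt (verit))
    then show False using Dn[of n] by simp
  qed
qed

text \<open>Steinitz exchange: an extra vector outside the span of \<open>I\<close> would give an
  independent set larger than \<open>T\<close>.\<close>

lemma span_exchange:
  fixes T I :: "'a::real_vector set"
  assumes "finite T" "independent I" "I \<subseteq> span T" "card T \<le> card I"
  shows "span T \<subseteq> span I"
proof
  fix x assume x: "x \<in> span T"
  show "x \<in> span I"
  proof (rule ccontr)
    assume nx: "x \<notin> span I"
    then have "independent (insert x I)" using assms(2) by (rule independent_insertI)
    then have "card (insert x I) \<le> card T" "finite (insert x I)"
      using independent_span_bound[OF assms(1), of "insert x I"] x assms(3) by auto
    moreover have "x \<notin> I" using nx span_base by blast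
    ultimately show False using assms(4) by simp
  qed
qed

context finite_based_root_system
begin

section \<open>Planes on which the form is positive definite\<close>

lemma independent_canonical:
  assumes U: "subspace U" and "\<delta>1 \<in> canonical U" "\<delta>2 \<in> canonical U" "\<delta>1 \<noteq> \<delta>2"
  shows "independent {\<delta>1, \<delta>2}"
proof -
  have "\<delta>2 \<noteq> 0" using canonical_independent[OF assms, of 0 1] by auto
  moreover have "\<delta>1 \<notin> span {\<delta>2}"
  proof
    assume "\<delta>1 \<in> span {\<delta>2}"
    then obtain k where "\<delta>1 = k *\<^sub>R \<delta>2" by (auto simp: span_singleton)
    then show False using canonical_independent[OF assms, of 1 "- k"] by simp
  qed
  ultimately show ?thesis by (simp add: independent_insert assms(4))
qed

lemma posdef_plane:
  fixes b p q :: real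
  assumes "\<bar>b\<bar> < 1" "p \<noteq> 0 \<or> q \<noteq> 0"
  shows "0 < p * p + q * q + 2 * (p * q * b)"
proof -
  have eq: "p * p + q * q + 2 * (p * q * b) = (p + b * q)\<^sup>2 + (1 - b\<^sup>2) * q\<^sup>2"
    by (simp add: power2_eq_square algebra_simps)
  have b: "0 < 1 - b\<^sup>2" using assms(1) by (simp add: abs_square_less_1)
  show ?thesis
  proof (cases "q = 0")
    case True
    then show ?thesis using assms(2) by (auto simp: zero_less_mult_iff linorder_neq_iff)
  next
    case False
    then have "0 < (1 - b\<^sup>2) * q\<^sup>2" using b by simp
    then show ?thesis unfolding eq by (smt (verit) zero_le_power2)
  qed
qed

lemma canonical_exists:
  assumes U: "subspace U" and \<beta>: "\<beta> \<in> sub_pos U"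
  shows "\<exists>\<delta>. \<delta> \<in> canonical U"
  using canonical_inversion[OF U, of "root_reflection \<beta>" \<beta>] \<beta>
  by (auto simp: sub_pos_def inv_set_def root_reflection_inv root_reflection_self lam_simps)

lemma sub_pos_or_minus:
  assumes "subspace U" "\<beta> \<in> roots" "\<beta> \<in> U"
  shows "\<beta> \<in> sub_pos U \<or> - \<beta> \<in> sub_pos U"
  using assms root_lam_nz[of \<beta>] by (auto simp: sub_pos_def lam_simps subspace_neg)

text \<open>With a single canonical root the plane would contain only one root up to sign,
  contradicting |B| < 1. The bound on the product is positive definiteness applied to the nonzero
  vector \<delta>1 + \<delta>2.\<close>

lemma plane_canonical_pair:
  assumes \<beta>: "\<beta> \<in> roots" and \<gamma>: "\<gamma> \<in> roots" and b: "\<bar>B \<beta> \<gamma>\<bar> < 1"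
  obtains \<delta>1 \<delta>2 where "\<delta>1 \<in> canonical (span {\<beta>, \<gamma>})" "\<delta>2 \<in> canonical (span {\<beta>, \<gamma>})" "\<delta>1 \<noteq> \<delta>2"
    "- 1 < B \<delta>1 \<delta>2" "span {\<beta>, \<gamma>} \<subseteq> span {\<delta>1, \<delta>2}"
proof -
  define U where "U = span {\<beta>, \<gamma>}"
  have U: "subspace U" "\<beta> \<in> U" "\<gamma> \<in> U" by (auto simp: U_def span_base)
  note pm = sub_pos_or_minus[OF U(1) \<beta> U(2)] sub_pos_or_minus[OF U(1) \<gamma> U(3)]
  obtain \<delta>1 where \<delta>1: "\<delta>1 \<in> canonical U" using canonical_exists[OF U(1)] pm by blast
  have "\<exists>\<delta>2 \<in> canonical U. \<delta>2 \<noteq> \<delta>1"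
  proof (rule ccontr)
    assume "\<not> ?thesis"
    then have only: "\<delta> = \<delta>1" if "\<delta> \<in> canonical U" for \<delta> using that by blast
    have "x = \<delta>1" if "x \<in> sub_pos U" for x
      using U(1) that
    proof (induction rule: sub_pos_induct)
      case (reflect \<gamma> \<delta>)
      then have "\<delta> = \<delta>1" "\<gamma> = \<delta>1" using only by auto
      then have "B \<delta> \<gamma> = 1" using \<delta>1 by (simp add: canonical_def sub_pos_def)
      then show ?case using reflect by simp
    qed (rule only)
    then have "\<beta> \<in> {\<delta>1, - \<delta>1}" "\<gamma> \<in> {\<delta>1, - \<delta>1}" using pm by (metis insertCI minus_minus)+
    moreover have "B \<delta>1 \<delta>1 = 1" using \<delta>1 by (simp add: canonical_def sub_pos_def)
    ultimately show False using b by (auto simp: B_simps)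
  qed
  then obtain \<delta>2 where \<delta>2: "\<delta>2 \<in> canonical U" "\<delta>1 \<noteq> \<delta>2" by blast
  have in_U: "\<delta>1 \<in> U" "\<delta>2 \<in> U" "\<delta>1 \<in> roots" "\<delta>2 \<in> roots"
    using \<delta>1 \<delta>2 by (auto simp: canonical_def sub_pos_def)
  obtain p q where pq: "\<delta>1 + \<delta>2 = p *\<^sub>R \<beta> + q *\<^sub>R \<gamma>"
    using in_U(1,2) subspace_add[OF U(1)] plane_elem unfolding U_def by meson
  have "\<delta>1 + \<delta>2 \<noteq> 0" using canonical_independent[OF U(1) \<delta>1 \<delta>2, of 1 1] by auto
  then have "p \<noteq> 0 \<or> q \<noteq> 0" using pq by auto
  then have "0 < p * p + q * q + 2 * (p * q * B \<beta> \<gamma>)" by (rule posdef_plane[OF b])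
  also have "\<dots> = B (\<delta>1 + \<delta>2) (\<delta>1 + \<delta>2)"
    unfolding pq using \<beta> \<gamma> B_sym[of \<gamma> \<beta>] by (simp add: B_simps algebra_simps)
  also have "\<dots> = 2 + 2 * B \<delta>1 \<delta>2" using in_U(3,4) B_sym[of \<delta>2 \<delta>1] by (simp add: B_simps)
  finally have "- 1 < B \<delta>1 \<delta>2" by simp
  moreover have "span {\<beta>, \<gamma>} \<subseteq> span {\<delta>1, \<delta>2}"
  proof (rule span_exchange)
    show "independent {\<delta>1, \<delta>2}" by (rule independent_canonical[OF U(1) \<delta>1 \<delta>2])
    show "card {\<beta>, \<gamma>} \<le> card {\<delta>1, \<delta>2}" using \<delta>2(2) by (simp add: card_insert_if)
  qed (use in_U in \<open>auto simp: U_def\<close>)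
  ultimately show ?thesis using that \<delta>1 \<delta>2 unfolding U_def by blast
qed

text \<open>The first nonpositive value after index 0 vanishes by
  \<open>chebyshev_U_canonical\<close>. The root one step before is then a positive multiple of
  \<delta>2, hence equal to it, which makes the preceding value 1. \<open>Suc (Suc M)\<close> is the
  order of the dihedral rotation.\<close>

lemma chebyshev_U_period:
  assumes U: "subspace U" and \<delta>1: "\<delta>1 \<in> canonical U" and \<delta>2: "\<delta>2 \<in> canonical U" and ne: "\<delta>1 \<noteq> \<delta>2"
    and d: "- 1 < B \<delta>1 \<delta>2"
  obtains M where "chebyshev_U (- B \<delta>1 \<delta>2) (Suc (Suc M)) = 0" "chebyshev_U (- B \<delta>1 \<delta>2) (Suc M) = 1"
    "\<And>k. \<lbrakk>0 < k; k < Suc (Suc M)\<rbrakk> \<Longrightarrow> 0 < chebyshev_U (- B \<delta>1 \<delta>2) k"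
proof -
  let ?u = "chebyshev_U (- B \<delta>1 \<delta>2)"
  have r: "\<delta>1 \<in> roots" "\<delta>2 \<in> roots" "0 < lam \<delta>2" using canonical_sub_pos \<delta>1 \<delta>2 by (auto simp: sub_pos_def)
  obtain k where "?u (Suc k) \<le> 0"
    using chebyshev_not_always_pos[of "- B \<delta>1 \<delta>2" "\<lambda>k. ?u (Suc k)"] d by auto
  define N where "N = (LEAST k. ?u (Suc k) \<le> 0)"
  have N: "?u (Suc N) \<le> 0" unfolding N_def by (rule LeastI, fact)
  have less: "0 < ?u (Suc k)" if "k < N" for k using not_less_Least[of k "\<lambda>k. ?u (Suc k) \<le> 0"] that by (auto simp: N_def)
  have "N \<noteq> 0" using N by (intro notI) simp
  then obtain M where M: "N = Suc M" by (cases N) auto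
  have zero: "?u (Suc (Suc M)) = 0"
    using chebyshev_U_canonical[OF U \<delta>1 \<delta>2 ne less[of M]] N M by simp
  have "dihedral \<delta>1 \<delta>2 (Suc M) = ?u (Suc M) *\<^sub>R \<delta>2" by (simp add: dihedral_def zero del: chebyshev_U.simps)
  then have "?u (Suc M) *\<^sub>R \<delta>2 = \<delta>2"
    using dihedral_root[OF r(1,2), of "Suc M"] root_multiple[OF _ r(2), of _ "?u (Suc M)"] less[of M] M by force
  then have "?u (Suc M) * lam \<delta>2 = lam \<delta>2" by (metis lam_simps(4) real_scaleR_def)
  then have "?u (Suc M) = 1" using r by simp
  moreover have "0 < ?u k" if "0 < k" "k < Suc (Suc M)" for k
    using less[of "k - 1"] that M by (cases k) auto
  ultimately show ?thesis using that zero by blast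
qed

text \<open>The functional is the average of \<open>lam\<close> over the rotations of the plane.\<close>

lemma posdef_functional:
  assumes \<beta>: "\<beta> \<in> roots" and \<gamma>: "\<gamma> \<in> roots" and b: "\<bar>B \<beta> \<gamma>\<bar> < 1"
  obtains \<Lambda> :: "'v \<Rightarrow> real" where "linear \<Lambda>" "\<Lambda> \<beta> = 0" "\<Lambda> \<gamma> = 0"
    "finite {\<delta> \<in> roots. 0 < lam \<delta> \<and> \<Lambda> \<delta> \<le> 0}"
proof -
  define U where "U = span {\<beta>, \<gamma>}"
  have U: "subspace U" "\<beta> \<in> U" "\<gamma> \<in> U" by (auto simp: U_def span_base)
  obtain \<delta>1 \<delta>2 where c: "\<delta>1 \<in> canonical U" "\<delta>2 \<in> canonical U" "\<delta>1 \<noteq> \<delta>2" "- 1 < B \<delta>1 \<delta>2" "U \<subseteq> span {\<delta>1, \<delta>2}"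
    using plane_canonical_pair[OF assms] unfolding U_def by blast
  have r: "\<delta>1 \<in> roots" "\<delta>2 \<in> roots" "\<delta>1 \<in> U" "\<delta>2 \<in> U" using c(1,2) by (auto simp: canonical_def sub_pos_def)
  define d where "d = - B \<delta>1 \<delta>2"
  have d: "0 \<le> d" "d < 1" "B \<delta>1 \<delta>2 = - d" "B \<delta>2 \<delta>1 = - d"
    using c(4) canonical_B_le_0[OF U(1) c(1-3)] B_sym[of \<delta>2 \<delta>1] by (auto simp: d_def)
  obtain M where M: "chebyshev_U d (Suc (Suc M)) = 0" "chebyshev_U d (Suc M) = 1"
    using chebyshev_U_period[OF U(1) c(1-4)] unfolding d_def by metis
  define E where "E = dihedral \<delta>1 \<delta>2"
  have E0: "E 0 = \<delta>1" and E1: "E 1 = \<delta>2 + (2 * d) *\<^sub>R \<delta>1" and Erec: "E (Suc (Suc k)) = (2 * d) *\<^sub>R E (Suc k) - E k" for k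
    by (simp_all add: E_def dihedral_1 dihedral_Suc d)
  define L where "L = Suc (Suc M)"
  \<comment> \<open>Half a turn negates the sequence of roots: \<open>L\<close> steps lead from
    \<delta>1 to its negative.\<close>
  have EL: "E (k + L) = - E k \<and> E (Suc k + L) = - E (Suc k)" for k
  proof (induction k)
    case 0
    have a: "E L = - E 0"
      using M by (simp add: E_def dihedral_def L_def d)
    have b: "E (Suc M) = \<delta>2"
      using M by (simp add: E_def dihedral_def d del: chebyshev_U.simps)
    have "E (Suc L) = (2 * d) *\<^sub>R E L - E (Suc M)" unfolding L_def by (rule Erec)
    then show ?case using a b E0 E1 by simp
  next
    case (Suc k)
    then show ?case using Erec[of k] Erec[of "k + L"] by simp
  qed
  have E2L: "E (k + 2 * L) = E k" for k
    using EL[of k] EL[of "k + L"] by (simp add: mult_2 add.assoc)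
  \<comment> \<open>The rotation of the plane; it moves the sequence \<open>E\<close> by two places,
    so its power \<open>L\<close> fixes the plane pointwise.\<close>
  define R where "R = root_reflection \<delta>1 \<otimes> root_reflection \<delta>2"
  have R: "R \<in> carrier W" using r by (simp add: R_def)
  have Ract: "act R x = act (root_reflection \<delta>1) (act (root_reflection \<delta>2) x)" for x
    using r by (simp add: R_def act_mult)
  have two: "(2 * y) *\<^sub>R x = y *\<^sub>R x + y *\<^sub>R x" for y :: real and x :: 'v
    by (simp flip: scaleR_add_left)
  have s1: "act (root_reflection \<delta>1) \<delta>2 = E 1" "act (root_reflection \<delta>1) \<delta>1 = - \<delta>1"
    using r d E1 by (simp_all add: act_root_reflection_apply scaleR_2)
  have R1: "act R \<delta>1 = E 2"
  proof -
    have "act (root_reflection \<delta>2) \<delta>1 = \<delta>1 + (2 * d) *\<^sub>R \<delta>2"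
      using r d by (simp add: act_root_reflection_apply)
    then have "act R \<delta>1 = - \<delta>1 + (2 * d) *\<^sub>R E 1" using r by (simp add: Ract act_add act_scale s1)
    then show ?thesis using Erec[of 0] E0 by (simp add: numeral_2_eq_2)
  qed
  have Rsum: "act R (E 1) = E 3"
  proof -
    have "act (root_reflection \<delta>2) (E 1) = - \<delta>2 + (2 * d) *\<^sub>R (\<delta>1 + (2 * d) *\<^sub>R \<delta>2)"
      using r d E1 by (simp add: act_root_reflection_apply B_simps algebra_simps two scaleR_2)
    then have "act R (E 1) = - E 1 + (2 * d) *\<^sub>R (- \<delta>1 + (2 * d) *\<^sub>R E 1)"
      using r by (simp add: Ract act_add act_scale act_minus act_diff s1)
    also have "\<dots> = E 3" by (simp add: numeral_3_eq_3 Erec E0)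
    finally show ?thesis .
  qed
  have RE: "act R (E k) = E (k + 2) \<and> act R (E (Suc k)) = E (Suc k + 2)" for k
  proof (induction k)
    case 0
    then show ?case using R1 Rsum E0 by (simp add: numeral_3_eq_3 numeral_2_eq_2)
  next
    case (Suc k)
    then show ?case using Erec[of k] Erec[of "Suc (Suc k)"] R by (simp add: act_diff act_scale)
  qed
  have RnE: "act (R [^] n) (E k) = E (k + 2 * n)" for n :: nat and k
  proof (induction n arbitrary: k)
    case (Suc n)
    have "act (R [^] Suc n) (E k) = act (R [^] n) (act R (E k))" using R by (simp add: act_mult)
    also have "\<dots> = E (k + 2 * Suc n)" using RE[of k] Suc[of "k + 2"] by simp
    finally show ?case .
  qed simp
  have RL1: "act (R [^] L) \<delta>1 = \<delta>1" using RnE[of L 0] E2L[of 0] E0 by simp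
  have RLE1: "act (R [^] L) (E 1) = E 1" using RnE[of L 1] E2L[of 1] by simp
  have "\<delta>2 = E 1 - (2 * d) *\<^sub>R \<delta>1" using E1 by simp
  then have RL2: "act (R [^] L) \<delta>2 = \<delta>2" using RL1 RLE1 R by (simp add: act_diff act_scale)
  define \<Lambda> where "\<Lambda> v = (\<Sum>n<L. lam (act (R [^] n) v))" for v
  have lin: "linear \<Lambda>"
    unfolding \<Lambda>_def using R
    by (intro linear_compose_sum ballI) (auto intro!: linear_compose[OF linear_act linear_lam, unfolded o_def])
  \<comment> \<open>The orbit sum \<open>X\<close> is fixed by the rotation, so both reflections
    agree on it; independence makes \<open>X\<close> orthogonal to \<delta>1 and \<delta>2, and
    nondegeneracy gives \<open>X = 0\<close>.\<close>
  have zero: "\<Lambda> p = 0" if p: "p \<in> U" "act (R [^] L) p = p" for p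
  proof -
    define X where "X = (\<Sum>n<L. act (R [^] n) p)"
    have inU: "act (R [^] n) p \<in> U" for n :: nat
    proof -
      have "x \<in> U \<Longrightarrow> act (R [^] n) x \<in> U" for x
      proof (induction n arbitrary: x)
        case (Suc n)
        then show ?case using R by (simp add: act_mult Ract reflection_in_subspace[OF U(1)] r)
      qed simp
      then show ?thesis using p by blast
    qed
    have "act R X = (\<Sum>n<L. act R (act (R [^] n) p))"
      unfolding X_def using linear_sum[OF linear_act[OF R]] .
    also have "\<dots> = (\<Sum>n<L. act (R [^] Suc n) p)"
    proof (intro sum.cong refl)
      fix n
      have "R [^] Suc n = R \<otimes> R [^] n" by (rule nat_pow_Suc2[OF R])
      then show "act R (act (R [^] n) p) = act (R [^] Suc n) p" using R by (simp only: act_mult nat_pow_closed)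
    qed simp
    also have "\<dots> = X"
    proof -
      have "act (R [^] (0::nat)) p + (\<Sum>n<L. act (R [^] Suc n) p) = (\<Sum>n<Suc L. act (R [^] n) p)"
        by (simp only: sum.lessThan_Suc_shift)
      also have "\<dots> = X + p" unfolding sum.lessThan_Suc by (simp add: p X_def)
      finally show ?thesis by simp
    qed
    finally have RX: "act R X = X" .
    have "X \<in> U" unfolding X_def using inU U(1) by (intro subspace_sum)
    then obtain x y where xy: "X = x *\<^sub>R \<delta>1 + y *\<^sub>R \<delta>2" using c(5) plane_elem by blast
    have "act (root_reflection \<delta>2) X = act (root_reflection \<delta>1) X"
      using RX r act_inv_act[of "root_reflection \<delta>1" "act (root_reflection \<delta>2) X"]
      by (simp add: Ract root_reflection_inv)
    then have "(- 2 * B \<delta>1 X) *\<^sub>R \<delta>1 + (2 * B \<delta>2 X) *\<^sub>R \<delta>2 = 0"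
      using r by (simp add: act_root_reflection_apply)
    then have "B \<delta>1 X = 0" "B \<delta>2 X = 0" using canonical_independent[OF U(1) c(1-3)] by fastforce+
    moreover have "B \<delta>1 X = x - d * y" "B \<delta>2 X = y - d * x" using r d(3,4) by (simp_all add: xy B_simps)
    ultimately have e: "x - d * y = 0" "y - d * x = 0" by auto
    have "(1 - d * d) * x = (x - d * y) + d * (y - d * x)" by (simp add: algebra_simps)
    also have "\<dots> = 0" unfolding e by simp
    finally have "(1 - d * d) * x = 0" .
    moreover have "d * d < 1" using d(1,2) mult_strict_mono'[of d 1 d 1] by simp
    ultimately have "x = 0" by simp
    then have "X = 0" using e(2) xy by simp
    then have "lam X = 0" by (simp add: lam_simps)
    then show ?thesis unfolding \<Lambda>_def X_def by (simp add: lam_simps)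
  qed
  have z: "\<Lambda> \<delta>1 = 0" "\<Lambda> \<delta>2 = 0" using zero r RL1 RL2 by auto
  have vanish: "\<Lambda> x = 0" if "x \<in> U" for x
  proof -
    obtain p q where "x = p *\<^sub>R \<delta>1 + q *\<^sub>R \<delta>2" using c(5) plane_elem \<open>x \<in> U\<close> by blast
    then show ?thesis using z by (simp add: linear_add[OF lin] linear_cmul[OF lin])
  qed
  \<comment> \<open>A nonpositive sum has a nonpositive term, so \<delta> is inverted by one of
    finitely many group elements.\<close>
  have "{\<delta> \<in> roots. 0 < lam \<delta> \<and> \<Lambda> \<delta> \<le> 0} \<subseteq> (\<Union>n<L. inv_set (inv (R [^] n)))"
  proof
    fix \<delta> assume "\<delta> \<in> {\<delta> \<in> roots. 0 < lam \<delta> \<and> \<Lambda> \<delta> \<le> 0}"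
    then have \<delta>: "\<delta> \<in> roots" "0 < lam \<delta>" "\<Lambda> \<delta> \<le> 0" by auto
    have "\<exists>n<L. lam (act (R [^] n) \<delta>) \<le> 0"
    proof (rule ccontr)
      assume "\<not> ?thesis"
      then have "0 < \<Lambda> \<delta>" unfolding \<Lambda>_def by (intro sum_pos) (auto simp: L_def not_le)
      then show False using \<delta> by simp
    qed
    then obtain n where n: "n < L" "lam (act (R [^] n) \<delta>) \<le> 0" by blast
    then have "lam (act (R [^] n) \<delta>) < 0"
      using root_lam_nz[of "act (R [^] n) \<delta>"] root_act \<delta>(1) R by (auto simp: less_le)
    then show "\<delta> \<in> (\<Union>n<L. inv_set (inv (R [^] n)))" using n(1) \<delta> R by (auto simp: inv_set_def)
  qed
  moreover have "finite (\<Union>n<L. inv_set (inv (R [^] n)))" using R inv_set_card(1) by auto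
  ultimately have "finite {\<delta> \<in> roots. 0 < lam \<delta> \<and> \<Lambda> \<delta> \<le> 0}" by (rule finite_subset)
  then show ?thesis using that lin vanish U by blast
qed

text \<open>The usual passage to the dominant chamber, by reflecting in canonical roots on which the
  functional is negative. The last conjunct records that positive roots on the walls stay positive
  under the inverse; it is what lets \<open>bipodal\<close> transport canonical roots.\<close>

lemma chamber_conjugate:
  assumes U: "subspace U" and "linear (\<Lambda> :: 'v \<Rightarrow> real)" "finite {\<beta> \<in> sub_pos U. \<Lambda> \<beta> < 0}"
  shows "\<exists>z\<in>carrier W. (\<forall>x. act z x \<in> U \<longleftrightarrow> x \<in> U) \<and> (\<forall>\<beta>\<in>sub_pos U. 0 \<le> \<Lambda> (act z \<beta>)) \<and>
    (\<forall>\<beta>\<in>sub_pos U. \<Lambda> \<beta> = 0 \<longrightarrow> 0 < lam (act (inv z) \<beta>))"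
  using assms(2,3)
proof (induction "card {\<beta> \<in> sub_pos U. \<Lambda> \<beta> < 0}" arbitrary: \<Lambda> rule: less_induct)
  case less
  note lin = less.prems(1)
  show ?case
  proof (cases "\<exists>\<delta>\<in>canonical U. \<Lambda> \<delta> < 0")
    case False
    have "0 \<le> \<Lambda> \<beta>" if "\<beta> \<in> sub_pos U" for \<beta>
      using U that
    proof (induction rule: sub_pos_induct)
      case (canonical \<delta>)
      then show ?case using False by (simp add: not_less)
    next
      case (reflect \<gamma> \<delta>)
      have "0 \<le> \<Lambda> \<delta>" using reflect False by (simp add: not_less)
      then have "B \<delta> \<gamma> * \<Lambda> \<delta> \<le> 0" using reflect by (simp add: mult_nonpos_nonneg)
      then show ?case using reflect by (simp add: linear_diff[OF lin] linear_cmul[OF lin])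
    qed
    then show ?thesis by (intro bexI[of _ "\<one>"]) (auto simp: sub_pos_def)
  next
    case True
    then obtain \<delta> where \<delta>: "\<delta> \<in> canonical U" "\<Lambda> \<delta> < 0" by blast
    have r: "\<delta> \<in> roots" "\<delta> \<in> U" "0 < lam \<delta>" using \<delta> by (auto simp: canonical_def sub_pos_def)
    let ?s = "root_reflection \<delta>"
    have ss: "act ?s (act ?s x) = x" for x
      using r(1) by (simp add: act_root_reflection reflection_involutive)
    define \<Lambda>' where "\<Lambda>' x = \<Lambda> (act ?s x)" for x
    have lin': "linear \<Lambda>'"
      unfolding \<Lambda>'_def using linear_compose[OF linear_act[of ?s] lin] r by (simp add: o_def)
    \<comment> \<open>The canonical reflection carries the bad roots of the new functional into the
      old ones without \<delta>.\<close>
    have sub: "{\<beta> \<in> sub_pos U. \<Lambda>' \<beta> < 0} \<subseteq> act ?s ` ({\<beta> \<in> sub_pos U. \<Lambda> \<beta> < 0} - {\<delta>})"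
    proof
      fix \<beta> assume "\<beta> \<in> {\<beta> \<in> sub_pos U. \<Lambda>' \<beta> < 0}"
      then have \<beta>: "\<beta> \<in> sub_pos U" "\<Lambda> (act ?s \<beta>) < 0" by (auto simp: \<Lambda>'_def)
      have "\<beta> \<noteq> \<delta>" using \<beta> \<delta> r by (auto simp: root_reflection_self linear_neg[OF lin])
      then have "act ?s \<beta> \<in> sub_pos U" using canonical_permutes[OF U \<delta>(1) \<beta>(1)] by blast
      moreover have "act ?s \<beta> \<noteq> \<delta>"
      proof
        assume "act ?s \<beta> = \<delta>"
        then have "\<beta> = - \<delta>" using ss[of \<beta>] r by (simp add: root_reflection_self)
        then show False using \<beta> r by (simp add: sub_pos_def lam_simps)
      qed
      ultimately have "act ?s \<beta> \<in> {\<beta> \<in> sub_pos U. \<Lambda> \<beta> < 0} - {\<delta>}" using \<beta> by blast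
      then show "\<beta> \<in> act ?s ` ({\<beta> \<in> sub_pos U. \<Lambda> \<beta> < 0} - {\<delta>})" 
        by (intro image_eqI[of \<beta> "act ?s" "act ?s \<beta>"]) (simp_all only: ss)
    qed
    have fin: "finite {\<beta> \<in> sub_pos U. \<Lambda> \<beta> < 0}" by fact
    have fin': "finite {\<beta> \<in> sub_pos U. \<Lambda>' \<beta> < 0}" using finite_subset[OF sub] fin by blast
    have "card {\<beta> \<in> sub_pos U. \<Lambda>' \<beta> < 0} \<le> card ({\<beta> \<in> sub_pos U. \<Lambda> \<beta> < 0} - {\<delta>})"
      using surj_card_le[OF _ sub] fin by blast
    also have "\<dots> < card {\<beta> \<in> sub_pos U. \<Lambda> \<beta> < 0}"
      using fin \<delta> canonical_sub_pos by (intro psubset_card_mono) auto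
    finally obtain z where z: "z \<in> carrier W" "\<forall>x. act z x \<in> U \<longleftrightarrow> x \<in> U"
      "\<forall>\<beta>\<in>sub_pos U. 0 \<le> \<Lambda>' (act z \<beta>)" "\<forall>\<beta>\<in>sub_pos U. \<Lambda>' \<beta> = 0 \<longrightarrow> 0 < lam (act (inv z) \<beta>)"
      using less.hyps[OF _ lin' fin'] by blast
    show ?thesis
    proof (intro bexI[of _ "?s \<otimes> z"] conjI allI ballI impI)
      show "?s \<otimes> z \<in> carrier W" using r z by simp
      show "act (?s \<otimes> z) x \<in> U \<longleftrightarrow> x \<in> U" for x
        using r z by (simp add: act_mult reflection_in_subspace[OF U])
      show "0 \<le> \<Lambda> (act (?s \<otimes> z) \<beta>)" if "\<beta> \<in> sub_pos U" for \<beta>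
        using z(3) that r z(1) by (simp add: act_mult \<Lambda>'_def)
      show "0 < lam (act (inv (?s \<otimes> z)) \<beta>)" if "\<beta> \<in> sub_pos U" "\<Lambda> \<beta> = 0" for \<beta>
      proof -
        have "\<beta> \<noteq> \<delta>" using that \<delta> by auto
        then have "act ?s \<beta> \<in> sub_pos U" using canonical_permutes[OF U \<delta>(1)] that by blast
        then have "0 < lam (act (inv z) (act ?s \<beta>))" using z(4) that ss by (auto simp: \<Lambda>'_def)
        then show ?thesis using r z by (simp add: act_inv_reflection_mult)
      qed
    qed
  qed
qed

text \<open>After conjugation the functional is nonnegative on simple roots, so its zero set among
  the positive roots consists of those supported on the simple roots \<open>J\<close> where it
  vanishes. There are finitely many \<open>J\<close>, and for the relevant ones finitely many such
  roots.\<close>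

theorem finite_B_values: "finite {B \<beta> \<gamma> | \<beta> \<gamma>. \<beta> \<in> roots \<and> \<gamma> \<in> roots \<and> \<bar>B \<beta> \<gamma>\<bar> < 1}"
proof -
  \<comment> \<open>Positive roots with some expression supported on \<open>J\<close>; expressions
    need not be unique.\<close>
  define Z where "Z J = {\<delta> \<in> roots. 0 < lam \<delta> \<and> (\<exists>c. (\<forall>s\<in>S. 0 \<le> c s) \<and> (\<forall>s\<in>S - J. c s = 0) \<and> \<delta> = (\<Sum>s\<in>S. c s *\<^sub>R \<alpha> s))}" for J
  define V where "V = (\<Union>J\<in>{J. J \<subseteq> S \<and> finite (Z J)}. (\<lambda>(a, b). B a b) ` ((Z J \<union> uminus ` Z J) \<times> (Z J \<union> uminus ` Z J)))"
  have "finite V" unfolding V_def using finite_S by (intro finite_UN_I) auto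
  moreover have "{B \<beta> \<gamma> | \<beta> \<gamma>. \<beta> \<in> roots \<and> \<gamma> \<in> roots \<and> \<bar>B \<beta> \<gamma>\<bar> < 1} \<subseteq> V"
  proof
    fix b assume "b \<in> {B \<beta> \<gamma> | \<beta> \<gamma>. \<beta> \<in> roots \<and> \<gamma> \<in> roots \<and> \<bar>B \<beta> \<gamma>\<bar> < 1}"
    then obtain \<beta> \<gamma> where \<beta>\<gamma>: "\<beta> \<in> roots" "\<gamma> \<in> roots" "\<bar>B \<beta> \<gamma>\<bar> < 1" "b = B \<beta> \<gamma>" by blast
    obtain \<Lambda> :: "'v \<Rightarrow> real" where \<Lambda>: "linear \<Lambda>" "\<Lambda> \<beta> = 0" "\<Lambda> \<gamma> = 0"
      and fin: "finite {\<delta> \<in> roots. 0 < lam \<delta> \<and> \<Lambda> \<delta> \<le> 0}" using posdef_functional[OF \<beta>\<gamma>(1-3)] .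
    have "finite {\<beta> \<in> sub_pos UNIV. \<Lambda> \<beta> < 0}" by (rule finite_subset[OF _ fin]) (auto simp: sub_pos_def)
    from chamber_conjugate[OF subspace_UNIV \<Lambda>(1) this] obtain z where z: "z \<in> carrier W"
      "\<forall>\<beta>\<in>sub_pos UNIV. 0 \<le> \<Lambda> (act z \<beta>)" by blast
    define J where "J = {s \<in> S. \<Lambda> (act z (\<alpha> s)) = 0}"
    have lz: "linear (\<lambda>x. \<Lambda> (act z x))" using linear_compose[OF linear_act[OF z(1)] \<Lambda>(1)] by (simp add: o_def)
    have nonneg: "0 \<le> \<Lambda> (act z (\<alpha> s))" if "s \<in> S" for s
      using z(2) that by (simp add: sub_pos_def simple_root lam_simple)
    have Z_iff: "\<delta> \<in> Z J \<longleftrightarrow> \<delta> \<in> roots \<and> 0 < lam \<delta> \<and> \<Lambda> (act z \<delta>) = 0" for \<delta>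
    proof
      assume "\<delta> \<in> Z J"
      then obtain c where c: "\<delta> \<in> roots" "0 < lam \<delta>" "\<forall>s\<in>S - J. c s = 0" "\<delta> = (\<Sum>s\<in>S. c s *\<^sub>R \<alpha> s)"
        unfolding Z_def by blast
      have "\<Lambda> (act z \<delta>) = (\<Sum>s\<in>S. c s * \<Lambda> (act z (\<alpha> s)))"
        by (simp add: c(4) linear_sum[OF lz] linear_cmul[OF lz])
      also have "\<dots> = 0" using c(3) by (intro sum.neutral) (auto simp: J_def)
      finally show "\<delta> \<in> roots \<and> 0 < lam \<delta> \<and> \<Lambda> (act z \<delta>) = 0" using c by blast
    next
      assume \<delta>: "\<delta> \<in> roots \<and> 0 < lam \<delta> \<and> \<Lambda> (act z \<delta>) = 0"
      then have "\<delta> \<in> simple_cone" using root_pos_cone by blast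
      then obtain c where c: "\<forall>s\<in>S. 0 \<le> c s" "\<delta> = (\<Sum>s\<in>S. c s *\<^sub>R \<alpha> s)" unfolding simple_cone_def by blast
      have "0 = \<Lambda> (act z \<delta>)" using \<delta> by simp
      also have "\<dots> = (\<Sum>s\<in>S. c s * \<Lambda> (act z (\<alpha> s)))"
        by (simp add: c(2) linear_sum[OF lz] linear_cmul[OF lz])
      finally have "(\<Sum>s\<in>S. c s * \<Lambda> (act z (\<alpha> s))) = 0" by simp
      moreover have "\<forall>s\<in>S. 0 \<le> c s * \<Lambda> (act z (\<alpha> s))" using c nonneg by simp
      ultimately have "\<forall>s\<in>S. c s * \<Lambda> (act z (\<alpha> s)) = 0"
        using sum_nonneg_eq_0_iff[OF finite_S, of "\<lambda>s. c s * \<Lambda> (act z (\<alpha> s))"] by blast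
      then have "\<forall>s\<in>S - J. c s = 0" by (auto simp: J_def)
      then show "\<delta> \<in> Z J" using \<delta> c unfolding Z_def by blast
    qed
    \<comment> \<open>The functional is 0 on these images, so up to sign they belong to its finite
      exceptional set.\<close>
    have "act z ` Z J \<subseteq> {\<delta> \<in> roots. 0 < lam \<delta> \<and> \<Lambda> \<delta> \<le> 0} \<union> uminus ` {\<delta> \<in> roots. 0 < lam \<delta> \<and> \<Lambda> \<delta> \<le> 0}"
    proof (rule image_subsetI)
      fix \<delta> assume "\<delta> \<in> Z J"
      then have d: "act z \<delta> \<in> roots" "\<Lambda> (act z \<delta>) = 0" using Z_iff root_act z(1) by auto
      show "act z \<delta> \<in> {\<delta> \<in> roots. 0 < lam \<delta> \<and> \<Lambda> \<delta> \<le> 0} \<union> uminus ` {\<delta> \<in> roots. 0 < lam \<delta> \<and> \<Lambda> \<delta> \<le> 0}"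
      proof (cases "0 < lam (act z \<delta>)")
        case False
        then have "- act z \<delta> \<in> {\<delta> \<in> roots. 0 < lam \<delta> \<and> \<Lambda> \<delta> \<le> 0}"
          using d root_lam_nz[OF d(1)] by (simp add: lam_simps linear_neg[OF \<Lambda>(1)])
        then show ?thesis by (intro UnI2 image_eqI[of _ uminus "- act z \<delta>"]) simp_all
      qed (use d in simp)
    qed
    then have "finite (act z ` Z J)" using fin finite_subset by blast
    then have finZ: "finite (Z J)" using z(1) by (rule_tac finite_imageD) (auto simp: inj_on_def act_eq_iff)
    have mem: "act (inv z) \<delta> \<in> Z J \<union> uminus ` Z J" if "\<delta> \<in> roots" "\<Lambda> \<delta> = 0" for \<delta>
    proof (cases "0 < lam (act (inv z) \<delta>)")
      case True
      then show ?thesis using that z(1) root_act by (simp add: Z_iff)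
    next
      case False
      then have "- act (inv z) \<delta> \<in> Z J"
        using that z(1) root_act[of \<delta> "inv z"] root_lam_nz[of "act (inv z) \<delta>"]
        by (simp add: Z_iff lam_simps act_minus linear_neg[OF \<Lambda>(1)])
      then show ?thesis by (intro UnI2 image_eqI[of _ uminus "- act (inv z) \<delta>"]) simp_all
    qed
    have "b = B (act (inv z) \<beta>) (act (inv z) \<gamma>)" using \<beta>\<gamma> z(1) by (simp add: B_act)
    moreover have "act (inv z) \<beta> \<in> Z J \<union> uminus ` Z J" "act (inv z) \<gamma> \<in> Z J \<union> uminus ` Z J"
      using mem \<beta>\<gamma> \<Lambda> by auto
    moreover have "J \<subseteq> S" by (auto simp: J_def)
    ultimately have "b \<in> (\<lambda>(a, b). B a b) ` ((Z J \<union> uminus ` Z J) \<times> (Z J \<union> uminus ` Z J))" "J \<subseteq> S"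
      by (auto intro!: image_eqI[of _ _ "(act (inv z) \<beta>, act (inv z) \<gamma>)"] simp del: Un_iff)
    then show "b \<in> V" unfolding V_def using finZ by blast
  qed
  ultimately show ?thesis by (rule finite_subset[rotated])
qed

section \<open>Dominance and small roots\<close>

lemma dominated_iff:
  assumes "\<beta> \<in> roots" "\<gamma> \<in> roots"
  shows "dominated_by \<beta> \<gamma> \<longleftrightarrow> (\<forall>w\<in>carrier W. lam (act w \<gamma>) < 0 \<longrightarrow> lam (act w \<beta>) < 0)"
  using assms root_act unfolding dominated_by_def neg_roots_iff by blast

lemma dominated_act:
  assumes "\<beta> \<in> roots" "\<gamma> \<in> roots" "g \<in> carrier W" "dominated_by \<beta> \<gamma>"
  shows "dominated_by (act g \<beta>) (act g \<gamma>)"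
proof -
  have "lam (act w (act g \<beta>)) < 0" if "w \<in> carrier W" "lam (act w (act g \<gamma>)) < 0" for w
    using assms that by (simp add: act_mult[symmetric] dominated_iff)
  then show ?thesis using assms root_act by (simp add: dominated_iff)
qed

lemma small_iff:
  "\<beta> \<in> small_roots \<longleftrightarrow> \<beta> \<in> roots \<and> 0 < lam \<beta> \<and>
    (\<forall>\<gamma>\<in>roots. 0 < lam \<gamma> \<longrightarrow> dominated_by \<gamma> \<beta> \<longrightarrow> \<gamma> = \<beta>)"
  by (auto simp: small_roots_def pos_roots_iff)

text \<open>The reflection in \<gamma> makes \<gamma> negative, hence also \<beta>, which takes a
  positive multiple of \<gamma> to subtract.\<close>

lemma dominated_B_pos:
  assumes "\<beta> \<in> roots" "\<gamma> \<in> roots" "0 < lam \<beta>" "0 < lam \<gamma>" "dominated_by \<beta> \<gamma>"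
  shows "0 < B \<beta> \<gamma>"
proof -
  have "lam (act (root_reflection \<gamma>) \<beta>) < 0"
    using assms root_reflection_self[of \<gamma>] by (simp add: dominated_iff lam_simps)
  then have "lam \<beta> < 2 * B \<gamma> \<beta> * lam \<gamma>" using assms by (simp add: act_root_reflection_apply lam_simps)
  then have "0 < 2 * B \<gamma> \<beta> * lam \<gamma>" using assms by linarith
  then show ?thesis using assms B_sym[of \<beta> \<gamma>] by (simp add: zero_less_mult_iff)
qed

text \<open>If \<open>\<beta>\<close> is dominated by \<open>\<gamma>\<close>, then reflecting produces an infinite chain of positive roots with
  \<open>x\<^sub>k\<^sub>+\<^sub>2 = 2 B(\<beta>, \<gamma>) x\<^sub>k\<^sub>+\<^sub>1 - x\<^sub>k\<close>, which cannot exist when \<open>B(\<beta>, \<gamma>) < 1\<close>.\<close>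

lemma dominated_B_ge_1:
  assumes "\<beta> \<in> roots" "\<gamma> \<in> roots" "0 < lam \<beta>" "dominated_by \<beta> \<gamma>"
  shows "1 \<le> B \<beta> \<gamma>"
proof (rule ccontr)
  assume "\<not> 1 \<le> B \<beta> \<gamma>"
  then have b: "B \<beta> \<gamma> < 1" by simp
  \<comment> \<open>The second-order recursion is run as an iteration on consecutive pairs.\<close>
  define x where "x k = fst (((\<lambda>(u, v). (v, (2 * B \<beta> \<gamma>) *\<^sub>R v - u)) ^^ k) (\<beta>, \<gamma>))" for k
  have snd: "snd (((\<lambda>(u, v). (v, (2 * B \<beta> \<gamma>) *\<^sub>R v - u)) ^^ k) (\<beta>, \<gamma>)) = x (Suc k)" for k
    by (simp add: x_def split: prod.split)
  have x0: "x 0 = \<beta>" "x 1 = \<gamma>" by (simp_all add: x_def)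
  have rec: "x (Suc (Suc k)) = (2 * B \<beta> \<gamma>) *\<^sub>R x (Suc k) - x k" for k
    unfolding snd[of "Suc k", symmetric] by (simp add: snd split_beta) (simp add: x_def)
  have inv: "x k \<in> roots \<and> x (Suc k) \<in> roots \<and> B (x k) (x (Suc k)) = B \<beta> \<gamma> \<and>
      dominated_by (x k) (x (Suc k)) \<and> 0 < lam (x k)" for k
  proof (induction k)
    case 0
    then show ?case using assms x0 by simp
  next
    case (Suc k)
    let ?a = "x k" and ?b = "x (Suc k)"
    have r: "?a \<in> roots" "?b \<in> roots" and Bab: "B ?a ?b = B \<beta> \<gamma>" and dom: "dominated_by ?a ?b" using Suc by auto
    have Bba: "B ?b ?a = B \<beta> \<gamma>" using Bab B_sym by metis
    have c: "x (Suc (Suc k)) = - act (root_reflection ?b) ?a"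
      using r Bba by (simp add: rec act_root_reflection_apply)
    have cr: "x (Suc (Suc k)) \<in> roots" unfolding c using r root_act by simp
    have "B ?b (x (Suc (Suc k))) = B \<beta> \<gamma>" using r Bba by (simp add: rec B_simps)
    \<comment> \<open>The dominance of the previous pair is applied to \<open>w\<close> times the
      reflection in \<open>?b\<close>, which exchanges the roles of the two signs.\<close>
    moreover have "dominated_by ?b (x (Suc (Suc k)))"
    proof -
      have "lam (act w ?b) < 0" if w: "w \<in> carrier W" and neg: "lam (act w (x (Suc (Suc k)))) < 0" for w
      proof (rule ccontr)
        assume "\<not> lam (act w ?b) < 0"
        then have "lam (act (w \<otimes> root_reflection ?b) ?b) < 0"
          using w r root_lam_nz[of "act w ?b"] root_act[of ?b w]
          by (simp add: act_mult root_reflection_self act_minus lam_simps)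
        then have "lam (act (w \<otimes> root_reflection ?b) ?a) < 0"
          using dom w r by (simp add: dominated_iff)
        then show False using neg w r by (simp add: act_mult c act_minus lam_simps)
      qed
      then show ?thesis using r cr by (simp add: dominated_iff)
    qed
    moreover have "0 < lam ?b"
    proof (rule ccontr)
      assume "\<not> 0 < lam ?b"
      then have "lam (act \<one> ?b) < 0" using root_lam_nz[OF r(2)] by simp
      then have "lam (act \<one> ?a) < 0" using dom dominated_iff[OF r] one_closed by blast
      then show False using Suc by simp
    qed
    ultimately show ?case using cr r by blast
  qed
  have "\<exists>k. lam (x k) \<le> 0"
    by (rule chebyshev_not_always_pos[OF b]) (simp add: rec lam_simps)
  then show False using inv by (metis not_le)
qed

text \<open>For an argument at least 1 the Chebyshev values increase strictly, and therefore so do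
  the values of \<open>lam\<close>.\<close>

lemma dihedral_inj:
  assumes "\<gamma> \<in> roots" "\<delta> \<in> roots" "1 \<le> - B \<gamma> \<delta>" "0 < lam \<gamma>" "0 < lam \<delta>"
  shows "inj (dihedral \<gamma> \<delta>)"
proof (rule linorder_injI)
  fix i j :: nat assume "i < j"
  have step: "lam (dihedral \<gamma> \<delta> k) < lam (dihedral \<gamma> \<delta> (Suc k))" for k
  proof -
    have "chebyshev_U (- B \<gamma> \<delta>) (Suc k) < chebyshev_U (- B \<gamma> \<delta>) (Suc (Suc k))"
      "chebyshev_U (- B \<gamma> \<delta>) k < chebyshev_U (- B \<gamma> \<delta>) (Suc k)"
      using chebyshev_U_increasing[OF assms(3), of k] chebyshev_U_increasing[OF assms(3), of "Suc k"] by linarith+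
    then show ?thesis unfolding dihedral_def lam_simps real_scaleR_def
      using assms by (intro add_strict_mono mult_strict_right_mono)
  qed
  have "strict_mono (\<lambda>k. lam (dihedral \<gamma> \<delta> k))" using step by (rule strict_monoI_Suc)
  then have "lam (dihedral \<gamma> \<delta> i) < lam (dihedral \<gamma> \<delta> j)" using \<open>i < j\<close> by (rule strict_monoD)
  then show "dihedral \<gamma> \<delta> i \<noteq> dihedral \<gamma> \<delta> j" by auto
qed

text \<open>After applying \<open>g\<close>, the chain starts from two positive roots and stays
  positive throughout. Its members that are negative beforehand thus map injectively to inversions
  of \<open>g\<close>.\<close>

lemma infinite_positive_dihedral:
  assumes \<beta>: "\<beta> \<in> roots" and \<gamma>: "\<gamma> \<in> roots" and b: "1 \<le> B \<beta> \<gamma>" and g: "g \<in> carrier W"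
    and neg: "lam (act g \<beta>) < 0" and pos: "0 < lam (act g \<gamma>)"
  shows "finite {k. lam (dihedral (- \<beta>) \<gamma> k) \<le> 0}"
proof -
  let ?E = "dihedral (- \<beta>) \<gamma>"
  have gE: "act g (?E k) = dihedral (act g (- \<beta>)) (act g \<gamma>) k" for k
    using g by (simp add: dihedral_def act_add act_scale act_diff act_minus B_act B_simps)
  have r: "act g (- \<beta>) \<in> roots" "act g \<gamma> \<in> roots" using \<beta> \<gamma> g root_act root_minus by blast+
  have l: "0 < lam (act g (- \<beta>))" using neg g by (simp add: act_minus lam_simps)
  have b': "1 \<le> - B (act g (- \<beta>)) (act g \<gamma>)" using b g by (simp add: B_act B_simps)
  have inj: "inj (\<lambda>k. act g (?E k))" unfolding gE using dihedral_inj[OF r b' l pos] by simp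
  have "(\<lambda>k. act g (?E k)) ` {k. lam (?E k) \<le> 0} \<subseteq> inv_set g"
  proof (rule image_subsetI)
    fix k assume k: "k \<in> {k. lam (?E k) \<le> 0}"
    have Er: "?E k \<in> roots" using dihedral_root[of "- \<beta>" \<gamma> k] \<beta> \<gamma> by simp
    have "0 < lam (act g (?E k))"
    proof -
      have "0 < chebyshev_U (- B (act g (- \<beta>)) (act g \<gamma>)) (Suc k)" "0 \<le> chebyshev_U (- B (act g (- \<beta>)) (act g \<gamma>)) k"
        using chebyshev_U_increasing[OF b', of k] by (smt (verit) of_nat_0_le_iff)+
      then show ?thesis unfolding gE unfolding dihedral_def lam_simps real_scaleR_def
        using l pos by (intro add_pos_nonneg mult_pos_pos mult_nonneg_nonneg) auto
    qed
    moreover have "lam (?E k) < 0" using k root_lam_nz[OF Er] by (simp add: less_le)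
    ultimately show "act g (?E k) \<in> inv_set g" using Er g root_act by (simp add: inv_set_def)
  qed
  then have "finite ((\<lambda>k. act g (?E k)) ` {k. lam (?E k) \<le> 0})" using inv_set_card(1)[OF g] finite_subset by blast
  then show ?thesis using inj by (meson finite_imageD inj_on_subset subset_UNIV)
qed

text \<open>If each root can be made negative without the other, both chains, from -\<beta> to
  \<gamma> and from -\<gamma> to \<beta>, are eventually positive. Comparing \<open>lam\<close> on
  them contradicts the growth of the Chebyshev values.\<close>

lemma B_ge_1_comparable:
  assumes \<beta>: "\<beta> \<in> roots" and \<gamma>: "\<gamma> \<in> roots" and b: "1 \<le> B \<beta> \<gamma>" and l: "0 < lam \<beta>"
  shows "dominated_by \<beta> \<gamma> \<or> dominated_by \<gamma> \<beta>"
proof (rule ccontr)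
  assume "\<not> ?thesis"
  then obtain g h where g: "g \<in> carrier W" "lam (act g \<gamma>) < 0" "\<not> lam (act g \<beta>) < 0"
    and h: "h \<in> carrier W" "lam (act h \<beta>) < 0" "\<not> lam (act h \<gamma>) < 0"
    using \<beta> \<gamma> by (auto simp: dominated_iff)
  have gp: "0 < lam (act g \<beta>)" using g root_lam_nz[of "act g \<beta>"] root_act \<beta> by force
  have hp: "0 < lam (act h \<gamma>)" using h root_lam_nz[of "act h \<gamma>"] root_act \<gamma> by force
  have f1: "finite {k. lam (dihedral (- \<beta>) \<gamma> k) \<le> 0}"
    by (rule infinite_positive_dihedral[OF \<beta> \<gamma> b h(1,2) hp])
  have f2: "finite {k. lam (dihedral (- \<gamma>) \<beta> k) \<le> 0}"
    by (rule infinite_positive_dihedral[OF \<gamma> \<beta> _ g(1,2) gp]) (use b B_sym[of \<beta> \<gamma>] in simp)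
  \<comment> \<open>The shift makes one \<open>n = Suc k\<close> good for the first chain at index
    \<open>Suc k\<close> and for the second at \<open>k\<close>, where the two inequalities can be
    chained.\<close>
  have "finite (Suc ` {k. lam (dihedral (- \<gamma>) \<beta> k) \<le> 0} \<union> {k. lam (dihedral (- \<beta>) \<gamma> k) \<le> 0} \<union> {0})"
    using f1 f2 by simp
  then obtain n where n: "n \<notin> Suc ` {k. lam (dihedral (- \<gamma>) \<beta> k) \<le> 0} \<union> {k. lam (dihedral (- \<beta>) \<gamma> k) \<le> 0} \<union> {0}"
    by (elim exE[OF ex_new_if_finite[OF infinite_UNIV_nat]])
  then obtain k where k: "n = Suc k" by (cases n) auto
  have "0 < lam (dihedral (- \<beta>) \<gamma> (Suc k))" "0 < lam (dihedral (- \<gamma>) \<beta> k)" using n k by (auto simp: not_le)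
  moreover have "0 < lam (dihedral (- \<beta>) \<gamma> (Suc k)) \<longleftrightarrow>
      chebyshev_U (B \<beta> \<gamma>) (Suc (Suc k)) * lam \<beta> < chebyshev_U (B \<beta> \<gamma>) (Suc k) * lam \<gamma>"
    by (simp add: dihedral_def lam_simps B_simps del: chebyshev_U.simps)
  moreover have "0 < lam (dihedral (- \<gamma>) \<beta> k) \<longleftrightarrow>
      chebyshev_U (B \<beta> \<gamma>) (Suc k) * lam \<gamma> < chebyshev_U (B \<beta> \<gamma>) k * lam \<beta>"
    using B_sym[of \<gamma> \<beta>] by (simp add: dihedral_def lam_simps B_simps del: chebyshev_U.simps)
  ultimately have "chebyshev_U (B \<beta> \<gamma>) (Suc (Suc k)) * lam \<beta> < chebyshev_U (B \<beta> \<gamma>) k * lam \<beta>" by linarith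
  then have "chebyshev_U (B \<beta> \<gamma>) (Suc (Suc k)) < chebyshev_U (B \<beta> \<gamma>) k" using l by simp
  then show False
    using chebyshev_U_increasing[OF b, of k] chebyshev_U_increasing[OF b, of "Suc k"] by linarith
qed

text \<open>The reflection \<open>s\<close> makes \<open>\<alpha> s\<close> negative and no other
  positive root.\<close>

lemma simple_small:
  assumes "s \<in> S"
  shows "\<alpha> s \<in> small_roots"
proof -
  have "\<gamma> = \<alpha> s" if "\<gamma> \<in> roots" "0 < lam \<gamma>" "dominated_by \<gamma> (\<alpha> s)" for \<gamma>
  proof -
    have "lam (act s (\<alpha> s)) < 0"
      using assms lam_simple by (simp add: act_simple B_reflection_def B_diag scaleR_2 lam_simps)
    then have "lam (act s \<gamma>) < 0" using that assms simple_root by (simp add: dominated_iff)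
    then show ?thesis using simple_permutes[OF assms that(1,2)] by force
  qed
  then show ?thesis using assms by (simp add: small_iff simple_root lam_simple)
qed

section \<open>Descending and ascending chains of small roots\<close>

lemma act_simple_apply: "s \<in> S \<Longrightarrow> act s x = x - (2 * B (\<alpha> s) x) *\<^sub>R \<alpha> s"
  by (simp add: act_simple B_reflection_def)

lemma act_simple_act_simple [simp]: "s \<in> S \<Longrightarrow> act s (act s x) = x"
  by (metis S_closed S_inv act_inv_act)

lemma small_B_less_1:
  assumes "\<beta> \<in> small_roots" "s \<in> S" "\<beta> \<noteq> \<alpha> s"
  shows "B (\<alpha> s) \<beta> < 1"
proof (rule ccontr)
  assume "\<not> ?thesis"
  then have "1 \<le> B (\<alpha> s) \<beta>" by simp
  then have "dominated_by (\<alpha> s) \<beta> \<or> dominated_by \<beta> (\<alpha> s)"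
    using assms B_ge_1_comparable[of "\<alpha> s" \<beta>] simple_root lam_simple by (simp add: small_iff)
  then show False
    using assms simple_small[OF assms(2)] by (metis small_iff)
qed

text \<open>Expanding \<open>B \<beta> \<beta> = 1\<close> over the simple roots shows that some
  product is positive. A root \<gamma> dominated by s\<beta> gives s\<gamma> dominated by \<beta>;
  here \<gamma> is not \<open>\<alpha> s\<close>, since dominance would require a positive
  product.\<close>

lemma small_descend:
  assumes \<beta>: "\<beta> \<in> small_roots" "\<beta> \<notin> \<alpha> ` S"
  shows "\<exists>s\<in>S. 0 < B (\<alpha> s) \<beta> \<and> B (\<alpha> s) \<beta> < 1 \<and> act s \<beta> \<in> small_roots"
proof -
  have r: "\<beta> \<in> roots" "0 < lam \<beta>" using \<beta> by (auto simp: small_iff)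
  obtain c where c: "\<beta> = (\<Sum>s\<in>S. c s *\<^sub>R \<alpha> s)" "\<forall>s\<in>S. 0 \<le> c s"
    using root_pos_cone[OF r] unfolding simple_cone_def by blast
  have "1 = B (\<Sum>s\<in>S. c s *\<^sub>R \<alpha> s) \<beta>" using r c by simp
  also have "\<dots> = (\<Sum>s\<in>S. c s * B (\<alpha> s) \<beta>)" by (simp add: B_sum_left B_simps)
  finally have "\<exists>s\<in>S. 0 < B (\<alpha> s) \<beta>"
    using c(2) sum_nonpos[of S "\<lambda>s. c s * B (\<alpha> s) \<beta>"] by (force simp: mult_nonneg_nonpos not_less)
  then obtain s where s: "s \<in> S" "0 < B (\<alpha> s) \<beta>" by blast
  have ne: "\<beta> \<noteq> \<alpha> s" using \<beta> s by blast
  have pos: "0 < lam (act s \<beta>)" "act s \<beta> \<in> roots" using simple_permutes[OF s(1) r ne] root_act r s by auto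
  have "\<gamma> = act s \<beta>" if \<gamma>: "\<gamma> \<in> roots" "0 < lam \<gamma>" "dominated_by \<gamma> (act s \<beta>)" for \<gamma>
  proof -
    have d: "dominated_by (act s \<gamma>) \<beta>" using dominated_act[OF \<gamma>(1) pos(2) _ \<gamma>(3), of s] s by simp
    have "\<gamma> \<noteq> \<alpha> s"
    proof
      assume "\<gamma> = \<alpha> s"
      then have "0 < B (\<alpha> s) (act s \<beta>)" using dominated_B_pos[OF \<gamma>(1) pos(2) \<gamma>(2) pos(1) \<gamma>(3)] by simp
      then show False using s by (simp add: act_simple_apply B_simps B_diag)
    qed
    then have "0 < lam (act s \<gamma>)" "act s \<gamma> \<in> roots" using simple_permutes \<gamma> s root_act by auto
    then have "act s \<gamma> = \<beta>" using \<beta>(1) d by (simp add: small_iff)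
    then show ?thesis using s by (metis act_simple_act_simple)
  qed
  then have "act s \<beta> \<in> small_roots" using pos by (simp add: small_iff)
  then show ?thesis using s small_B_less_1[OF \<beta>(1) s(1) ne] by blast
qed

text \<open>Descents by \<open>small_descend\<close>, read upwards: a product in (0, 1) before the
  descent is one in (-1, 0) for the ascent.\<close>

fun up_path :: "'v \<Rightarrow> 'w list \<Rightarrow> 'v \<Rightarrow> bool" where
  "up_path \<beta> [] \<gamma> \<longleftrightarrow> \<gamma> = \<beta>"
| "up_path \<beta> (s # ss) \<gamma> \<longleftrightarrow> s \<in> S \<and> - 1 < B (\<alpha> s) \<beta> \<and> B (\<alpha> s) \<beta> < 0 \<and> up_path (act s \<beta>) ss \<gamma>"

text \<open>Ascending in another simple root can only lower the product with
  \<open>\<alpha> s\<close>, so a value at most -1 never returns to the admissible interval.\<close>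

lemma up_path_inactive:
  assumes "up_path \<beta> ss \<gamma>" "s \<in> S" "B (\<alpha> s) \<beta> \<le> - 1"
  shows "s \<notin> set ss"
  using assms
proof (induction ss arbitrary: \<beta>)
  case (Cons t ss)
  then have t: "t \<in> S" "- 1 < B (\<alpha> t) \<beta>" "B (\<alpha> t) \<beta> < 0" "s \<noteq> t" by auto
  have "B (\<alpha> s) (act t \<beta>) = B (\<alpha> s) \<beta> - 2 * B (\<alpha> t) \<beta> * B (\<alpha> s) (\<alpha> t)"
    using t by (simp add: act_simple_apply B_simps)
  moreover have "0 \<le> B (\<alpha> t) \<beta> * B (\<alpha> s) (\<alpha> t)"
    using t B_simple_le_0[of s t] Cons.prems(2) by (simp add: mult_nonpos_nonpos)
  ultimately have "B (\<alpha> s) (act t \<beta>) \<le> - 1" using Cons.prems(3) by linarith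
  then show ?case using Cons.IH[of "act t \<beta>"] Cons.prems t by auto
qed simp

lemma up_path_sum:
  assumes "up_path \<beta> ss \<gamma>"
  shows "\<exists>c. (\<forall>s. 0 \<le> c s) \<and> (\<forall>s. s \<notin> set ss \<longrightarrow> c s = 0) \<and> \<gamma> = \<beta> + (\<Sum>s\<in>S. c s *\<^sub>R \<alpha> s)"
  using assms
proof (induction ss arbitrary: \<beta>)
  case Nil
  then show ?case by (intro exI[of _ "\<lambda>_. 0"]) simp
next
  case (Cons t ss)
  then have t: "t \<in> S" "B (\<alpha> t) \<beta> < 0" by auto
  obtain c where c: "\<forall>s. 0 \<le> c s" "\<forall>s. s \<notin> set ss \<longrightarrow> c s = 0" "\<gamma> = act t \<beta> + (\<Sum>s\<in>S. c s *\<^sub>R \<alpha> s)"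
    using Cons.IH[of "act t \<beta>"] Cons.prems by auto
  define k where "k = - 2 * B (\<alpha> t) \<beta>"
  have "(\<Sum>s\<in>S. (c s + (if s = t then k else 0)) *\<^sub>R \<alpha> s) = (\<Sum>s\<in>S. c s *\<^sub>R \<alpha> s) + (\<Sum>s\<in>S. if s = t then k *\<^sub>R \<alpha> t else 0)"
    unfolding sum.distrib[symmetric] by (intro sum.cong) (auto simp: algebra_simps)
  also have "(\<Sum>s\<in>S. if s = t then k *\<^sub>R \<alpha> t else 0) = k *\<^sub>R \<alpha> t" using t finite_S by simp
  finally have "\<gamma> = \<beta> + (\<Sum>s\<in>S. (c s + (if s = t then k else 0)) *\<^sub>R \<alpha> s)"
    using c(3) t by (simp add: act_simple_apply k_def)
  then show ?case using c t by (intro exI[of _ "\<lambda>s. c s + (if s = t then k else 0)"]) (auto simp: k_def)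
qed

lemma up_path_lam: "up_path \<beta> ss \<gamma> \<Longrightarrow> ss \<noteq> [] \<Longrightarrow> lam \<beta> < lam \<gamma>"
proof (induction ss arbitrary: \<beta>)
  case (Cons t ss)
  then have "B (\<alpha> t) \<beta> * lam (\<alpha> t) < 0" using lam_simple by (auto simp: mult_neg_pos)
  then have "lam \<beta> < lam (act t \<beta>)" using Cons.prems by (simp add: act_simple_apply lam_simps)
  then show ?case using Cons by (cases ss) force+
qed simp

text \<open>The function is restricted to \<open>S\<close>, so that states lie in a product of
  finite sets; this is why values at most -1 are collapsed.\<close>

definition state :: "'v \<Rightarrow> 'w \<Rightarrow> real" where
  "state \<beta> = (\<lambda>s\<in>S. if B (\<alpha> s) \<beta> \<le> - 1 then - 1 else B (\<alpha> s) \<beta>)"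

text \<open>This bounds the length of paths of small roots: two roots on a path with the same state have inner
  product 1, so one dominates the other.\<close>

lemma up_path_state:
  assumes \<beta>: "\<beta> \<in> small_roots" and \<gamma>: "\<gamma> \<in> small_roots" and path: "up_path \<beta> ss \<gamma>" "ss \<noteq> []"
  shows "state \<beta> \<noteq> state \<gamma>"
proof
  assume eq: "state \<beta> = state \<gamma>"
  obtain c where c: "\<forall>s. 0 \<le> c s" "\<forall>s. s \<notin> set ss \<longrightarrow> c s = 0" "\<gamma> = \<beta> + (\<Sum>s\<in>S. c s *\<^sub>R \<alpha> s)"
    using up_path_sum[OF path(1)] by blast
  define \<nu> where "\<nu> = (\<Sum>s\<in>S. c s *\<^sub>R \<alpha> s)"
  have "c s * B (\<alpha> s) \<nu> = 0" if s: "s \<in> S" for s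
  proof (cases "s \<in> set ss")
    case True
    then have "\<not> B (\<alpha> s) \<beta> \<le> - 1" using up_path_inactive[OF path(1) s] by blast
    then have "B (\<alpha> s) \<gamma> = B (\<alpha> s) \<beta>" using fun_cong[OF eq, of s] s by (auto simp: state_def split: if_splits)
    then show ?thesis using c(3) by (simp add: \<nu>_def B_simps)
  qed (use c in simp)
  \<comment> \<open>Every simple root occurring in \<nu> is orthogonal to \<nu>, so \<nu> is
    isotropic; equality of the norms of \<beta> and \<gamma> then makes it orthogonal to
    \<beta>.\<close>
  then have "B \<nu> \<nu> = 0" by (subst (1) \<nu>_def) (auto simp: B_sum_left B_simps intro!: sum.neutral)
  moreover have r: "\<beta> \<in> roots" "\<gamma> \<in> roots" "0 < lam \<beta>" "0 < lam \<gamma>" using \<beta> \<gamma> by (auto simp: small_iff)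
  moreover have g: "\<gamma> = \<beta> + \<nu>" using c by (simp add: \<nu>_def)
  ultimately have "B \<beta> \<nu> = 0" using root_B[of \<gamma>] root_B[of \<beta>] B_sym[of \<nu> \<beta>] by (simp add: B_simps)
  then have "B \<beta> \<gamma> = 1" using g r by (simp add: B_simps)
  then have "dominated_by \<beta> \<gamma> \<or> dominated_by \<gamma> \<beta>" using B_ge_1_comparable r by simp
  then have "\<beta> = \<gamma>" using \<beta> \<gamma> r by (metis small_iff)
  then show False using up_path_lam[OF path] by simp
qed

lemma finite_states: "finite (state ` small_roots)"
proof -
  let ?K = "{B \<beta> \<gamma> | \<beta> \<gamma>. \<beta> \<in> roots \<and> \<gamma> \<in> roots \<and> \<bar>B \<beta> \<gamma>\<bar> < 1} \<union> {- 1, 1}"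
  have "state ` small_roots \<subseteq> S \<rightarrow>\<^sub>E ?K"
  proof (rule image_subsetI)
    fix \<beta> assume \<beta>: "\<beta> \<in> small_roots"
    have "state \<beta> s \<in> ?K" if s: "s \<in> S" for s
    proof (cases "B (\<alpha> s) \<beta> \<le> - 1 \<or> \<beta> = \<alpha> s")
      case True
      then show ?thesis using s by (auto simp: state_def B_diag)
    next
      case False
      then have "\<bar>B (\<alpha> s) \<beta>\<bar> < 1" using small_B_less_1[OF \<beta> s] by auto
      moreover have "\<alpha> s \<in> roots" "\<beta> \<in> roots" using s \<beta> simple_root by (auto simp: small_iff)
      ultimately show ?thesis using False s by (auto simp: state_def)
    qed
    then show "state \<beta> \<in> S \<rightarrow>\<^sub>E ?K" by (auto simp: state_def)
  qed
  then show ?thesis using finite_B_values finite_S by (meson finite.intros finite_PiE finite_UnI finite_subset)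
qed

fun level :: "nat \<Rightarrow> 'v set" where
  "level 0 = \<alpha> ` S"
| "level (Suc n) = (\<Union>s\<in>S. act s ` level n)"

lemma finite_level: "finite (level n)"
  by (induction n) (auto simp: finite_S)

theorem finite_small_roots: "finite small_roots"
proof -
  define R where "R \<beta> \<gamma> \<longleftrightarrow> \<gamma> \<in> small_roots \<and> (\<exists>s\<in>S. 0 < B (\<alpha> s) \<beta> \<and> B (\<alpha> s) \<beta> < 1 \<and> \<gamma> = act s \<beta>)" for \<beta> \<gamma>
  have Rpath: "\<exists>ss. ss \<noteq> [] \<and> up_path \<gamma> ss \<beta>" if "R\<^sup>+\<^sup>+ \<beta> \<gamma>" for \<beta> \<gamma>
    using that
  proof (induction rule: tranclp_induct)
    case (base \<gamma>)
    then obtain s where s: "s \<in> S" "0 < B (\<alpha> s) \<beta>" "B (\<alpha> s) \<beta> < 1" "\<gamma> = act s \<beta>" by (auto simp: R_def)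
    then show ?case by (intro exI[of _ "[s]"]) (auto simp: act_simple_apply B_simps B_diag)
  next
    case (step \<gamma> \<delta>)
    then obtain ss s where "up_path \<gamma> ss \<beta>" and s: "s \<in> S" "0 < B (\<alpha> s) \<gamma>" "B (\<alpha> s) \<gamma> < 1" "\<delta> = act s \<gamma>"
      by (auto simp: R_def)
    moreover have "B (\<alpha> s) \<delta> = - B (\<alpha> s) \<gamma>" using s by (simp add: act_simple_apply B_simps B_diag)
    ultimately show ?case by (intro exI[of _ "s # ss"]) auto
  qed
  define n where "n = card (state ` small_roots)"
  have "small_roots \<subseteq> (\<Union>i\<le>n. level i)"
  proof
    fix \<gamma> assume \<gamma>: "\<gamma> \<in> small_roots"
    define nxt where "nxt \<beta> = (SOME \<beta>'. R \<beta> \<beta>')" for \<beta>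
    define f where "f i = (nxt ^^ i) \<gamma>" for i
    have nxt: "R \<beta> (nxt \<beta>)" if "\<beta> \<in> small_roots" "\<beta> \<notin> \<alpha> ` S" for \<beta>
      unfolding nxt_def by (rule someI_ex) (use small_descend[OF that] in \<open>auto simp: R_def\<close>)
    \<comment> \<open>Otherwise \<open>f 0\<close> to \<open>f (Suc n)\<close> would be small roots
      with distinct states, two more than there are states.\<close>
    have "\<exists>i\<le>n. f i \<in> \<alpha> ` S"
    proof (rule ccontr)
      assume no: "\<not> ?thesis"
      have sm: "i \<le> Suc n \<Longrightarrow> f i \<in> small_roots" for i
      proof (induction i)
        case (Suc i)
        then show ?case using nxt[of "f i"] no by (auto simp: f_def R_def)
      qed (simp add: f_def \<gamma>)
      have step: "R (f i) (f (Suc i))" if "i \<le> n" for i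
        using nxt[of "f i"] no sm[of i] that by (auto simp: f_def)
      have trans: "R\<^sup>+\<^sup>+ (f i) (f (i + Suc k))" if "i + k \<le> n" for i k
        using that
      proof (induction k)
        case 0
        then show ?case using step by auto
      next
        case (Suc k)
        then show ?case using step[of "i + Suc k"] by (auto intro: tranclp.trancl_into_trancl)
      qed
      have "inj_on (\<lambda>i. state (f i)) {..Suc n}"
      proof (rule linorder_inj_onI)
        fix i j assume ij: "i < j" "i \<in> {..Suc n}" "j \<in> {..Suc n}"
        then obtain k where k: "j = i + Suc k" using less_iff_Suc_add[of i j] by auto
        then have "R\<^sup>+\<^sup>+ (f i) (f j)" using trans[of i k] ij by simp
        then show "state (f i) \<noteq> state (f j)"
          using Rpath up_path_state[of "f j" "f i"] sm ij by fastforce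
      qed auto
      then have "card {..Suc n} \<le> card (state ` small_roots)"
        by (rule card_inj_on_le) (use sm finite_states in auto)
      then show False by (simp add: n_def)
    qed
    then obtain i where "i \<le> n" "f i \<in> \<alpha> ` S" by blast
    \<comment> \<open>The first simple root on the chain; the choice \<open>nxt\<close> is
      controlled only at nonsimple small roots.\<close>
    define I where "I = (LEAST i. f i \<in> \<alpha> ` S)"
    have I: "f I \<in> \<alpha> ` S" "\<And>j. j < I \<Longrightarrow> f j \<notin> \<alpha> ` S" "I \<le> n"
      using LeastI[of "\<lambda>i. f i \<in> \<alpha> ` S", OF \<open>f i \<in> \<alpha> ` S\<close>] not_less_Least
        Least_le[of "\<lambda>i. f i \<in> \<alpha> ` S", OF \<open>f i \<in> \<alpha> ` S\<close>] \<open>i \<le> n\<close> unfolding I_def by (auto dest: not_less_Least)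
    have sm: "j \<le> I \<Longrightarrow> f j \<in> small_roots" for j
    proof (induction j)
      case (Suc j)
      then show ?case using nxt[of "f j"] I(2)[of j] by (auto simp: f_def R_def)
    qed (simp add: f_def \<gamma>)
    have "k \<le> I \<Longrightarrow> f (I - k) \<in> level k" for k
    proof (induction k)
      case (Suc k)
      then have "Suc (I - Suc k) = I - k" by simp
      then have "f (I - k) = nxt (f (I - Suc k))" unfolding f_def by (metis funpow.simps(2) comp_apply)
      then have "R (f (I - Suc k)) (f (I - k))"
        using nxt[of "f (I - Suc k)"] sm I(2)[of "I - Suc k"] Suc.prems by simp
      then obtain s where "s \<in> S" "f (I - k) = act s (f (I - Suc k))" by (auto simp: R_def)
      then have "s \<in> S" "f (I - Suc k) = act s (f (I - k))" by auto
      then show ?case using Suc by auto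
    qed (simp add: I)
    from this[of I] have "\<gamma> \<in> level I" by (simp add: f_def)
    then show "\<gamma> \<in> (\<Union>i\<le>n. level i)" using I by auto
  qed
  then show ?thesis using finite_level finite_subset by blast
qed

section \<open>Low elements are determined by their short inversions\<close>

text \<open>The inversions of the product always lie in the disjoint union of N(h) and h N(u), which
  has \<open>len h + len u\<close> elements. Equality of lengths thus means that nothing cancels,
  that is, \<open>h\<close> makes no inversion of \<open>u\<close> negative.\<close>

lemma reduced_product:
  assumes h: "h \<in> carrier W" and u: "u \<in> carrier W"
  shows "len (h \<otimes> u) = len h + len u \<longleftrightarrow> (\<forall>\<xi>\<in>inv_set u. 0 < lam (act h \<xi>))"
    and "len (h \<otimes> u) = len h + len u \<Longrightarrow> inv_set (h \<otimes> u) = inv_set h \<union> act h ` inv_set u"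
proof -
  note i = inv_mult_group[OF h u] act_mult[OF inv_closed[OF u] inv_closed[OF h]]
  have root_sign: "lam (act g \<beta>) < 0 \<longleftrightarrow> \<not> 0 < lam (act g \<beta>)" if "\<beta> \<in> roots" "g \<in> carrier W" for g \<beta>
    using root_lam_nz[of "act g \<beta>"] root_act that by force
  have inj: "inj_on (act h) A" for A using h by (auto simp: inj_on_def act_eq_iff)
  have fin: "finite (inv_set h \<union> act h ` inv_set u)" using inv_set_card(1) h u by blast
  have le: "inv_set (h \<otimes> u) \<subseteq> inv_set h \<union> act h ` inv_set u"
  proof
    fix \<beta> assume \<beta>: "\<beta> \<in> inv_set (h \<otimes> u)"
    show "\<beta> \<in> inv_set h \<union> act h ` inv_set u"
    proof (cases "lam (act (inv h) \<beta>) < 0")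
      case False
      then have "act (inv h) \<beta> \<in> inv_set u"
        using \<beta> h root_sign[of \<beta> "inv h"] root_act[of \<beta> "inv h"] by (auto simp: inv_set_def i)
      then show ?thesis using h by (metis UnI2 act_act_inv imageI)
    qed (use \<beta> in \<open>auto simp: inv_set_def\<close>)
  qed
  have card_un: "card (inv_set h \<union> act h ` inv_set u) = len h + len u"
  proof -
    have "inv_set h \<inter> act h ` inv_set u = {}" using h by (auto simp: inv_set_def)
    then show ?thesis using inv_set_card[OF h] inv_set_card[OF u] by (simp add: card_Un_disjoint card_image inj)
  qed
  have ge: "inv_set h \<union> act h ` inv_set u \<subseteq> inv_set (h \<otimes> u)" if pos: "\<forall>\<xi>\<in>inv_set u. 0 < lam (act h \<xi>)"
  proof (rule Un_least)
    show "act h ` inv_set u \<subseteq> inv_set (h \<otimes> u)"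
      using pos h u root_act by (auto simp: inv_set_def i)
    show "inv_set h \<subseteq> inv_set (h \<otimes> u)"
    proof
      fix \<beta> assume \<beta>: "\<beta> \<in> inv_set h"
      have "- act (inv h) \<beta> \<notin> inv_set u"
      proof
        assume "- act (inv h) \<beta> \<in> inv_set u"
        then have "0 < lam (act h (- act (inv h) \<beta>))" using pos by blast
        then show False using \<beta> h by (simp add: inv_set_def act_minus lam_simps)
      qed
      then show "\<beta> \<in> inv_set (h \<otimes> u)"
        using \<beta> h u root_act[of \<beta> "inv h"] root_sign[of "act (inv h) \<beta>" "inv u"]
        by (auto simp: inv_set_def i act_minus lam_simps)
    qed
  qed
  have eq: "inv_set (h \<otimes> u) = inv_set h \<union> act h ` inv_set u" if "len (h \<otimes> u) = len h + len u"
    using card_subset_eq[OF fin le] card_un inv_set_card(2)[of "h \<otimes> u"] h u that by simp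
  then show "len (h \<otimes> u) = len h + len u \<Longrightarrow> inv_set (h \<otimes> u) = inv_set h \<union> act h ` inv_set u" .
  show "len (h \<otimes> u) = len h + len u \<longleftrightarrow> (\<forall>\<xi>\<in>inv_set u. 0 < lam (act h \<xi>))"
  proof
    assume "len (h \<otimes> u) = len h + len u"
    from eq[OF this] show "\<forall>\<xi>\<in>inv_set u. 0 < lam (act h \<xi>)" by (auto simp: inv_set_def)
  next
    assume "\<forall>\<xi>\<in>inv_set u. 0 < lam (act h \<xi>)"
    then have "inv_set (h \<otimes> u) = inv_set h \<union> act h ` inv_set u" using le ge by blast
    then show "len (h \<otimes> u) = len h + len u" using card_un inv_set_card(2)[of "h \<otimes> u"] h u by simp
  qed
qed

text \<open>Deleting \<open>t\<close> from the factorization leaves a nonreduced product, so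
  \<open>h\<close> makes some inversion \<xi> of \<open>v\<close> negative. Then -h\<xi> and h t
  \<xi> are inversions of \<open>w\<close>, and their sum is a multiple of \<gamma>.\<close>

lemma not_short_inversion:
  assumes w: "w \<in> carrier W" and \<gamma>: "\<gamma> \<in> inv_set w" "\<gamma> \<notin> N1 w"
  obtains x y p where "x \<in> inv_set w" "y \<in> inv_set w" "x \<noteq> y" "0 < p" "\<gamma> = p *\<^sub>R (x + y)"
proof -
  obtain h t v where h: "h \<in> carrier W" "t \<in> S" "v \<in> carrier W" "w = h \<otimes> t \<otimes> v"
    "len w = len h + 1 + len v" "\<gamma> = act h (\<alpha> t)" using inversion_split[OF w \<gamma>(1)] .
  have \<gamma>r: "\<gamma> \<in> roots" "0 < lam \<gamma>" using \<gamma>(1) by (auto simp: inv_set_def)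
  have "root_reflection \<gamma> \<otimes> w = h \<otimes> t \<otimes> inv h \<otimes> (h \<otimes> (t \<otimes> v))"
    using h by (simp add: root_reflection_act_simple m_assoc)
  also have "\<dots> = h \<otimes> t \<otimes> (t \<otimes> v)" using h by (simp add: m_assoc) (simp add: m_assoc[symmetric])
  also have "\<dots> = h \<otimes> v" using h by (simp add: m_assoc S_cancel)
  finally have "len (h \<otimes> v) \<noteq> len h + len v" using \<gamma> h(5) N1_iff[OF w] by auto
  then obtain \<xi> where \<xi>: "\<xi> \<in> inv_set v" "\<not> 0 < lam (act h \<xi>)" using reduced_product(1) h by blast
  have \<xi>r: "\<xi> \<in> roots" using \<xi> by (simp add: inv_set_def)
  then have neg: "lam (act h \<xi>) < 0" using \<xi>(2) root_lam_nz[of "act h \<xi>"] root_act h(1) by force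
  have tv: "len (t \<otimes> v) = len v + 1"
    using len_mult_simple[OF h(2,3)] len_mult_le[of h "t \<otimes> v"] h by (auto simp: m_assoc)
  then have red: "len (h \<otimes> (t \<otimes> v)) = len h + len (t \<otimes> v)" using h by (simp add: m_assoc)
  note N = reduced_product(2)[OF h(1) _ red]
  have w': "w = h \<otimes> (t \<otimes> v)" "t \<otimes> v \<in> carrier W" using h by (auto simp: m_assoc)
  define x where "x = - act h \<xi>"
  define y where "y = act h (act t \<xi>)"
  have x: "x \<in> inv_set h"
    using neg \<xi>(1) h(1) root_act by (auto simp: x_def inv_set_def act_minus lam_simps)
  have "act t \<xi> \<in> inv_set (t \<otimes> v)" using inv_set_simple_mult(1)[OF h(3,2) tv] \<xi>(1) by blast
  then have "y \<in> inv_set w" "x \<in> inv_set w" using N x w' by (auto simp: y_def)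
  moreover have "x \<noteq> y"
  proof
    assume "x = y"
    then have "act h (act t \<xi>) = act h (- \<xi>)" using h(1) by (simp add: x_def y_def act_minus)
    then have "act t \<xi> = - \<xi>" by (simp add: act_eq_iff[OF h(1)])
    moreover have "0 < lam (act t \<xi>)" "0 < lam \<xi>"
      using \<open>act t \<xi> \<in> inv_set (t \<otimes> v)\<close> \<xi>(1) by (auto simp: inv_set_def)
    ultimately show False by (simp add: lam_simps)
  qed
  moreover have sum: "x + y = (- 2 * B (\<alpha> t) \<xi>) *\<^sub>R \<gamma>"
    using h by (simp add: x_def y_def act_simple_apply act_diff act_scale)
  moreover have "0 < - 2 * B (\<alpha> t) \<xi>"
  proof -
    have "0 < lam (x + y)" using \<open>y \<in> inv_set w\<close> \<open>x \<in> inv_set w\<close> by (simp add: inv_set_def lam_simps)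
    then have "0 < (- 2 * B (\<alpha> t) \<xi>) * lam \<gamma>" unfolding sum by (simp add: lam_simps)
    then show ?thesis using \<gamma>r by (simp add: mult_less_0_iff)
  qed
  ultimately show ?thesis
    using that[of x y "1 / (- 2 * B (\<alpha> t) \<xi>)"] by (auto simp del: minus_mult_left)
qed

text \<open>In a generating subset of least cardinality every element is short: a nonshort
  \<open>y0\<close> is a combination of two distinct inversions and hence either redundant or
  contradictory.\<close>

lemma inv_set_generated:
  assumes w: "w \<in> carrier W" and \<gamma>: "\<gamma> \<in> inv_set w"
  shows "\<exists>c. (\<forall>y\<in>N1 w. 0 \<le> c y) \<and> \<gamma> = (\<Sum>y\<in>N1 w. c y *\<^sub>R y)"
proof -
  define gen where "gen Y \<longleftrightarrow> Y \<subseteq> inv_set w \<and>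
    (\<forall>x\<in>inv_set w. \<exists>c. (\<forall>y\<in>Y. 0 \<le> c y) \<and> x = (\<Sum>y\<in>Y. c y *\<^sub>R y))" for Y
  have fin: "finite (inv_set w)" using inv_set_card w by blast
  have delta: "(\<Sum>y\<in>A. (if y = x then 1 else 0) *\<^sub>R y) = x" if "finite A" "x \<in> A" for A and x :: 'v
  proof -
    have "(\<Sum>y\<in>A. (if y = x then 1 else 0) *\<^sub>R y) = (\<Sum>y\<in>A. if y = x then x else 0)"
      by (intro sum.cong) auto
    then show ?thesis using that by simp
  qed
  have "gen (inv_set w)"
    unfolding gen_def
  proof (intro conjI subset_refl ballI)
    fix x assume "x \<in> inv_set w"
    then show "\<exists>c. (\<forall>y\<in>inv_set w. 0 \<le> c y) \<and> x = (\<Sum>y\<in>inv_set w. c y *\<^sub>R y)"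
      using delta[OF fin] by (intro exI[of _ "\<lambda>y. if y = x then 1 else 0"]) simp
  qed
  then obtain Y where Y: "gen Y" "\<And>Z. gen Z \<Longrightarrow> card Y \<le> card Z"
    using ex_has_least_nat[of gen "inv_set w" card] by blast
  have finY: "finite Y" and YN: "Y \<subseteq> inv_set w" using Y(1) fin finite_subset by (auto simp: gen_def)
  have lamY: "0 < lam y" if "y \<in> Y" for y using YN that by (auto simp: inv_set_def)
  have "Y \<subseteq> N1 w"
  proof
    fix y0 assume y0: "y0 \<in> Y"
    show "y0 \<in> N1 w"
    proof (rule ccontr)
      assume "y0 \<notin> N1 w"
      then obtain x1 x2 p where x: "x1 \<in> inv_set w" "x2 \<in> inv_set w" "x1 \<noteq> x2" "0 < p" "y0 = p *\<^sub>R (x1 + x2)"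
        using not_short_inversion[OF w, of y0] y0 YN by blast
      obtain c where c: "\<forall>y\<in>Y. 0 \<le> c y" "x1 = (\<Sum>y\<in>Y. c y *\<^sub>R y)" using x(1) Y(1) unfolding gen_def by blast
      obtain d where d: "\<forall>y\<in>Y. 0 \<le> d y" "x2 = (\<Sum>y\<in>Y. d y *\<^sub>R y)" using x(2) Y(1) unfolding gen_def by blast
      define e where "e y = p * (c y + d y)" for y
      have e0: "\<forall>y\<in>Y. 0 \<le> e y" using c d x(4) by (auto simp: e_def)
      have "y0 = (\<Sum>y\<in>Y. e y *\<^sub>R y)"
        unfolding x(5) c(2) d(2) e_def by (simp add: sum.distrib[symmetric] scaleR_sum_right algebra_simps)
      also have "\<dots> = e y0 *\<^sub>R y0 + (\<Sum>y\<in>Y - {y0}. e y *\<^sub>R y)" using finY y0 by (simp add: sum.remove)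
      finally have rel: "(1 - e y0) *\<^sub>R y0 = (\<Sum>y\<in>Y - {y0}. e y *\<^sub>R y)" by (simp add: algebra_simps)
      show False
      proof (cases "e y0 < 1")
        case True
        define k where "k = 1 - e y0"
        have k: "0 < k" using True by (simp add: k_def)
        have y0eq: "y0 = (\<Sum>y\<in>Y - {y0}. (e y / k) *\<^sub>R y)"
        proof -
          have "y0 = (1 / k) *\<^sub>R (k *\<^sub>R y0)" using k by simp
          also have "\<dots> = (\<Sum>y\<in>Y - {y0}. (e y / k) *\<^sub>R y)"
            unfolding k_def rel by (simp add: scaleR_sum_right)
          finally show ?thesis .
        qed
        have "gen (Y - {y0})"
          unfolding gen_def
        proof (intro conjI ballI)
          fix z assume "z \<in> inv_set w"
          then obtain f where f: "\<forall>y\<in>Y. 0 \<le> f y" "z = (\<Sum>y\<in>Y. f y *\<^sub>R y)" using Y(1) unfolding gen_def by blast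
          have "z = f y0 *\<^sub>R y0 + (\<Sum>y\<in>Y - {y0}. f y *\<^sub>R y)" using f(2) finY y0 by (simp add: sum.remove)
          also have "f y0 *\<^sub>R y0 = (\<Sum>y\<in>Y - {y0}. (f y0 * (e y / k)) *\<^sub>R y)"
            by (subst (2) y0eq) (simp add: scaleR_sum_right)
          finally have "z = (\<Sum>y\<in>Y - {y0}. (f y0 * (e y / k) + f y) *\<^sub>R y)"
            by (simp add: scaleR_add_left sum.distrib)
          then show "\<exists>c. (\<forall>y\<in>Y - {y0}. 0 \<le> c y) \<and> z = (\<Sum>y\<in>Y - {y0}. c y *\<^sub>R y)"
            using f(1) e0 k y0 by (intro exI[of _ "\<lambda>y. f y0 * (e y / k) + f y"]) auto
        qed (use YN in auto)
        from Y(2)[OF this] card_Diff1_less[OF finY y0] show False by linarith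
      next
        \<comment> \<open>With own coefficient at least 1, applying \<open>lam\<close> kills all
          other coefficients, so both summands are multiples of \<open>y0\<close> and coincide with
          it.\<close>
        case False
        have "(1 - e y0) * lam y0 = (\<Sum>y\<in>Y - {y0}. e y * lam y)"
          using arg_cong[OF rel, of lam] by (simp add: lam_simps)
        moreover have "(1 - e y0) * lam y0 \<le> 0" using False lamY[OF y0] by (simp add: mult_nonpos_nonneg)
        moreover have nn: "\<forall>y\<in>Y - {y0}. 0 \<le> e y * lam y" using e0 lamY by (simp add: less_imp_le)
        moreover from nn have "0 \<le> (\<Sum>y\<in>Y - {y0}. e y * lam y)" by (intro sum_nonneg) blast
        ultimately have "(\<Sum>y\<in>Y - {y0}. e y * lam y) = 0" by linarith
        then have "\<forall>y\<in>Y - {y0}. e y * lam y = 0"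
          using nn finY by (subst (asm) sum_nonneg_eq_0_iff) auto
        moreover have "lam y \<noteq> 0" if "y \<in> Y" for y using lamY[OF that] by simp
        ultimately have "\<forall>y\<in>Y - {y0}. e y = 0" by (metis DiffD1 mult_eq_0_iff)
        then have "\<forall>y\<in>Y - {y0}. c y = 0 \<and> d y = 0"
          using c(1) d(1) x(4) by (auto simp: e_def add_nonneg_eq_0_iff)
        then have "x1 = c y0 *\<^sub>R y0" "x2 = d y0 *\<^sub>R y0"
          using c(2) d(2) finY y0 by (auto simp: sum.remove)
        then have "x1 = y0" "x2 = y0"
          using root_multiple[of x1 y0 "c y0"] root_multiple[of x2 y0 "d y0"] x(1,2) YN y0 c(1) d(1)
          by (auto simp: inv_set_def)
        then show False using x(3) by blast
      qed
    qed
  qed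
  obtain c where c: "\<forall>y\<in>Y. 0 \<le> c y" "\<gamma> = (\<Sum>y\<in>Y. c y *\<^sub>R y)" using \<gamma> Y(1) unfolding gen_def by blast
  have "finite (N1 w)" using fin N1_iff[OF w] by (meson finite_subset subsetI)
  then have "\<gamma> = (\<Sum>y\<in>N1 w. (if y \<in> Y then c y else 0) *\<^sub>R y)"
    unfolding c(2) using \<open>Y \<subseteq> N1 w\<close> by (intro sum.mono_neutral_cong_left) auto
  then show ?thesis using c(1) by (intro exI[of _ "\<lambda>y. if y \<in> Y then c y else 0"]) auto
qed

lemma N1_inj:
  assumes u: "u \<in> carrier W" and w: "w \<in> carrier W" and eq: "N1 u = N1 w"
  shows "u = w"
proof -
  have sub: "inv_set a \<subseteq> inv_set b" if a: "a \<in> carrier W" and b: "b \<in> carrier W" and eq: "N1 a = N1 b" for a b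
  proof
    fix \<gamma> assume \<gamma>: "\<gamma> \<in> inv_set a"
    then obtain c where c: "\<forall>y\<in>N1 a. 0 \<le> c y" "\<gamma> = (\<Sum>y\<in>N1 a. c y *\<^sub>R y)" using inv_set_generated[OF a] by blast
    have neg: "lam (act (inv b) y) < 0" if "y \<in> N1 a" for y
      using that eq N1_iff[OF b] by (auto simp: inv_set_def)
    have "lam (act (inv b) \<gamma>) = (\<Sum>y\<in>N1 a. c y * lam (act (inv b) y))"
      using b by (simp add: c(2) linear_sum[OF linear_act] act_scale lam_simps)
    also have "\<dots> \<le> 0" using c(1) neg by (intro sum_nonpos) (auto simp: mult_nonneg_nonpos less_imp_le)
    finally have "lam (act (inv b) \<gamma>) < 0"
      using root_lam_nz[of "act (inv b) \<gamma>"] root_act[of \<gamma> "inv b"] \<gamma> b by (auto simp: inv_set_def less_le)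
    then show "\<gamma> \<in> inv_set b" using \<gamma> by (simp add: inv_set_def)
  qed
  show ?thesis using inv_set_inj[OF u w] sub[OF u w eq] sub[OF w u eq[symmetric]] by blast
qed

theorem finite_low_elements: "finite low_elements"
proof (rule finite_imageD)
  show "finite (N1 ` low_elements)"
    using finite_small_roots by (rule_tac finite_subset[of _ "Pow small_roots"]) (auto simp: low_elements_def)
  show "inj_on N1 low_elements" using N1_inj by (auto simp: inj_on_def low_elements_def)
qed

lemma simple_low:
  assumes s: "s \<in> S"
  shows "s \<in> low_elements"
proof -
  have "inv_set s = {\<alpha> s}" using inv_set_simple_mult(1)[of "\<one>" s] s by simp
  then have "N1 s \<subseteq> {\<alpha> s}" using N1_iff[of s] s by auto
  then show ?thesis using simple_small s by (auto simp: low_elements_def)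
qed

section \<open>Joins in the weak order\<close>

text \<open>An obstruction \<xi> to reducedness of \<open>u\<close> times \<open>v\<close> would
  give the inversion -u\<xi> of \<open>u\<close> that is not an inversion of
  \<open>w\<close>.\<close>

lemma weak_order_iff:
  assumes u: "u \<in> carrier W" and w: "w \<in> carrier W"
  shows "(\<exists>v\<in>carrier W. w = u \<otimes> v \<and> len w = len u + len v) \<longleftrightarrow> inv_set u \<subseteq> inv_set w"
proof
  assume "\<exists>v\<in>carrier W. w = u \<otimes> v \<and> len w = len u + len v"
  then show "inv_set u \<subseteq> inv_set w" using reduced_product(2)[OF u] by blast
next
  assume sub: "inv_set u \<subseteq> inv_set w"
  define v where "v = inv u \<otimes> w"
  have v: "v \<in> carrier W" "w = u \<otimes> v" using u w by (auto simp: v_def m_assoc[symmetric])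
  have "0 < lam (act u \<xi>)" if \<xi>: "\<xi> \<in> inv_set v" for \<xi>
  proof (rule ccontr)
    assume "\<not> 0 < lam (act u \<xi>)"
    moreover have r: "act u \<xi> \<in> roots" using \<xi> u root_act by (simp add: inv_set_def)
    ultimately have "lam (act u \<xi>) < 0" using root_lam_nz[OF r] by linarith
    then have "- act u \<xi> \<in> inv_set u" using \<xi> u r by (simp add: inv_set_def act_minus lam_simps)
    then have "- act u \<xi> \<in> inv_set w" using sub by blast
    then have "lam (act (inv w) (- act u \<xi>)) < 0" by (simp add: inv_set_def)
    moreover have "act (inv v) \<xi> = act (inv w) (act u \<xi>)" using u w by (simp add: v_def inv_mult_group act_mult)
    ultimately show False using \<xi> w by (simp add: inv_set_def act_minus lam_simps)
  qed
  then have "len (u \<otimes> v) = len u + len v" using reduced_product(1)[OF u v(1)] by blast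
  then show "\<exists>v\<in>carrier W. w = u \<otimes> v \<and> len w = len u + len v" using v by auto
qed

lemma is_join_iff:
  assumes u: "u \<in> carrier W" and v: "v \<in> carrier W"
  shows "is_join j u v \<longleftrightarrow> j \<in> carrier W \<and> inv_set u \<subseteq> inv_set j \<and> inv_set v \<subseteq> inv_set j \<and>
    (\<forall>x\<in>carrier W. inv_set u \<subseteq> inv_set x \<longrightarrow> inv_set v \<subseteq> inv_set x \<longrightarrow> inv_set j \<subseteq> inv_set x)"
proof -
  have upper: "x \<in> Upper right_weak_order {u, v} \<longleftrightarrow> x \<in> carrier W \<and> inv_set u \<subseteq> inv_set x \<and> inv_set v \<subseteq> inv_set x" for x
    using weak_order_iff[OF u, of x] weak_order_iff[OF v, of x] u v
    unfolding Upper_def right_weak_order_def by auto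
  have join: "is_join j u v \<longleftrightarrow> j \<in> Upper right_weak_order {u, v} \<and>
      (\<forall>x\<in>Upper right_weak_order {u, v}. \<exists>y\<in>carrier W. x = j \<otimes> y \<and> len x = len j + len y)"
    unfolding is_join_def least_def by (auto simp: right_weak_order_def Upper_def)
  show ?thesis
  proof (cases "j \<in> carrier W")
    case True
    have "(\<exists>y\<in>carrier W. x = j \<otimes> y \<and> len x = len j + len y) \<longleftrightarrow> inv_set j \<subseteq> inv_set x"
      if "x \<in> Upper right_weak_order {u, v}" for x using weak_order_iff[OF True, of x] that upper by blast
    then have "is_join j u v \<longleftrightarrow> j \<in> Upper right_weak_order {u, v} \<and>
      (\<forall>x\<in>Upper right_weak_order {u, v}. inv_set j \<subseteq> inv_set x)"
      by (simp add: join)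
    then show ?thesis by (simp only: Ball_def upper) blast
  next
    case False
    then show ?thesis using upper join by blast
  qed
qed

lemma simple_inversion_iff:
  assumes "s \<in> S" "w \<in> carrier W"
  shows "\<alpha> s \<in> inv_set w \<longleftrightarrow> len (s \<otimes> w) + 1 = len w"
proof -
  have "lam (act (inv w) (\<alpha> s)) \<noteq> 0" using root_lam_nz root_act simple_root assms by simp
  then have "\<alpha> s \<in> inv_set w \<longleftrightarrow> \<not> 0 < lam (act (inv w) (\<alpha> s))"
    using assms by (auto simp: inv_set_def simple_root lam_simple)
  then show ?thesis using lam_act_simple_inv_iff[OF assms(2,1)] len_mult_simple[OF assms] by auto
qed

lemma inv_set_descent:
  assumes s: "s \<in> S" and w: "w \<in> carrier W" and d: "\<alpha> s \<in> inv_set w"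
  shows "inv_set w = insert (\<alpha> s) (act s ` inv_set (s \<otimes> w))" "\<alpha> s \<notin> act s ` inv_set (s \<otimes> w)"
    "len (s \<otimes> w) + 1 = len w" "\<alpha> s \<notin> inv_set (s \<otimes> w)"
proof -
  show l: "len (s \<otimes> w) + 1 = len w" using d simple_inversion_iff[OF s w] by simp
  then have l': "len (s \<otimes> (s \<otimes> w)) = len (s \<otimes> w) + 1" using s w by (simp add: S_cancel)
  show "inv_set w = insert (\<alpha> s) (act s ` inv_set (s \<otimes> w))" "\<alpha> s \<notin> act s ` inv_set (s \<otimes> w)"
    using inv_set_simple_mult[OF _ s l'] s w by (simp_all add: S_cancel)
  show "\<alpha> s \<notin> inv_set (s \<otimes> w)"
    using simple_inversion_iff[of s "s \<otimes> w"] s w l' by simp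
qed

lemma inv_set_descent_mono:
  assumes "s \<in> S" "u \<in> carrier W" "w \<in> carrier W" "\<alpha> s \<in> inv_set u" "\<alpha> s \<in> inv_set w"
  shows "inv_set (s \<otimes> u) \<subseteq> inv_set (s \<otimes> w) \<longleftrightarrow> inv_set u \<subseteq> inv_set w"
proof -
  have "inj (act s)" using assms(1) by (auto simp: inj_on_def act_eq_iff)
  then have "inv_set (s \<otimes> u) \<subseteq> inv_set (s \<otimes> w) \<longleftrightarrow>
      act s ` inv_set (s \<otimes> u) \<subseteq> act s ` inv_set (s \<otimes> w)"
    by (simp add: inj_image_subset_iff)
  also have "\<dots> \<longleftrightarrow> insert (\<alpha> s) (act s ` inv_set (s \<otimes> u)) \<subseteq> insert (\<alpha> s) (act s ` inv_set (s \<otimes> w))"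
    using inv_set_descent(2)[OF assms(1,2,4)] by (simp add: subset_insert)
  finally show ?thesis
    unfolding inv_set_descent(1)[OF assms(1,2,4), symmetric] inv_set_descent(1)[OF assms(1,3,5), symmetric] .
qed

text \<open>The reflection in s\<beta> turns sw into s times \<open>s\<^sub>\<beta> w\<close>; the
  length must drop, and it can differ from that of \<open>s\<^sub>\<beta> w\<close> only by
  1.\<close>

lemma N1_descent:
  assumes s: "s \<in> S" and w: "w \<in> carrier W" "\<alpha> s \<in> inv_set w" and \<beta>: "\<beta> \<in> N1 w" "\<beta> \<noteq> \<alpha> s"
  shows "act s \<beta> \<in> N1 (s \<otimes> w)"
proof -
  have \<beta>w: "\<beta> \<in> inv_set w" "len (root_reflection \<beta> \<otimes> w) + 1 = len w" using \<beta> N1_iff w by auto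
  then have r: "\<beta> \<in> roots" by (simp add: inv_set_def)
  obtain \<gamma> where "\<gamma> \<in> inv_set (s \<otimes> w)" "\<beta> = act s \<gamma>" using \<beta>w(1) \<beta>(2) inv_set_descent(1)[OF s w] by auto
  then have \<gamma>: "act s \<beta> \<in> inv_set (s \<otimes> w)" using s by simp
  have l: "len (s \<otimes> w) + 1 = len w" using inv_set_descent(3)[OF s w] .
  have "root_reflection (act s \<beta>) \<otimes> (s \<otimes> w) = s \<otimes> root_reflection \<beta> \<otimes> s \<otimes> (s \<otimes> w)"
    using s r by (simp add: root_reflection_act S_inv)
  also have "\<dots> = s \<otimes> (root_reflection \<beta> \<otimes> w)" using s r w by (simp add: m_assoc S_cancel)
  finally have e: "root_reflection (act s \<beta>) \<otimes> (s \<otimes> w) = s \<otimes> (root_reflection \<beta> \<otimes> w)" .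
  have "len (root_reflection (act s \<beta>) \<otimes> (s \<otimes> w)) < len (s \<otimes> w)"
    using \<gamma> len_reflection_less[of "act s \<beta>" "s \<otimes> w"] s w by (simp add: inv_set_def)
  then have "len (s \<otimes> (root_reflection \<beta> \<otimes> w)) + 1 = len (s \<otimes> w)"
    using len_mult_simple[OF s, of "root_reflection \<beta> \<otimes> w"] r w \<beta>w(2) l e by auto
  then show ?thesis using \<gamma> e N1_iff[of "s \<otimes> w"] s w by simp
qed

text \<open>With \<open>j = a \<otimes> v\<close> reduced, a drop of more than one for
  \<open>a\<close> would be inherited by \<open>j\<close>.\<close>

lemma N1_restrict:
  assumes a: "a \<in> carrier W" and j: "j \<in> carrier W" and sub: "inv_set a \<subseteq> inv_set j"
    and \<beta>: "\<beta> \<in> N1 j" "\<beta> \<in> inv_set a"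
  shows "\<beta> \<in> N1 a"
proof -
  obtain v where v: "v \<in> carrier W" "j = a \<otimes> v" "len j = len a + len v"
    using weak_order_iff[OF a j] sub by blast
  have r: "\<beta> \<in> roots" using \<beta>(2) by (simp add: inv_set_def)
  have l: "len (root_reflection \<beta> \<otimes> j) + 1 = len j" using \<beta>(1) N1_iff[OF j] by blast
  have "len (root_reflection \<beta> \<otimes> a \<otimes> v) \<le> len (root_reflection \<beta> \<otimes> a) + len v"
    using len_mult_le[of "root_reflection \<beta> \<otimes> a" v] r a v by simp
  moreover have "len (root_reflection \<beta> \<otimes> a) < len a"
    using len_reflection_less[of \<beta> a] \<beta>(2) a by (simp add: inv_set_def)
  ultimately have "len (root_reflection \<beta> \<otimes> a) + 1 = len a"
    using l v r a by (simp add: m_assoc)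
  then show ?thesis using \<beta>(2) N1_iff[OF a] by blast
qed

lemma simple_reflection_unique:
  assumes "\<beta> \<in> roots" "0 < lam \<beta>" "s \<in> S" "root_reflection \<beta> = s"
  shows "\<beta> = \<alpha> s"
proof (rule ccontr)
  assume "\<beta> \<noteq> \<alpha> s"
  then have "0 < lam (act s \<beta>)" using simple_permutes assms by blast
  then show False using root_reflection_self[OF assms(1)] assms by (simp add: lam_simps)
qed

text \<open>Here \<open>p\<close> is the longest element of the dihedral group of \<open>s\<close>
  and \<open>t\<close>. It is obtained as an element of greatest length of that group below
  \<open>w\<close>, so the finiteness of the group need not be known in advance.\<close>

lemma dihedral_longest:
  assumes st: "s \<in> S" "t \<in> S" "s \<noteq> t" and w: "w \<in> carrier W" and d: "\<alpha> s \<in> inv_set w" "\<alpha> t \<in> inv_set w"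
  obtains p where "p \<in> carrier W" "inv_set p = sub_pos (span {\<alpha> s, \<alpha> t})" "N1 p \<subseteq> {\<alpha> s, \<alpha> t}"
    "\<And>x. \<lbrakk>x \<in> carrier W; \<alpha> s \<in> inv_set x; \<alpha> t \<in> inv_set x\<rbrakk> \<Longrightarrow> inv_set p \<subseteq> inv_set x"
proof -
  define P where "P = span {\<alpha> s, \<alpha> t}"
  have P: "subspace P" "\<alpha> s \<in> P" "\<alpha> t \<in> P" by (auto simp: P_def span_base)
  define D where "D = word_prod W ` {xs. set xs \<subseteq> {s, t}}"
  have Dc: "x \<in> carrier W" if "x \<in> D" for x using that st by (auto simp: D_def)
  have Dmult: "x \<otimes> y \<in> D" if xy: "x \<in> D" "y \<in> D" for x y
  proof -
    obtain xs ys where "set xs \<subseteq> {s, t}" "set ys \<subseteq> {s, t}" "x = word_prod W xs" "y = word_prod W ys"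
      using xy unfolding D_def by blast
    moreover have "word_prod W (xs @ ys) = word_prod W xs \<otimes> word_prod W ys"
      using calculation st by (intro word_prod_append) auto
    ultimately show ?thesis unfolding D_def by (intro image_eqI[of _ _ "xs @ ys"]) auto
  qed
  have Dinv: "inv x \<in> D" if x: "x \<in> D" for x
  proof -
    obtain xs where "set xs \<subseteq> {s, t}" "x = word_prod W xs" using x unfolding D_def by blast
    moreover have "word_prod W (rev xs) = inv (word_prod W xs)"
      using calculation st by (intro word_prod_rev) auto
    ultimately show ?thesis unfolding D_def by (intro image_eqI[of _ _ "rev xs"]) auto
  qed
  have Dst: "s \<in> D" "t \<in> D" "\<one> \<in> D"
    unfolding D_def using st by (auto intro: image_eqI[of _ _ "[s]"] image_eqI[of _ _ "[t]"] image_eqI[of _ _ "[]"])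
  have DP: "act x v \<in> P" if "x \<in> D" "v \<in> P" for x v
  proof -
    have "set xs \<subseteq> {s, t} \<Longrightarrow> act (word_prod W xs) v \<in> P" for xs
    proof (induction xs)
      case (Cons y xs)
      then have y: "y \<in> S" "\<alpha> y \<in> P" "set xs \<subseteq> S" using st P by auto
      then show ?case using Cons P(1) by (simp add: act_mult act_simple_apply subspace_diff subspace_scale)
    qed (simp add: that)
    then show ?thesis using that by (auto simp: D_def)
  qed
  have Dinv_root: "\<beta> \<in> P \<and> root_reflection \<beta> \<in> D" if x: "x \<in> D" and \<beta>: "\<beta> \<in> inv_set x" for x \<beta>
  proof -
    obtain xs where xs: "set xs \<subseteq> {s, t}" "x = word_prod W xs" using x unfolding D_def by blast
    obtain us q vs where us: "xs = us @ q # vs" "\<beta> = act (word_prod W us) (\<alpha> q)"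
      using word_inversion[of xs \<beta>] xs st \<beta> by (auto simp: inv_set_def)
    have u: "word_prod W us \<in> D" "q \<in> {s, t}" using xs us by (auto simp: D_def)
    then show ?thesis using us(2) DP P Dmult Dinv Dst st Dc by (auto simp: root_reflection_act_simple)
  qed
  have can: "\<alpha> s \<in> canonical UNIV" "\<alpha> t \<in> canonical UNIV" using simple_canonical st by auto
  have ne: "\<alpha> s \<noteq> \<alpha> t" using inj_on_simple st by (auto dest: inj_onD)
  have coh: "\<exists>a b. 0 \<le> a \<and> 0 \<le> b \<and> \<beta> = a *\<^sub>R \<alpha> s + b *\<^sub>R \<alpha> t" if "\<beta> \<in> roots" "0 < lam \<beta>" "\<beta> \<in> P" for \<beta>
    using plane_coherent[OF subspace_UNIV can ne that(1,2)] that(3) plane_elem unfolding P_def by metis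
  have "\<one> \<in> D \<and> inv_set \<one> \<subseteq> inv_set w" using Dst by simp
  moreover have "\<forall>x. x \<in> D \<and> inv_set x \<subseteq> inv_set w \<longrightarrow> len x < Suc (len w)"
    using card_mono[OF inv_set_card(1)[OF w]] inv_set_card(2) Dc w by (metis less_Suc_eq_le)
  ultimately have "\<exists>p. (p \<in> D \<and> inv_set p \<subseteq> inv_set w) \<and> (\<forall>x. x \<in> D \<and> inv_set x \<subseteq> inv_set w \<longrightarrow> len x \<le> len p)"
    by (rule Lattices_Big.ex_has_greatest_nat[where P = "\<lambda>x. x \<in> D \<and> inv_set x \<subseteq> inv_set w" and f = len])
  then obtain p where p: "p \<in> D" "inv_set p \<subseteq> inv_set w"
    and max: "\<And>x. x \<in> D \<Longrightarrow> inv_set x \<subseteq> inv_set w \<Longrightarrow> len x \<le> len p"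
    by blast
  have pc: "p \<in> carrier W" using p Dc by blast
  obtain y where y: "y \<in> carrier W" "w = p \<otimes> y" "len w = len p + len y"
    using weak_order_iff[OF pc w] p(2) by blast
  \<comment> \<open>A left descent \<open>s\<close> or \<open>t\<close> of \<open>y\<close> could be
    moved over to \<open>p\<close>, against maximality.\<close>
  have yq: "0 < lam (act (inv y) (\<alpha> q))" if q: "q \<in> {s, t}" for q
  proof -
    have qS: "q \<in> S" "q \<in> D" using q st Dst by auto
    have "len (q \<otimes> y) = len y + 1"
    proof (rule ccontr)
      assume "len (q \<otimes> y) \<noteq> len y + 1"
      then have l: "len (q \<otimes> y) + 1 = len y" using len_mult_simple[OF qS(1) y(1)] by auto
      have w': "w = p \<otimes> q \<otimes> (q \<otimes> y)" using y pc qS by (simp add: m_assoc S_cancel)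
      have "len w \<le> len (p \<otimes> q) + len (q \<otimes> y)" unfolding w' using len_mult_le[of "p \<otimes> q" "q \<otimes> y"] pc qS y by simp
      then have l2: "len (p \<otimes> q) = len p + 1" using len_mult_simple_right[OF qS(1) pc] y(3) l by linarith
      have "inv_set (p \<otimes> q) \<subseteq> inv_set w"
        using weak_order_iff[of "p \<otimes> q" w] w' l l2 y pc qS w by (metis add.assoc add.commute m_closed S_closed)
      then show False using max[of "p \<otimes> q"] Dmult p qS l2 by force
    qed
    then show ?thesis using lam_act_simple_inv_iff[OF y(1) qS(1)] by simp
  qed
  \<comment> \<open>Otherwise \<open>inv p\<close> sends \<open>\<alpha> q\<close> to a nonnegative
    combination of the two simple roots, which \<open>inv y\<close> keeps nonnegative under
    \<open>lam\<close>; but \<open>\<alpha> q\<close> is an inversion of \<open>w\<close>.\<close>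
  have pq: "\<alpha> q \<in> inv_set p" if q: "q \<in> {s, t}" for q
  proof (rule ccontr)
    assume "\<alpha> q \<notin> inv_set p"
    have qS: "q \<in> S" "\<alpha> q \<in> P" "\<alpha> q \<in> inv_set w" using q st P d by auto
    have r: "act (inv p) (\<alpha> q) \<in> roots" using root_act simple_root qS pc by simp
    then have "0 < lam (act (inv p) (\<alpha> q))"
      using \<open>\<alpha> q \<notin> inv_set p\<close> qS root_lam_nz[OF r] by (auto simp: inv_set_def simple_root lam_simple)
    then obtain a b where ab: "0 \<le> a" "0 \<le> b" "act (inv p) (\<alpha> q) = a *\<^sub>R \<alpha> s + b *\<^sub>R \<alpha> t"
      using coh[OF r] DP[OF Dinv[OF p(1)] qS(2)] by blast
    have "act (inv w) (\<alpha> q) = act (inv y) (act (inv p) (\<alpha> q))"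
      using y pc by (simp add: inv_mult_group act_mult)
    then have "lam (act (inv w) (\<alpha> q)) = a * lam (act (inv y) (\<alpha> s)) + b * lam (act (inv y) (\<alpha> t))"
      using y(1) by (simp add: ab act_add act_scale lam_simps)
    then have "0 \<le> lam (act (inv w) (\<alpha> q))" using ab yq[of s] yq[of t] by simp
    then show False using qS by (simp add: inv_set_def)
  qed
  have full: "sub_pos P \<subseteq> inv_set x" if x: "x \<in> carrier W" "\<alpha> s \<in> inv_set x" "\<alpha> t \<in> inv_set x" for x
  proof
    fix \<beta> assume \<beta>: "\<beta> \<in> sub_pos P"
    obtain a b where ab: "0 \<le> a" "0 \<le> b" "\<beta> = a *\<^sub>R \<alpha> s + b *\<^sub>R \<alpha> t" using coh[of \<beta>] \<beta> by (auto simp: sub_pos_def)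
    have "lam (act (inv x) \<beta>) = a * lam (act (inv x) (\<alpha> s)) + b * lam (act (inv x) (\<alpha> t))"
      using x(1) by (simp add: ab act_add act_scale lam_simps)
    also have "\<dots> \<le> 0" using ab x by (intro add_nonpos_nonpos mult_nonneg_nonpos) (auto simp: inv_set_def)
    finally show "\<beta> \<in> inv_set x"
      using \<beta> x(1) root_act[of \<beta> "inv x"] root_lam_nz[of "act (inv x) \<beta>"] by (auto simp: inv_set_def sub_pos_def less_le)
  qed
  have sub: "inv_set x \<subseteq> sub_pos P" if "x \<in> D" for x
    using Dinv_root[OF that] by (auto simp: sub_pos_def inv_set_def)
  have Np: "inv_set p = sub_pos P" using full[OF pc] pq sub[OF p(1)] by blast
  have fin: "finite (sub_pos P)" "card (sub_pos P) = len p" using Np inv_set_card[OF pc] by auto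
  have "N1 p \<subseteq> {\<alpha> s, \<alpha> t}"
  proof
    fix \<beta> assume "\<beta> \<in> N1 p"
    then have \<beta>: "\<beta> \<in> inv_set p" "len (root_reflection \<beta> \<otimes> p) + 1 = len p" using N1_iff[OF pc] by auto
    have r: "\<beta> \<in> roots" "0 < lam \<beta>" using \<beta>(1) by (auto simp: inv_set_def)
    define x where "x = root_reflection \<beta> \<otimes> p"
    have x: "x \<in> D" "x \<in> carrier W" "len x + 1 = len p"
      using Dmult Dinv_root[OF p(1) \<beta>(1)] p(1) Dc \<beta>(2) by (auto simp: x_def)
    have "\<not> sub_pos P \<subseteq> inv_set x"
    proof
      assume "sub_pos P \<subseteq> inv_set x"
      then have "card (sub_pos P) \<le> len x" using card_mono inv_set_card[OF x(2)] by metis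
      then show False using fin x(3) by simp
    qed
    \<comment> \<open>Being shorter than \<open>p\<close>, \<open>x\<close> misses some
      \<open>\<alpha> q\<close>. Then \<open>q \<otimes> x\<close> has the length of
      \<open>p\<close> and only inversions in the plane, hence equals \<open>p\<close>, so the
      reflection in \<beta> is \<open>q\<close>.\<close>
    then obtain q where q: "q \<in> {s, t}" "\<alpha> q \<notin> inv_set x" using full[OF x(2)] by blast
    have qS: "q \<in> S" "q \<in> D" using q st Dst by auto
    have "len (q \<otimes> x) = len p"
      using simple_inversion_iff[OF qS(1) x(2)] q(2) len_mult_simple[OF qS(1) x(2)] x(3) by auto
    moreover have "q \<otimes> x \<in> D" using Dmult qS x by blast
    ultimately have "inv_set (q \<otimes> x) = sub_pos P"
      using card_subset_eq[OF fin(1) sub] fin(2) inv_set_card(2)[of "q \<otimes> x"] Dc by metis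
    then have "q \<otimes> x = p" using inv_set_inj[of "q \<otimes> x" p] Np pc x qS by simp
    then have "x = q \<otimes> p" using qS x by (metis S_cancel)
    then have "root_reflection \<beta> = q" using r pc qS by (auto simp: x_def)
    then have "\<beta> = \<alpha> q" using simple_reflection_unique r qS by blast
    then show "\<beta> \<in> {\<alpha> s, \<alpha> t}" using q by auto
  qed
  then show ?thesis by (rule that[OF pc Np[unfolded P_def]]) (use full Np in auto)
qed

definition short_join :: "'w \<Rightarrow> 'w \<Rightarrow> 'w \<Rightarrow> bool" where
  "short_join u v j \<longleftrightarrow> is_join j u v \<and> N1 j \<subseteq> inv_set u \<union> inv_set v"

text \<open>Existence of the join and the bound on its short inversions are proved together, by
  induction on the length of a common upper bound. Without a common left descent, the join is
  assembled from three joins of pairs with one, using the longest element \<open>p\<close> of a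
  dihedral group.\<close>

lemma short_join_exists:
  assumes "u \<in> carrier W" "v \<in> carrier W" "w \<in> carrier W" "inv_set u \<subseteq> inv_set w" "inv_set v \<subseteq> inv_set w"
  shows "\<exists>j. short_join u v j"
  using assms
proof (induction "len w" arbitrary: u v w rule: less_induct)
  case less
  note w = less.prems(3)
  \<comment> \<open>A common simple inversion is cancelled from \<open>u\<close>, \<open>v\<close>
    and \<open>w\<close>, which shortens the bound, and put back afterwards.\<close>
  have common: "\<exists>j. short_join u v j"
    if uv: "u \<in> carrier W" "v \<in> carrier W" "inv_set u \<subseteq> inv_set w" "inv_set v \<subseteq> inv_set w"
      and s: "s \<in> S" "\<alpha> s \<in> inv_set u" "\<alpha> s \<in> inv_set v" for u v s
  proof -
    have sw: "\<alpha> s \<in> inv_set w" using uv s by blast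
    have mono: "inv_set (s \<otimes> u) \<subseteq> inv_set (s \<otimes> w)" "inv_set (s \<otimes> v) \<subseteq> inv_set (s \<otimes> w)"
      using inv_set_descent_mono[OF s(1) _ w _ sw] uv s by auto
    have "len (s \<otimes> w) < len w" using inv_set_descent(3)[OF s(1) w sw] by simp
    from less.hyps[OF this _ _ _ mono] obtain j where "short_join (s \<otimes> u) (s \<otimes> v) j"
      using s(1) uv w by auto
    then have j: "j \<in> carrier W" "inv_set (s \<otimes> u) \<subseteq> inv_set j" "inv_set (s \<otimes> v) \<subseteq> inv_set j"
      and least: "\<And>x. \<lbrakk>x \<in> carrier W; inv_set (s \<otimes> u) \<subseteq> inv_set x; inv_set (s \<otimes> v) \<subseteq> inv_set x\<rbrakk> \<Longrightarrow> inv_set j \<subseteq> inv_set x"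
      and N1j: "N1 j \<subseteq> inv_set (s \<otimes> u) \<union> inv_set (s \<otimes> v)"
      using is_join_iff[of "s \<otimes> u" "s \<otimes> v" j] uv s(1) by (auto simp: short_join_def)
    have "inv_set j \<subseteq> inv_set (s \<otimes> w)" using least mono s(1) w by simp
    then have sj: "\<alpha> s \<notin> inv_set j" using inv_set_descent(4)[OF s(1) w sw] by blast
    define j' where "j' = s \<otimes> j"
    have j': "j' \<in> carrier W" "s \<otimes> j' = j" using j s by (auto simp: j'_def S_cancel)
    have "len (s \<otimes> j) = len j + 1"
      using sj simple_inversion_iff[OF s(1) j(1)] len_mult_simple[OF s(1) j(1)] by auto
    then have sj': "\<alpha> s \<in> inv_set j'" using inv_set_simple_mult(1)[OF j(1) s(1)] by (simp add: j'_def)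
    have "inv_set u \<subseteq> inv_set j'" "inv_set v \<subseteq> inv_set j'"
      using inv_set_descent_mono[OF s(1) uv(1) j'(1) s(2) sj'] inv_set_descent_mono[OF s(1) uv(2) j'(1) s(3) sj'] j j'
      by auto
    moreover have "inv_set j' \<subseteq> inv_set x" if x: "x \<in> carrier W" "inv_set u \<subseteq> inv_set x" "inv_set v \<subseteq> inv_set x" for x
    proof -
      have sx: "\<alpha> s \<in> inv_set x" using x s by blast
      have "inv_set j \<subseteq> inv_set (s \<otimes> x)"
        using least[of "s \<otimes> x"] inv_set_descent_mono[OF s(1) uv(1) x(1) s(2) sx]
          inv_set_descent_mono[OF s(1) uv(2) x(1) s(3) sx] x s(1) by auto
      then show ?thesis using inv_set_descent_mono[OF s(1) j'(1) x(1) sj' sx] j' by simp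
    qed
    moreover have "N1 j' \<subseteq> inv_set u \<union> inv_set v"
    proof
      fix \<beta> assume \<beta>: "\<beta> \<in> N1 j'"
      show "\<beta> \<in> inv_set u \<union> inv_set v"
      proof (cases "\<beta> = \<alpha> s")
        case False
        then have "act s \<beta> \<in> inv_set (s \<otimes> u) \<union> inv_set (s \<otimes> v)"
          using N1_descent[OF s(1) j'(1) sj' \<beta>] N1j j' by auto
        then have "act s (act s \<beta>) \<in> inv_set u \<union> inv_set v"
          using inv_set_descent(1)[OF s(1) uv(1) s(2)] inv_set_descent(1)[OF s(1) uv(2) s(3)] by blast
        then show ?thesis using s(1) by simp
      qed (use s in auto)
    qed
    ultimately have "short_join u v j'" using is_join_iff[OF uv(1,2), of j'] j' by (auto simp: short_join_def)
    then show ?thesis by blast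
  qed
  show ?case
  proof (cases "u = \<one> \<or> v = \<one>")
    case True
    moreover have "N1 u \<subseteq> inv_set u" "N1 v \<subseteq> inv_set v" using N1_iff less.prems(1,2) by auto
    ultimately have "short_join u v v \<or> short_join u v u"
      using is_join_iff[OF less.prems(1,2)] less.prems(1,2) by (auto simp: short_join_def)
    then show ?thesis by blast
  next
    case False
    obtain s where s: "s \<in> S" "\<alpha> s \<in> inv_set u"
      using left_descent_exists[of u] False less.prems(1) simple_inversion_iff by metis
    obtain t where t: "t \<in> S" "\<alpha> t \<in> inv_set v"
      using left_descent_exists[of v] False less.prems(2) simple_inversion_iff by metis
    show ?thesis
    proof (cases "s = t")
      case True
      then show ?thesis using common less.prems s t by blast
    next
      case False
      have stw: "\<alpha> s \<in> inv_set w" "\<alpha> t \<in> inv_set w" using s t less.prems by auto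
      obtain p where p: "p \<in> carrier W" "inv_set p = sub_pos (span {\<alpha> s, \<alpha> t})" "N1 p \<subseteq> {\<alpha> s, \<alpha> t}"
        and p_least: "\<And>x. \<lbrakk>x \<in> carrier W; \<alpha> s \<in> inv_set x; \<alpha> t \<in> inv_set x\<rbrakk> \<Longrightarrow> inv_set p \<subseteq> inv_set x"
        using dihedral_longest[OF s(1) t(1) False w stw] by blast
      have stp: "\<alpha> s \<in> inv_set p" "\<alpha> t \<in> inv_set p"
        unfolding p(2) using s t by (auto simp: sub_pos_def simple_root lam_simple span_base)
      have pw: "inv_set p \<subseteq> inv_set w" using p_least w stw by blast
      have joinD: "j \<in> carrier W" "inv_set a \<subseteq> inv_set j" "inv_set b \<subseteq> inv_set j"
          "\<And>x. \<lbrakk>x \<in> carrier W; inv_set a \<subseteq> inv_set x; inv_set b \<subseteq> inv_set x\<rbrakk> \<Longrightarrow> inv_set j \<subseteq> inv_set x"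
          "N1 j \<subseteq> inv_set a \<union> inv_set b"
        if "short_join a b j" "a \<in> carrier W" "b \<in> carrier W" for a b j
        using that is_join_iff[of a b j] by (auto simp: short_join_def)
      obtain a where "short_join u p a" using common[OF less.prems(1) p(1) less.prems(4) pw s stp(1)] by blast
      note a = joinD[OF this less.prems(1) p(1)]
      obtain b where "short_join v p b" using common[OF less.prems(2) p(1) less.prems(5) pw t stp(2)] by blast
      note b = joinD[OF this less.prems(2) p(1)]
      have abw: "inv_set a \<subseteq> inv_set w" "inv_set b \<subseteq> inv_set w"
        using a(4)[OF w less.prems(4) pw] b(4)[OF w less.prems(5) pw] .
      have sab: "\<alpha> s \<in> inv_set a" "\<alpha> s \<in> inv_set b" using a(2) b(3) s(2) stp(1) by blast+
      obtain j where "short_join a b j" using common[OF a(1) b(1) abw s(1) sab] by blast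
      note j = joinD[OF this a(1) b(1)]
      \<comment> \<open>A short inversion of \<open>j\<close> contributed by \<open>p\<close> is
        short for \<open>p\<close>, hence one of the two simple roots, which already lie in N(u) and
        N(v).\<close>
      have aj: "\<beta> \<in> inv_set u \<union> inv_set v" if \<beta>: "\<beta> \<in> N1 j" "\<beta> \<in> inv_set u \<union> inv_set v \<union> inv_set p" for \<beta>
      proof (cases "\<beta> \<in> inv_set p")
        case True
        have "inv_set p \<subseteq> inv_set j" using a(3) j(2) by blast
        then have "\<beta> \<in> N1 p" using N1_restrict[OF p(1) j(1) _ \<beta>(1) True] by blast
        then show ?thesis using p(3) s(2) t(2) by blast
      qed (use \<beta>(2) in blast)
      have "N1 j \<subseteq> inv_set u \<union> inv_set v"
      proof
        fix \<beta> assume \<beta>: "\<beta> \<in> N1 j"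
        then consider "\<beta> \<in> inv_set a" | "\<beta> \<in> inv_set b" using j(5) by blast
        then show "\<beta> \<in> inv_set u \<union> inv_set v"
        proof cases
          case 1
          then show ?thesis using N1_restrict[OF a(1) j(1,2) \<beta> 1] a(5) aj[OF \<beta>] by blast
        next
          case 2
          then show ?thesis using N1_restrict[OF b(1) j(1,3) \<beta> 2] b(5) aj[OF \<beta>] by blast
        qed
      qed
      moreover have "inv_set j \<subseteq> inv_set x" if x: "x \<in> carrier W" "inv_set u \<subseteq> inv_set x" "inv_set v \<subseteq> inv_set x" for x
      proof -
        have "inv_set p \<subseteq> inv_set x" using p_least[OF x(1)] x s(2) t(2) by blast
        then show ?thesis using a(4)[OF x(1,2)] b(4)[OF x(1,3)] j(4)[OF x(1)] by blast
      qed
      moreover have "inv_set u \<subseteq> inv_set j" "inv_set v \<subseteq> inv_set j" using a(2) b(2) j(2,3) by auto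
      ultimately have "short_join u v j"
        using is_join_iff[OF less.prems(1,2), of j] j(1) by (simp add: short_join_def)
      then show ?thesis by blast
    qed
  qed
qed

theorem low_join:
  assumes u: "u \<in> low_elements" and v: "v \<in> low_elements" and j: "is_join j u v"
  shows "j \<in> low_elements"
proof -
  have c: "u \<in> carrier W" "v \<in> carrier W" using u v by (auto simp: low_elements_def)
  have j': "j \<in> carrier W" "inv_set u \<subseteq> inv_set j" "inv_set v \<subseteq> inv_set j"
    "\<And>x. \<lbrakk>x \<in> carrier W; inv_set u \<subseteq> inv_set x; inv_set v \<subseteq> inv_set x\<rbrakk> \<Longrightarrow> inv_set j \<subseteq> inv_set x"
    using j is_join_iff[OF c] by auto
  obtain k where k: "short_join u v k" using short_join_exists[OF c j'(1-3)] by blast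
  then have "inv_set k = inv_set j" "k \<in> carrier W"
    using j' is_join_iff[OF c, of k] by (auto simp: short_join_def)
  then have "k = j" using inv_set_inj j'(1) by blast
  then have N: "N1 j \<subseteq> inv_set u \<union> inv_set v" using k by (simp add: short_join_def)
  have "\<beta> \<in> small_roots" if "\<beta> \<in> N1 j" for \<beta>
    using N1_restrict[OF c(1) j'(1,2) that] N1_restrict[OF c(2) j'(1,3) that] that N u v
    by (auto simp: low_elements_def)
  then show ?thesis using j'(1) by (auto simp: low_elements_def)
qed

end

section \<open>Bipodality of the set of small roots\<close>

lemma chebyshev_U_values:
  "chebyshev_U c 2 = 2 * c"
  "chebyshev_U c 3 = 4 * c\<^sup>2 - 1"
  "chebyshev_U c 4 = 4 * c * (2 * c\<^sup>2 - 1)"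
  "chebyshev_U c 5 = 16 * (c\<^sup>2)\<^sup>2 - 12 * c\<^sup>2 + 1"
  "chebyshev_U c 6 = 2 * c * (4 * c\<^sup>2 - 1) * (4 * c\<^sup>2 - 3)"
  "chebyshev_U c 7 = 8 * c\<^sup>2 * (2 * c\<^sup>2 - 1) * (4 * c\<^sup>2 - 3) - 1"
  by (simp_all add: numeral_eq_Suc power2_eq_square algebra_simps)

text \<open>The hypothesis on the sequence is the discreteness of a dihedral reflection group: \<open>c\<close> is
  \<open>cos(\<pi>/k)\<close> or at least 1, and \<open>c\<^sup>2 > 3/4\<close> forces \<open>k \<ge> 7\<close>.\<close>

lemma chebyshev_U_discrete:
  assumes c: "0 \<le> c" and step: "\<And>k. 0 < chebyshev_U c k \<Longrightarrow> 0 \<le> chebyshev_U c (Suc k)"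
  shows "c = 0 \<or> c = 1 / 2 \<or> 1 / 2 \<le> c\<^sup>2" "3 / 4 < c\<^sup>2 \<Longrightarrow> 1 \<le> 2 * c * (2 * c\<^sup>2 - 1)"
proof -
  have s23: "0 < chebyshev_U c 2 \<Longrightarrow> 0 \<le> chebyshev_U c 3" and s34: "0 < chebyshev_U c 3 \<Longrightarrow> 0 \<le> chebyshev_U c 4"
    and s67: "0 < chebyshev_U c 6 \<Longrightarrow> 0 \<le> chebyshev_U c 7"
    using step[of 2] step[of 3] step[of 6] by (simp_all del: chebyshev_U.simps)
  show "c = 0 \<or> c = 1 / 2 \<or> 1 / 2 \<le> c\<^sup>2"
  proof (cases "c = 0")
    case False
    then have c0: "0 < c" using c by simp
    then have "0 \<le> 4 * c\<^sup>2 - 1" using s23 by (simp add: chebyshev_U_values)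
    show ?thesis
    proof (cases "4 * c\<^sup>2 - 1 = 0")
      case True
      then have "c\<^sup>2 = (1 / 2)\<^sup>2" by (simp add: power2_eq_square)
      then show ?thesis using c by (simp add: power2_eq_iff)
    next
      case False
      then have "0 \<le> 4 * c * (2 * c\<^sup>2 - 1)" using s34 \<open>0 \<le> 4 * c\<^sup>2 - 1\<close> by (simp add: chebyshev_U_values)
      then have "0 \<le> 2 * c\<^sup>2 - 1" using c0 by (simp add: zero_le_mult_iff)
      then show ?thesis by simp
    qed
  qed simp
  show "1 \<le> 2 * c * (2 * c\<^sup>2 - 1)" if x: "3 / 4 < c\<^sup>2"
  proof -
    define x where "x = c\<^sup>2"
    have x0: "3 / 4 < x" using x by (simp add: x_def)
    have c0: "0 < c" using x c by (cases "c = 0") auto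
    then have "0 < chebyshev_U c 6" using x by (simp add: chebyshev_U_values)
    then have f: "1 \<le> 8 * x * (2 * x - 1) * (4 * x - 3)" using s67 by (simp add: chebyshev_U_values x_def)
    \<comment> \<open>A rational bound below cos^2(pi/7), about 0.81: small enough to follow from
      the inequality \<open>f\<close>, large enough to make 4 x (2 x - 1)^2 at least 1.\<close>
    have "79 / 100 \<le> x"
    proof (rule ccontr)
      assume "\<not> ?thesis"
      then have u: "x < 79 / 100" by simp
      have "8 * x * (2 * x - 1) * (4 * x - 3) \<le> 8 * (79 / 100) * (2 * (79 / 100) - 1) * (4 * (79 / 100) - 3)"
        using u x0 by (intro mult_mono) auto
      then show False using f by simp
    qed
    then have "4 * (79 / 100) * (2 * (79 / 100) - 1)\<^sup>2 \<le> 4 * x * (2 * x - 1)\<^sup>2"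
      by (intro mult_mono power_mono) auto
    moreover have "1 \<le> 4 * (79 / 100) * (2 * (79 / 100) - 1 :: real)\<^sup>2" by (simp add: power2_eq_square)
    ultimately have "1 \<le> 4 * x * (2 * x - 1)\<^sup>2" by linarith
    also have "4 * x * (2 * x - 1)\<^sup>2 = (2 * c * (2 * c\<^sup>2 - 1))\<^sup>2" by (simp add: x_def power2_eq_square)
    finally have "1\<^sup>2 \<le> (2 * c * (2 * c\<^sup>2 - 1))\<^sup>2" by simp
    moreover have "0 \<le> 2 * c * (2 * c\<^sup>2 - 1)" using c0 x by simp
    ultimately show ?thesis by (rule power2_le_imp_le)
  qed
qed

text \<open>The recursion is reversible, and read from the far end it starts with the same values 0,
  1.\<close>

lemma chebyshev_U_symmetric:
  assumes "chebyshev_U c (Suc L) = 0" "chebyshev_U c L = 1"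
  shows "k \<le> L \<Longrightarrow> chebyshev_U c (Suc L - k) = chebyshev_U c k \<and> chebyshev_U c (L - k) = chebyshev_U c (Suc k)"
proof (induction k)
  case (Suc k)
  then have IH: "chebyshev_U c (Suc (L - k)) = chebyshev_U c k" "chebyshev_U c (L - k) = chebyshev_U c (Suc k)"
    by (simp_all add: Suc_diff_le)
  obtain n where n: "L - k = Suc n" using Suc.prems by (cases "L - k") auto
  have "chebyshev_U c (Suc (Suc n)) = 2 * c * chebyshev_U c (Suc n) - chebyshev_U c n" by simp
  then have "chebyshev_U c n = chebyshev_U c (Suc (Suc k))" using IH unfolding n by simp
  moreover have "L - Suc k = n" using n by simp
  ultimately show ?case using IH by (simp del: chebyshev_U.simps)
qed (use assms in simp)

text \<open>The values are concave and symmetric about (L + 1)/2, hence smallest towards both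
  ends.\<close>

lemma chebyshev_U_min:
  assumes zero: "chebyshev_U c (Suc L) = 0" "chebyshev_U c L = 1" and c: "c < 1"
    and pos: "\<And>k. \<lbrakk>0 < k; k < Suc L\<rbrakk> \<Longrightarrow> 0 < chebyshev_U c k"
    and k: "i \<le> k" "k + i \<le> Suc L"
  shows "chebyshev_U c i \<le> chebyshev_U c k"
proof -
  let ?u = "chebyshev_U c"
  define D where "D k = ?u (Suc k) - ?u k" for k
  note sym = chebyshev_U_symmetric[OF zero]
  have nn: "0 \<le> ?u k" if "k \<le> Suc L" for k using pos[of k] zero that by (cases "k = 0 \<or> k = Suc L") auto
  have dec: "D (Suc k) \<le> D k" if "k < Suc L" for k
  proof -
    have "D (Suc k) = D k - (2 - 2 * c) * ?u (Suc k)" by (simp add: D_def algebra_simps)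
    moreover have "0 \<le> (2 - 2 * c) * ?u (Suc k)" using c nn[of "Suc k"] that by simp
    ultimately show ?thesis by linarith
  qed
  have anti: "D (k + n) \<le> D k" if "k + n \<le> L" for k n
    using that
  proof (induction n)
    case (Suc n)
    then show ?case using dec[of "k + n"] by simp
  qed simp
  have Dnn: "0 \<le> D k" if "2 * k \<le> L" for k
  proof -
    have "D (L - k) = - D k" using sym[of k] that Suc_diff_le[of k L] by (simp add: D_def)
    moreover have "D (L - k) \<le> D k" using anti[of k "L - 2 * k"] that by (simp add: mult_2)
    ultimately show ?thesis by linarith
  qed
  have mono: "?u i \<le> ?u (i + n)" if "2 * (i + n) \<le> Suc L" for n
    using that
  proof (induction n)
    case (Suc n)
    then show ?case using Dnn[of "i + n"] by (simp add: D_def)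
  qed simp
  show ?thesis
  proof (cases "2 * k \<le> Suc L")
    case True
    then show ?thesis using mono[of "k - i"] k by simp
  next
    case False
    then have "2 * (Suc L - k) \<le> Suc L" "i \<le> Suc L - k" using k by auto
    moreover from this have "i + (Suc L - k - i) = Suc L - k" by simp
    ultimately have "?u i \<le> ?u (Suc L - k)" using mono[of "Suc L - k - i"] by (simp only:)
    also have "?u (Suc L - k) = ?u k"
    proof (cases "k \<le> L")
      case False
      then have "k = Suc L" using k by simp
      then show ?thesis using zero by simp
    qed (use sym in blast)
    finally show ?thesis .
  qed
qed

text \<open>Near either end the pairs are explicit; by \<open>chebyshev_U_min\<close> all others are
  bounded below by the values with index 2 and 3, which are 2c and 4c^2 - 1.\<close>

lemma chebyshev_U_consecutive:
  assumes zero: "chebyshev_U c (Suc L) = 0" "chebyshev_U c L = 1" and c: "c < 1"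
    and pos: "\<And>k. \<lbrakk>0 < k; k < Suc L\<rbrakk> \<Longrightarrow> 0 < chebyshev_U c k"
    and k: "0 < k" "k < L" and ab: "a = chebyshev_U c k" "b = chebyshev_U c (Suc k)"
  shows "1 \<le> a \<and> 1 \<le> b \<and> 0 < c \<and>
    (a = 1 \<and> b = 2 * c \<or> a = 2 * c \<and> b = 1 \<or>
     a = 2 * c \<and> b = 4 * c\<^sup>2 - 1 \<and> 2 * c \<le> b \<or> a = 4 * c\<^sup>2 - 1 \<and> b = 2 * c \<and> 2 * c \<le> a \<or>
     0 < 4 * c\<^sup>2 - 1 \<and> 4 * c\<^sup>2 - 1 \<le> a \<and> 4 * c\<^sup>2 - 1 \<le> b \<and> 2 * c \<le> a \<and> 2 * c \<le> b)"
proof -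
  let ?u = "chebyshev_U c"
  note min = chebyshev_U_min[OF zero c pos]
  note sym = chebyshev_U_symmetric[OF zero]
  have a1: "1 \<le> a" "1 \<le> b" using min[of 1 k] min[of 1 "Suc k"] k ab by auto
  have "0 < ?u 2" using pos[of 2] k by simp
  then have c0: "0 < c" by (simp add: chebyshev_U_values)
  have u2: "?u 2 = 2 * c" "?u 3 = 4 * c\<^sup>2 - 1" by (rule chebyshev_U_values)+
  consider "k = 1" | "k \<noteq> 1" "Suc k = L" | "k = 2" "Suc k < L" | "k \<noteq> 1" "k \<noteq> 2" "Suc (Suc k) = L" | "3 \<le> k" "Suc (Suc (Suc k)) \<le> L"
    using k by linarith
  then show ?thesis
  proof cases
    case 1
    then show ?thesis using ab a1 c0 u2 by (simp add: numeral_2_eq_2)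
  next
    case 2
    then have "a = 2 * c" "b = 1"
      using ab sym[of 1] u2 zero by (auto simp: numeral_2_eq_2)
    then show ?thesis using a1 c0 by simp
  next
    case 3
    then have "a = 2 * c" "b = 4 * c\<^sup>2 - 1" using ab u2 by (simp_all add: numeral_2_eq_2 numeral_3_eq_3)
    moreover have "2 * c \<le> b" using min[of 2 "Suc k"] 3 ab u2 by simp
    ultimately show ?thesis using a1 c0 by simp
  next
    case 4
    then have "L - 1 = Suc k" "L - 2 = k" "2 \<le> L" by auto
    then have "a = 4 * c\<^sup>2 - 1" "b = 2 * c"
      using ab sym[of 1] sym[of 2] u2 by (simp_all add: numeral_2_eq_2 numeral_3_eq_3)
    moreover have "2 * c \<le> a" using min[of 2 k] 4 k ab u2 by simp
    ultimately show ?thesis using a1 c0 by simp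
  next
    case 5
    then have "?u 3 \<le> a" "?u 3 \<le> b" "?u 2 \<le> a" "?u 2 \<le> b"
      using min[of 3 k] min[of 3 "Suc k"] min[of 2 k] min[of 2 "Suc k"] k ab by auto
    moreover have "0 < ?u 3" using pos[of 3] 5 by simp
    ultimately show ?thesis using a1 c0 u2 by simp
  qed
qed

context finite_based_root_system
begin

section \<open>Subsystems of rank three\<close>

lemma space_elem: "x \<in> span {a, b, c} \<longleftrightarrow> (\<exists>p q t. x = p *\<^sub>R a + q *\<^sub>R b + t *\<^sub>R c)" for a b c :: "'a::real_vector"
proof
  assume "x \<in> span {a, b, c}"
  then obtain p where "x - p *\<^sub>R a \<in> span {b, c}" using span_breakdown_eq[of x a "{b, c}"] by auto
  then obtain q t where "x - p *\<^sub>R a = q *\<^sub>R b + t *\<^sub>R c" using plane_elem by blast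
  then have "x = p *\<^sub>R a + q *\<^sub>R b + t *\<^sub>R c" by (simp add: algebra_simps)
  then show "\<exists>p q t. x = p *\<^sub>R a + q *\<^sub>R b + t *\<^sub>R c" by blast
qed (auto intro!: span_add span_scale intro: span_base)

text \<open>A further canonical root has nonpositive products with all three. Depending on the sign
  of the Gram determinant, this contradicts its positivity or its norm 1.\<close>

lemma canonical_triple:
  assumes U: "subspace U" "U \<subseteq> span {r, r', \<kappa>}"
    and can: "r \<in> canonical U" "r' \<in> canonical U" "\<kappa> \<in> canonical U" "r \<noteq> r'" "\<kappa> \<noteq> r" "\<kappa> \<noteq> r'"
    and B: "B r r' = - c" "B \<kappa> r = 0" "B \<kappa> r' = - j" "c < 1" "j < 1"
  shows "canonical U = {r, r', \<kappa>}"
proof -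
  have cj: "0 \<le> c" "0 \<le> j" using canonical_B_le_0[OF U(1)] can B by (metis neg_le_0_iff_le)+
  have l: "0 < lam r" "0 < lam r'" "0 < lam \<kappa>" "r \<in> roots" "r' \<in> roots" "\<kappa> \<in> roots"
    using can canonical_sub_pos by (auto simp: sub_pos_def)
  have "x \<in> {r, r', \<kappa>}" if x: "x \<in> canonical U" for x
  proof (rule ccontr)
    assume nx: "x \<notin> {r, r', \<kappa>}"
    have xr: "x \<in> roots" "0 < lam x" "x \<in> U" using x canonical_sub_pos by (auto simp: sub_pos_def)
    obtain p q t where pqt: "x = p *\<^sub>R r + q *\<^sub>R r' + t *\<^sub>R \<kappa>" using xr(3) U(2) space_elem by blast
    define b1 b2 b3 where "b1 = B x r" and "b2 = B x r'" and "b3 = B x \<kappa>"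
    have b: "b1 \<le> 0" "b2 \<le> 0" "b3 \<le> 0"
      using canonical_B_le_0[OF U(1) x] can nx by (auto simp: b1_def b2_def b3_def)
    have e1: "b1 = p - c * q"
      using B B_sym[of r' r] l by (simp add: b1_def pqt B_simps)
    have e2: "b2 = q - c * p - j * t"
      using B l by (simp add: b2_def pqt B_simps)
    have e3: "b3 = t - j * q"
      using B B_sym[of r \<kappa>] B_sym[of r' \<kappa>] l by (simp add: b3_def pqt B_simps)
    have "B x x = p * b1 + q * b2 + t * b3"
      unfolding b1_def b2_def b3_def by (subst (1) pqt) (simp add: B_simps B_sym)
    then have e4: "p * b1 + q * b2 + t * b3 = 1" using xr by simp
    have e5: "0 < p * lam r + q * lam r' + t * lam \<kappa>" using xr(2) by (simp add: pqt lam_simps)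
    \<comment> \<open>Gram determinant of the three roots. The next identities are Cramer's rule;
      their coefficients are nonnegative, so \<open>p * D\<close>, \<open>q * D\<close> and
      \<open>t * D\<close> are nonpositive.\<close>
    define D where "D = 1 - c\<^sup>2 - j\<^sup>2"
    have qD: "q * D = b2 + c * b1 + j * b3" by (simp add: e1 e2 e3 D_def power2_eq_square algebra_simps)
    have pD: "p * D = (1 - j\<^sup>2) * b1 + c * b2 + c * j * b3" by (simp add: e1 e2 e3 D_def power2_eq_square algebra_simps)
    have tD: "t * D = (1 - c\<^sup>2) * b3 + j * b2 + c * j * b1" by (simp add: e1 e2 e3 D_def power2_eq_square algebra_simps)
    have j1: "0 < 1 - j\<^sup>2" "0 < 1 - c\<^sup>2" using cj B by (simp_all add: abs_square_less_1)
    have le: "q * D \<le> 0" "p * D \<le> 0" "t * D \<le> 0"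
      unfolding qD pD tD using b cj j1 by (auto intro!: add_nonpos_nonpos mult_nonneg_nonpos)
    show False
    proof (cases D "0::real" rule: linorder_cases)
      case less
      then have "0 \<le> p" "0 \<le> q" "0 \<le> t" using le by (auto simp: mult_le_0_iff)
      then have "p * b1 + q * b2 + t * b3 \<le> 0" using b by (auto intro!: add_nonpos_nonpos mult_nonneg_nonpos)
      then show False using e4 by simp
    next
      case greater
      then have "p \<le> 0" "q \<le> 0" "t \<le> 0" using le by (auto simp: mult_le_0_iff)
      then have "p * lam r + q * lam r' + t * lam \<kappa> \<le> 0"
        using l by (auto intro!: add_nonpos_nonpos mult_nonpos_nonneg)
      then show False using e5 by simp
    next
      case equal
      have "b2 + c * b1 + j * b3 = 0" using qD equal by simp
      moreover have "c * b1 \<le> 0" "j * b3 \<le> 0" using b cj by (auto intro: mult_nonneg_nonpos)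
      ultimately have z: "b2 = 0" "c * b1 = 0" "j * b3 = 0" using b by linarith+
      have "c \<noteq> 0" "j \<noteq> 0" using equal j1 by (auto simp: D_def)
      then have "b1 = 0" "b3 = 0" using z by auto
      then show False using e4 z by simp
    qed
  qed
  then show ?thesis using can by blast
qed

text \<open>The values 0 and 1/2 are cos(pi/2) and cos(pi/3), and 1/2 bounds cos^2(pi/k) for k at
  least 4.\<close>

lemma canonical_value:
  assumes "subspace U" "\<delta>1 \<in> canonical U" "\<delta>2 \<in> canonical U" "\<delta>1 \<noteq> \<delta>2" "B \<delta>1 \<delta>2 = - i"
  shows "0 \<le> i" "i = 0 \<or> i = 1 / 2 \<or> 1 / 2 \<le> i\<^sup>2" "3 / 4 < i\<^sup>2 \<Longrightarrow> 1 \<le> 2 * i * (2 * i\<^sup>2 - 1)"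
proof -
  show i: "0 \<le> i" using canonical_B_le_0[OF assms(1-4)] assms(5) by simp
  have "0 \<le> chebyshev_U i (Suc k)" if "0 < chebyshev_U i k" for k
    using chebyshev_U_canonical[OF assms(1-4), of k] assms(5) that by simp
  from chebyshev_U_discrete[OF i this]
  show "i = 0 \<or> i = 1 / 2 \<or> 1 / 2 \<le> i\<^sup>2" "3 / 4 < i\<^sup>2 \<Longrightarrow> 1 \<le> 2 * i * (2 * i\<^sup>2 - 1)" by blast+
qed

lemma canonical_negative:
  assumes "subspace U" "g \<in> carrier W" "\<xi> \<in> sub_pos U" "lam (act g \<xi>) < 0"
  shows "\<exists>\<delta>\<in>canonical U. lam (act g \<delta>) < 0"
proof -
  have "\<xi> \<in> inv_set (inv g)" "\<xi> \<in> U" using assms by (auto simp: inv_set_def sub_pos_def)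
  then obtain \<delta> where "\<delta> \<in> canonical U" "\<delta> \<in> inv_set (inv g)" using canonical_inversion[OF assms(1)] assms(2) by (metis inv_closed)
  then show ?thesis using assms(2) by (auto simp: inv_set_def)
qed

text \<open>For c^2 < 3/4 the form is positive definite on the span, as completing squares shows,
  while a product at most -1 would make x + y a nonzero vector of nonpositive norm.\<close>

lemma posdef_triple:
  assumes r: "r1 \<in> roots" "r2 \<in> roots" "\<kappa> \<in> roots"
    and B: "B r1 r2 = - c" "B \<kappa> r1 = 0" "B \<kappa> r2 = - (1 / 2)" "c\<^sup>2 < 3 / 4"
    and x: "x \<in> roots" "0 < lam x" "x \<in> span {r1, r2, \<kappa>}"
    and y: "y \<in> roots" "0 < lam y" "y \<in> span {r1, r2, \<kappa>}"
  shows "- 1 < B x y"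
proof (rule ccontr)
  assume n: "\<not> - 1 < B x y"
  obtain p q t where u: "x + y = p *\<^sub>R r1 + q *\<^sub>R r2 + t *\<^sub>R \<kappa>"
    using span_add[OF x(3) y(3)] space_elem by blast
  have "B (x + y) (x + y) = 2 + 2 * B x y" using x y B_sym[of y x] by (simp add: B_simps)
  moreover have "B (x + y) (x + y) = p\<^sup>2 + q\<^sup>2 + t\<^sup>2 - 2 * c * p * q - q * t"
    unfolding u using r B B_sym[of r2 r1] B_sym[of r1 \<kappa>] B_sym[of r2 \<kappa>]
    by (simp add: B_simps power2_eq_square algebra_simps)
  moreover have "p\<^sup>2 + q\<^sup>2 + t\<^sup>2 - 2 * c * p * q - q * t = (t - q / 2)\<^sup>2 + (p - c * q)\<^sup>2 + (3 / 4 - c\<^sup>2) * q\<^sup>2"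
    by (simp add: power2_eq_square field_simps)
  ultimately have le: "(t - q / 2)\<^sup>2 + (p - c * q)\<^sup>2 + (3 / 4 - c\<^sup>2) * q\<^sup>2 \<le> 0" using n by linarith
  have nn: "0 \<le> (t - q / 2)\<^sup>2" "0 \<le> (p - c * q)\<^sup>2" "0 \<le> (3 / 4 - c\<^sup>2) * q\<^sup>2" using B by simp_all
  then have "(3 / 4 - c\<^sup>2) * q\<^sup>2 = 0" "(p - c * q)\<^sup>2 = 0" "(t - q / 2)\<^sup>2 = 0" using le by linarith+
  moreover from calculation(1) have "q = 0" using B by simp
  ultimately have "q = 0" "p = 0" "t = 0" by simp_all
  then have "lam (x + y) = 0" using u by (simp add: lam_simps)
  then show False using x y by (simp add: lam_simps)
qed

text \<open>
  Transport to the position where the two canonical roots of the plane are canonical in the rank three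
  subsystem \<open>U\<close>. Here \<open>z\<close> is the element transporting back, and \<open>- z \<mu>\<close> is a root dominated by
  \<open>z r\<close>; the third canonical root \<open>\<kappa>\<close>, or one of its first few images under the rank three
  reflection group, then yields a root dominated by \<open>z \<gamma>\<close>. The delicate cases are those of the Coxeter
  diagrams with labels 3 and \<open>k \<ge> 6\<close>; four reflections are needed for the affine diagram with
  labels 3 and 6.
\<close>

lemma bipodal_core:
  assumes U: "subspace U" "U \<subseteq> span {r, r', \<mu>}"
    and can: "r \<in> canonical U" "r' \<in> canonical U" "r \<noteq> r'" and Brr': "B r r' = - c" "c < 1"
    and z: "z \<in> carrier W" "0 < lam (act z r)" "0 < lam (act z r')"
    and \<mu>: "\<mu> \<in> sub_pos U" "lam (act z \<mu>) < 0" "B \<mu> r \<le> - 1"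
    and ab: "1 \<le> a" "1 \<le> b" "0 < c"
      "a = 1 \<and> b = 2 * c \<or> a = 2 * c \<and> b = 1 \<or>
       a = 2 * c \<and> b = 4 * c\<^sup>2 - 1 \<and> 2 * c \<le> b \<or> a = 4 * c\<^sup>2 - 1 \<and> b = 2 * c \<and> 2 * c \<le> a \<or>
       0 < 4 * c\<^sup>2 - 1 \<and> 4 * c\<^sup>2 - 1 \<le> a \<and> 4 * c\<^sup>2 - 1 \<le> b \<and> 2 * c \<le> a \<and> 2 * c \<le> b"
    and \<gamma>: "\<gamma> = a *\<^sub>R r + b *\<^sub>R r'"
  shows "\<exists>\<nu>\<in>roots. 0 < lam \<nu> \<and> lam (act z \<nu>) < 0 \<and> B \<nu> \<gamma> \<le> - 1"
\<comment> \<open>Here \<gamma> is the reflection of \<open>r\<close> in \<open>r'\<close>, so \<mu>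
  itself or its reflection in \<open>r'\<close> is the required root.\<close>
proof (cases "a = 1 \<and> b = 2 * c")
  case True
  have rt: "r \<in> roots" "r' \<in> roots" "0 < lam r" "0 < lam r'" and m: "\<mu> \<in> roots" "0 < lam \<mu>"
    using can \<mu> canonical_sub_pos by (auto simp: sub_pos_def)
  show ?thesis
  proof (cases "B \<mu> r' \<le> 0")
    case neg: True
    have "2 * c * B \<mu> r' \<le> 0" using neg ab(3) by (simp add: mult_nonneg_nonpos)
    then have "B \<mu> \<gamma> \<le> - 1" using \<mu>(3) True by (simp add: \<gamma> B_simps)
    then show ?thesis using m \<mu>(2) by blast
  next
    case False
    define \<nu> where "\<nu> = act (root_reflection r') \<mu>"
    have "\<mu> \<noteq> r'" using \<mu>(2) z(3) by auto
    then have "\<nu> \<in> sub_pos U" unfolding \<nu>_def using canonical_permutes[OF U(1) can(2) \<mu>(1)] by blast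
    then have "\<nu> \<in> roots" "0 < lam \<nu>" by (auto simp: sub_pos_def)
    moreover have "0 < B \<mu> r' * lam (act z r')" using False z by simp
    then have "lam (act z \<nu>) < 0"
      using \<mu>(2) z rt B_sym[of r' \<mu>] by (simp add: \<nu>_def act_root_reflection_apply act_diff act_scale lam_simps)
    moreover have "B \<nu> \<gamma> = B \<mu> r"
      using True rt Brr' B_sym[of r' \<mu>] B_sym[of r' r]
      by (simp add: \<nu>_def \<gamma> act_root_reflection_apply B_simps algebra_simps)
    ultimately show ?thesis using \<mu>(3) by auto
  qed
next
  case False
  have rt: "r \<in> roots" "r' \<in> roots" "0 < lam r" "0 < lam r'" "r \<in> U" "r' \<in> U"
    and m: "\<mu> \<in> roots" "0 < lam \<mu>" "\<mu> \<in> U"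
    using can \<mu> canonical_sub_pos by (auto simp: sub_pos_def)
  \<comment> \<open>The positive root \<mu> becomes negative under \<open>z\<close> although
    \<open>r\<close> and \<open>r'\<close> do not, so there is a third canonical root that
    does.\<close>
  obtain \<kappa> where \<kappa>: "\<kappa> \<in> canonical U" "lam (act z \<kappa>) < 0"
    using canonical_negative[OF U(1) z(1) \<mu>(1,2)] by blast
  have \<kappa>r: "\<kappa> \<in> roots" "0 < lam \<kappa>" "\<kappa> \<in> U" "\<kappa> \<noteq> r" "\<kappa> \<noteq> r'"
    using \<kappa> z canonical_sub_pos by (auto simp: sub_pos_def)
  define i j where "i = - B \<kappa> r" and "j = - B \<kappa> r'"
  have G: "B r r = 1" "B r' r' = 1" "B \<kappa> \<kappa> = 1" "B r r' = - c" "B r' r = - c" "B \<kappa> r = - i" "B r \<kappa> = - i"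
      "B \<kappa> r' = - j" "B r' \<kappa> = - j"
    using rt \<kappa>r Brr' B_sym[of r' r] B_sym[of r \<kappa>] B_sym[of r' \<kappa>] by (auto simp: i_def j_def)
  note iv = canonical_value[OF U(1) \<kappa>(1) can(1) \<kappa>r(4) G(6)]
  note jv = canonical_value[OF U(1) \<kappa>(1) can(2) \<kappa>r(5) G(8)]
  note cv = canonical_value[OF U(1) can(1-3) G(4)]
  have by_\<kappa>: ?thesis if "1 \<le> a * i + b * j"
    using that \<kappa> \<kappa>r by (intro bexI[of _ \<kappa>]) (auto simp: \<gamma> B_simps G)
  \<comment> \<open>The value 1/2 would leave only a = b = 1, which belongs to the case already
    settled.\<close>
  have c12: "1 / 2 \<le> c\<^sup>2"
  proof -
    have "c \<noteq> 1 / 2"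
    proof
      assume c: "c = 1 / 2"
      have "4 * c\<^sup>2 - 1 = 0" unfolding c by (simp add: power2_eq_square)
      then show False using False ab c by auto
    qed
    then show ?thesis using cv(2) ab(3) by auto
  qed
  have ind: "independent {\<kappa>, r, r'}"
  proof -
    have "\<kappa> \<notin> span {r, r'}"
    proof
      assume "\<kappa> \<in> span {r, r'}"
      then obtain p q where pq: "\<kappa> = p *\<^sub>R r + q *\<^sub>R r'" using plane_elem by blast
      have "0 \<le> p \<and> 0 \<le> q" by (rule plane_coherent[OF U(1) can \<kappa>r(1,2) pq])
      then have "0 \<le> lam (act z \<kappa>)" using z by (simp add: pq act_add act_scale lam_simps)
      then show False using \<kappa>(2) by simp
    qed
    then show ?thesis using independent_canonical[OF U(1) can] \<kappa>r by (simp add: independent_insert)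
  qed
  have "span {r, r', \<mu>} \<subseteq> span {\<kappa>, r, r'}"
  proof (rule span_exchange)
    show "card {r, r', \<mu>} \<le> card {\<kappa>, r, r'}" using can(3) \<kappa>r by (simp add: card_insert_if)
  qed (use ind U(2) rt \<kappa>r in auto)
  then have U': "U \<subseteq> span {r, r', \<kappa>}" "U \<subseteq> span {r', r, \<kappa>}" using U(2) by (auto simp: insert_commute)
  define s where "s \<delta> v = v - (2 * B \<delta> v) *\<^sub>R \<delta>" for \<delta> v
  have sact: "act (root_reflection \<delta>) v = s \<delta> v" if "\<delta> \<in> roots" for \<delta> v
    using that by (simp add: s_def act_root_reflection_apply)
  have sroot: "s \<delta> v \<in> roots" if "\<delta> \<in> roots" "v \<in> roots" for \<delta> v
    using root_act[of v "root_reflection \<delta>"] that by (simp add: sact)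
  have ss: "s \<delta> (s \<delta> v) = v" if "\<delta> \<in> roots" for \<delta> v
    using that by (simp add: s_def B_simps)
  have slin: "s \<delta> (u + v) = s \<delta> u + s \<delta> v" "s \<delta> (k *\<^sub>R v) = k *\<^sub>R s \<delta> v" "s \<delta> (- v) = - s \<delta> v" "s \<delta> (u - v) = s \<delta> u - s \<delta> v" for \<delta> u v k
    by (simp_all add: s_def B_simps algebra_simps)
  have s_val: "s r r = - r" "s r' r' = - r'" "s \<kappa> \<kappa> = - \<kappa>" "s r r' = r' + (2 * c) *\<^sub>R r" "s r' r = r + (2 * c) *\<^sub>R r'"
      "s \<kappa> r = r + (2 * i) *\<^sub>R \<kappa>" "s r \<kappa> = \<kappa> + (2 * i) *\<^sub>R r" "s \<kappa> r' = r' + (2 * j) *\<^sub>R \<kappa>" "s r' \<kappa> = \<kappa> + (2 * j) *\<^sub>R r'"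
    by (simp_all add: s_def G scaleR_2)
  \<comment> \<open>One transport step: the image of the reflected root under the new group element
    is unchanged, so a canonical root with negative image exists again. Excluding all but one
    candidate identifies the next root to test.\<close>
  have nxt: "s \<delta> \<xi> \<in> sub_pos U \<and> g \<otimes> root_reflection \<delta> \<in> carrier W \<and> lam (act (g \<otimes> root_reflection \<delta>) (s \<delta> \<xi>)) < 0 \<and>
      (\<forall>v. act (g \<otimes> root_reflection \<delta>) v = act g (s \<delta> v))"
    if g: "g \<in> carrier W" and \<xi>: "\<xi> \<in> sub_pos U" "lam (act g \<xi>) < 0" and \<delta>: "\<delta> \<in> canonical U" "\<xi> \<noteq> \<delta>" for g \<xi> \<delta>
  proof -
    have \<delta>r: "\<delta> \<in> roots" using \<delta>(1) canonical_sub_pos by (auto simp: sub_pos_def)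
    show ?thesis
      using canonical_permutes[OF U(1) \<delta>(1) \<xi>(1) \<delta>(2)] g \<xi>(2) \<delta>r by (simp add: sact act_mult ss)
  qed
  have lamz: "0 \<le> lam (act z r)" "0 \<le> lam (act z r')" using z by auto
  have witness: ?thesis if "\<nu> \<in> roots" "0 < lam \<nu>" "lam (act z \<nu>) < 0" "B \<nu> \<gamma> \<le> - 1" for \<nu>
    using that by blast
  consider (both) "1 / 2 \<le> i" "1 / 2 \<le> j" | (i0) "i = 0" | (j0) "j = 0" "i \<noteq> 0"
  proof -
    have "1 / 2 \<le> x" if "0 \<le> x" "1 / 2 \<le> x\<^sup>2" for x :: real
    proof (rule ccontr)
      assume "\<not> 1 / 2 \<le> x"
      then have "x\<^sup>2 \<le> (1 / 2)\<^sup>2" using that(1) by (intro power_mono) auto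
      then show False using that(2) by (simp add: power2_eq_square)
    qed
    then show ?thesis using that iv(1,2) jv(1,2) by (metis order_refl)
  qed
  then show ?thesis
  proof cases
    case both
    have "1 * (1 / 2) \<le> a * i" "1 * (1 / 2) \<le> b * j" using both ab by (intro mult_mono; simp)+
    then show ?thesis by (intro by_\<kappa>) linarith
  next
    case i0
    show ?thesis
    proof (cases "1 \<le> b * j")
      case True
      then show ?thesis using by_\<kappa> i0 by simp
    next
      case bj: False
      then have j1: "j < 1"
      proof -
        have "1 * j \<le> b * j" using ab(2) jv(1) by (intro mult_right_mono)
        then show ?thesis using bj by simp
      qed
      have canU: "canonical U = {r, r', \<kappa>}"
        using canonical_triple[OF U(1) U'(1) can(1,2) \<kappa>(1) can(3) \<kappa>r(4,5)] G i0 Brr'(2) j1 by simp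
      have hit: "lam (act g r) < 0 \<or> lam (act g r') < 0 \<or> lam (act g \<kappa>) < 0"
        if "g \<in> carrier W" "\<xi> \<in> sub_pos U" "lam (act g \<xi>) < 0" for g \<xi>
        using canonical_negative[OF U(1) that] by (auto simp: canU)
      have "\<mu> \<noteq> \<kappa>" using \<mu>(3) G(6) i0 by auto
      note n1 = nxt[OF z(1) \<mu>(1,2) \<kappa>(1) this]
      define g1 \<xi>1 where "g1 = z \<otimes> root_reflection \<kappa>" and "\<xi>1 = s \<kappa> \<mu>"
      have 1: "g1 \<in> carrier W" "\<xi>1 \<in> sub_pos U" "lam (act g1 \<xi>1) < 0" "\<And>v. act g1 v = act z (s \<kappa> v)"
        using n1 by (auto simp: g1_def \<xi>1_def)
      define \<nu>1 where "\<nu>1 = s \<kappa> r'"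
      \<comment> \<open>Under \<open>g1\<close> the image of \<open>r\<close> is unchanged and that
        of \<kappa> changes sign, so only \<open>r'\<close> can have a negative image.\<close>
      have z1: "lam (act z \<nu>1) < 0"
        using hit[OF 1(1-3)] lamz \<kappa>(2) z(1) i0 by (auto simp: 1(4) s_val \<nu>1_def act_minus lam_simps)
      have \<nu>1: "\<nu>1 \<in> roots" "0 < lam \<nu>1" "\<nu>1 = r' + (2 * j) *\<^sub>R \<kappa>"
        using sroot[OF \<kappa>r(1) rt(2)] rt \<kappa>r jv(1) by (auto simp: \<nu>1_def s_val lam_simps intro!: add_pos_nonneg)
      have j_nz: "j \<noteq> 0" using z1 lamz \<nu>1(3) by auto
      have B1: "B \<nu>1 \<gamma> = b - a * c - 2 * j\<^sup>2 * b"
        using i0 by (simp add: \<nu>1(3) \<gamma> B_simps G power2_eq_square algebra_simps)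
      show ?thesis
      proof (cases "j = 1 / 2")
        case False
        then have j2: "1 / 2 \<le> j\<^sup>2" using jv(2) j_nz by auto
        show ?thesis
        proof (cases "2 * c \<le> b")
          case True
          have "1 * 1 \<le> (4 * c\<^sup>2) * j\<^sup>2 * 1"
          proof -
            have "2 * (1 / 2) \<le> (4 * c\<^sup>2) * j\<^sup>2" using c12 j2 by (intro mult_mono) auto
            then show ?thesis by simp
          qed
          then have "1\<^sup>2 \<le> (2 * c * j)\<^sup>2" by (simp add: power_mult_distrib)
          then have "1 \<le> 2 * c * j" using ab(3) jv(1) by (intro power2_le_imp_le[of 1]) auto
          also have "\<dots> \<le> b * j" using True jv(1) by (intro mult_right_mono)
          finally show ?thesis using bj by simp
        next
          case False
          then have "a = 2 * c" "b = 1" using ab(4) \<open>\<not> (a = 1 \<and> b = 2 * c)\<close> by auto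
          then have "B \<nu>1 \<gamma> \<le> - 1" using c12 j2 B1 by (simp add: power2_eq_square)
          then show ?thesis using witness \<nu>1 z1 by blast
        qed
      next
        case True
        \<comment> \<open>Below 3/4 the diagram is of finite type, which rules out the product of
          \<mu> and \<open>r\<close>.\<close>
        have c34: "3 / 4 \<le> c\<^sup>2"
        proof (rule ccontr)
          assume "\<not> 3 / 4 \<le> c\<^sup>2"
          then have "- 1 < B \<mu> r"
            using posdef_triple[OF rt(1,2) \<kappa>r(1) G(4), of \<mu> r] G i0 True m rt U'(1) by auto
          then show False using \<mu>(3) by simp
        qed
        have "b < 2" using bj True by simp
        then consider "a = 2 * c" "b = 1" | "a = 4 * c\<^sup>2 - 1" "b = 2 * c"
          using ab(4) False c34 by auto
        then show ?thesis
        proof cases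
          case 1
          then have "B \<nu>1 \<gamma> \<le> - 1" using B1 c34 True by (simp add: power2_eq_square)
          then show ?thesis using witness \<nu>1 z1 by blast
        next
          case 2
          then have B1': "B \<nu>1 \<gamma> = - (2 * c * (2 * c\<^sup>2 - 1))" unfolding B1 2 True by (simp add: power2_eq_square algebra_simps)
          show ?thesis
          \<comment> \<open>Above 3/4 the bound from \<open>canonical_value\<close> suffices;
            equality is the affine diagram, where one more reflection is used.\<close>
          proof (cases "3 / 4 < c\<^sup>2")
            case True
            then show ?thesis using witness \<nu>1 z1 B1' cv(3) by simp
          next
            case False
            then have c2: "c\<^sup>2 = 3 / 4" using c34 by simp
            have "\<xi>1 \<noteq> r'"
            proof
              assume "\<xi>1 = r'"
              then have "\<mu> = \<nu>1" using ss[OF \<kappa>r(1), of \<mu>] by (simp add: \<xi>1_def \<nu>1_def)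
              then show False using \<mu>(3) Brr'(2) i0 by (simp add: \<nu>1(3) B_simps G)
            qed
            note n2 = nxt[OF 1(1-3) can(2) this]
            define g2 \<xi>2 where "g2 = g1 \<otimes> root_reflection r'" and "\<xi>2 = s r' \<xi>1"
            have 2: "g2 \<in> carrier W" "\<xi>2 \<in> sub_pos U" "lam (act g2 \<xi>2) < 0" "\<And>v. act g2 v = act z (s \<kappa> (s r' v))"
              using n2 1(4) by (auto simp: g2_def \<xi>2_def)
            define \<nu>2 where "\<nu>2 = s \<kappa> (s r' r)"
            have "s \<kappa> (s r' \<kappa>) = r'" by (simp add: s_val slin \<open>j = 1 / 2\<close>)
            moreover have "s \<kappa> (s r' r') = - \<nu>1" by (simp add: s_val slin \<nu>1_def)
            ultimately have z2: "lam (act z \<nu>2) < 0"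
              using hit[OF 2(1-3)] lamz z(1) z1 by (auto simp: 2(4) \<nu>2_def act_minus lam_simps)
            have \<nu>2r: "\<nu>2 \<in> roots"
              using sroot rt \<kappa>r by (simp add: \<nu>2_def)
            have \<nu>2e: "\<nu>2 = r + (2 * c) *\<^sub>R r' + (2 * c) *\<^sub>R \<kappa>"
              using i0 by (simp add: \<nu>2_def s_val slin \<open>j = 1 / 2\<close> algebra_simps)
            have \<nu>2p: "0 < lam \<nu>2"
              using rt \<kappa>r ab(3) by (auto simp: \<nu>2e lam_simps intro!: add_pos_nonneg)
            note \<nu>2 = \<nu>2r \<nu>2p \<nu>2e
            have "B \<nu>2 \<gamma> = a * (1 - 2 * c\<^sup>2)"
              using i0 \<open>j = 1 / 2\<close> by (simp add: \<nu>2(3) \<gamma> B_simps G power2_eq_square algebra_simps)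
            then have "B \<nu>2 \<gamma> \<le> - 1" using c2 \<open>a = 4 * c\<^sup>2 - 1\<close> by simp
            then show ?thesis using witness \<nu>2 z2 by blast
          qed
        qed
      qed
    qed
  next
    case j0
    show ?thesis
    proof (cases "1 \<le> a * i")
      case True
      then show ?thesis using by_\<kappa> j0 by simp
    next
      case ai: False
      then have i1: "i < 1"
      proof -
        have "1 * i \<le> a * i" using ab(1) iv(1) by (intro mult_right_mono)
        then show ?thesis using ai by simp
      qed
      have "canonical U = {r', r, \<kappa>}"
        using canonical_triple[OF U(1) U'(2) can(2,1) \<kappa>(1) can(3)[symmetric] \<kappa>r(5,4)] G j0 Brr'(2) i1 by simp
      then have canU: "canonical U = {r, r', \<kappa>}" by auto
      have hit: "lam (act g r) < 0 \<or> lam (act g r') < 0 \<or> lam (act g \<kappa>) < 0"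
        if "g \<in> carrier W" "\<xi> \<in> sub_pos U" "lam (act g \<xi>) < 0" for g \<xi>
        using canonical_negative[OF U(1) that] by (auto simp: canU)
      \<comment> \<open>With \<open>i\<^sup>2\<close> and \<open>c\<^sup>2\<close> at least 1/2, the
        product 2 c i would be at least 1, and \<kappa> itself would already do.\<close>
      have i12: "i = 1 / 2"
      proof (rule ccontr)
        assume "i \<noteq> 1 / 2"
        then have i2: "1 / 2 \<le> i\<^sup>2" using iv(2) j0 by auto
        have "2 * c \<le> a" using ab(4) \<open>\<not> (a = 1 \<and> b = 2 * c)\<close> by auto
        have "2 * (1 / 2) \<le> (4 * c\<^sup>2) * i\<^sup>2" using c12 i2 by (intro mult_mono) auto
        then have "1\<^sup>2 \<le> (2 * c * i)\<^sup>2" by (simp add: power_mult_distrib)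
        then have "1 \<le> 2 * c * i" using ab(3) iv(1) by (intro power2_le_imp_le[of 1]) auto
        also have "\<dots> \<le> a * i" using \<open>2 * c \<le> a\<close> iv(1) by (intro mult_right_mono)
        finally show False using ai by simp
      qed
      have c34: "3 / 4 \<le> c\<^sup>2"
      proof (rule ccontr)
        assume "\<not> 3 / 4 \<le> c\<^sup>2"
        then have "- 1 < B \<mu> r"
          using posdef_triple[OF rt(2,1) \<kappa>r(1) G(5), of \<mu> r] G j0 i12 m rt U'(2) by auto
        then show False using \<mu>(3) by simp
      qed
      have "a < 2" using ai i12 by simp
      then consider "a = 2 * c" "b = 1" | "a = 2 * c" "b = 4 * c\<^sup>2 - 1"
        using ab(4) False c34 by auto
      note cases_ab = this
      have cc: "c * c = c\<^sup>2" by (simp add: power2_eq_square)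
      have "\<mu> \<noteq> \<kappa>" using \<mu>(3) G(6) i12 by auto
      note n1 = nxt[OF z(1) \<mu>(1,2) \<kappa>(1) this]
      define g1 \<xi>1 where "g1 = z \<otimes> root_reflection \<kappa>" and "\<xi>1 = s \<kappa> \<mu>"
      have 1: "g1 \<in> carrier W" "\<xi>1 \<in> sub_pos U" "lam (act g1 \<xi>1) < 0" "\<And>v. act g1 v = act z (s \<kappa> v)"
        using n1 by (auto simp: g1_def \<xi>1_def)
      have sv: "s \<kappa> r = r + \<kappa>" "s r \<kappa> = r + \<kappa>" "s \<kappa> r' = r'" "s r' \<kappa> = \<kappa>"
        by (simp_all add: s_val i12 j0)
      define \<nu>1 where "\<nu>1 = s \<kappa> r"
      have z1: "lam (act z \<nu>1) < 0"
        using hit[OF 1(1-3)] lamz \<kappa>(2) z(1) by (auto simp: 1(4) s_val(1-3) sv(3) \<nu>1_def act_minus lam_simps)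
      have \<nu>1: "\<nu>1 \<in> roots" "\<nu>1 = r + \<kappa>"
        using sroot[OF \<kappa>r(1) rt(1)] by (auto simp: \<nu>1_def sv)
      have "\<xi>1 \<noteq> r"
      proof
        assume "\<xi>1 = r"
        then have "\<mu> = \<nu>1" using ss[OF \<kappa>r(1), of \<mu>] by (simp add: \<xi>1_def \<nu>1_def)
        then show False using \<mu>(3) i12 by (simp add: \<nu>1(2) B_simps G)
      qed
      note n2 = nxt[OF 1(1-3) can(1) this]
      define g2 \<xi>2 where "g2 = g1 \<otimes> root_reflection r" and "\<xi>2 = s r \<xi>1"
      have 2: "g2 \<in> carrier W" "\<xi>2 \<in> sub_pos U" "lam (act g2 \<xi>2) < 0" "\<And>v. act g2 v = act z (s \<kappa> (s r v))"
        using n2 1(4) by (auto simp: g2_def \<xi>2_def)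
      define \<nu>2 where "\<nu>2 = s \<kappa> (s r r')"
      have sr\<kappa>: "s \<kappa> (s r \<kappa>) = r" by (simp add: sv slin s_val(3))
      have z2: "lam (act z \<nu>2) < 0"
        using hit[OF 2(1-3)] lamz z(1) z1 sr\<kappa>
        by (auto simp: 2(4) \<nu>2_def s_val(1) slin \<nu>1_def[symmetric] act_minus lam_simps)
      have \<nu>2r: "\<nu>2 \<in> roots"
        using sroot rt \<kappa>r by (simp add: \<nu>2_def)
      have \<nu>2e: "\<nu>2 = r' + (2 * c) *\<^sub>R r + (2 * c) *\<^sub>R \<kappa>"
        by (simp add: \<nu>2_def s_val(4) sv slin algebra_simps)
      have \<nu>2p: "0 < lam \<nu>2"
        using rt \<kappa>r ab(3) by (auto simp: \<nu>2e lam_simps intro!: add_pos_nonneg)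
      note \<nu>2 = \<nu>2r \<nu>2p \<nu>2e
      have v3g: "s \<kappa> (s r (s r' r)) = (4 * c\<^sup>2 - 1) *\<^sub>R (r + \<kappa>) + (2 * c) *\<^sub>R r'"
        by (simp add: s_val(1,4,5) sv slin algebra_simps power2_eq_square)
      show ?thesis
      proof (cases "3 / 4 < c\<^sup>2")
        case big: True
        note c7 = cv(3)[OF big]
        show ?thesis
        proof (rule cases_ab)
          assume a: "a = 2 * c" and b: "b = 4 * c\<^sup>2 - 1"
          have "c + b * c = 4 * c * c * c"
            unfolding b by (simp add: power2_eq_square algebra_simps)
          with a have "B \<nu>1 \<gamma> = - (2 * c * (2 * c\<^sup>2 - 1))"
            using i12 j0 by (simp add: \<nu>1(2) \<gamma> B_simps G power2_eq_square algebra_simps)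
          then show ?thesis using witness[of \<nu>1] \<nu>1 z1 c7 rt(3) \<kappa>r(2) by (simp add: lam_simps)
        next
          assume ab1: "a = 2 * c" "b = 1"
          have "\<xi>2 \<noteq> r'"
          proof
            assume "\<xi>2 = r'"
            then have "\<mu> = \<nu>2" using ss[OF \<kappa>r(1), of \<mu>] ss[OF rt(1), of \<xi>1] by (simp add: \<xi>2_def \<xi>1_def \<nu>2_def)
            then show False using \<mu>(3) i12 by (simp add: \<nu>2(3) B_simps G)
          qed
          note n3 = nxt[OF 2(1-3) can(2) this]
          define g3 where "g3 = g2 \<otimes> root_reflection r'"
          have 3: "g3 \<in> carrier W" "s r' \<xi>2 \<in> sub_pos U" "lam (act g3 (s r' \<xi>2)) < 0"
            "\<And>v. act g3 v = act z (s \<kappa> (s r (s r' v)))"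
            using n3 2(4) by (auto simp: g3_def)
          define \<nu>3 where "\<nu>3 = s \<kappa> (s r (s r' r))"
          have z3: "lam (act z \<nu>3) < 0"
            using hit[OF 3(1-3)] lamz z(1) z2 sr\<kappa>
            by (auto simp: 3(4) \<nu>3_def s_val(2) sv(4) slin \<nu>2_def[symmetric] act_minus lam_simps)
          have v3: "\<nu>3 = (4 * c\<^sup>2 - 1) *\<^sub>R (r + \<kappa>) + (2 * c) *\<^sub>R r'"
            using v3g by (simp add: \<nu>3_def)
          have "0 < lam \<nu>3" using rt \<kappa>r big ab(3) by (simp add: v3 lam_simps add_pos_pos)
          moreover have "\<nu>3 \<in> roots" using sroot rt \<kappa>r by (simp add: \<nu>3_def)
          moreover have "B \<nu>3 \<gamma> = - (2 * c * (2 * c\<^sup>2 - 1))"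
            using i12 j0 by (simp add: v3 \<gamma> ab1 B_simps G power2_eq_square algebra_simps)
          ultimately show ?thesis using witness z3 c7 by simp
        qed
      next
        case small: False
        then have c2: "c\<^sup>2 = 3 / 4" using c34 by simp
        show ?thesis
        proof (rule cases_ab)
          assume ab2: "a = 2 * c" "b = 4 * c\<^sup>2 - 1"
          have "B \<nu>2 \<gamma> = b * (1 - 2 * c\<^sup>2)"
            using i12 j0 by (simp add: \<nu>2(3) \<gamma> B_simps G power2_eq_square algebra_simps)
          then have "B \<nu>2 \<gamma> \<le> - 1" using c2 ab2 by simp
          then show ?thesis using witness \<nu>2 z2 by blast
        next
          assume ab1: "a = 2 * c" "b = 1"
          have "\<xi>2 \<noteq> r'"
          proof
            assume "\<xi>2 = r'"
            then have "\<mu> = \<nu>2" using ss[OF \<kappa>r(1), of \<mu>] ss[OF rt(1), of \<xi>1] by (simp add: \<xi>2_def \<xi>1_def \<nu>2_def)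
            then show False using \<mu>(3) i12 by (simp add: \<nu>2(3) B_simps G)
          qed
          note n3 = nxt[OF 2(1-3) can(2) this]
          define g3 \<xi>3 where "g3 = g2 \<otimes> root_reflection r'" and "\<xi>3 = s r' \<xi>2"
          have 3: "g3 \<in> carrier W" "\<xi>3 \<in> sub_pos U" "lam (act g3 \<xi>3) < 0"
            "\<And>v. act g3 v = act z (s \<kappa> (s r (s r' v)))"
            using n3 2(4) by (auto simp: g3_def \<xi>3_def)
          define \<nu>3 where "\<nu>3 = s \<kappa> (s r (s r' r))"
          have z3: "lam (act z \<nu>3) < 0"
            using hit[OF 3(1-3)] lamz z(1) z2 sr\<kappa>
            by (auto simp: 3(4) \<nu>3_def s_val(2) sv(4) slin \<nu>2_def[symmetric] act_minus lam_simps)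
          have v3: "\<nu>3 = 2 *\<^sub>R (r + \<kappa>) + (2 * c) *\<^sub>R r'"
            using v3g c2 by (simp add: \<nu>3_def)
          have "\<xi>3 \<noteq> r"
          proof
            assume "\<xi>3 = r"
            then have "\<mu> = \<nu>3" using ss[OF \<kappa>r(1), of \<mu>] ss[OF rt(1), of \<xi>1] ss[OF rt(2), of \<xi>2]
              by (simp add: \<xi>3_def \<xi>2_def \<xi>1_def \<nu>3_def)
            then show False using \<mu>(3) i12 c2 by (simp add: v3 B_simps G cc)
          qed
          note n4 = nxt[OF 3(1-3) can(1) this]
          define g4 \<xi>4 where "g4 = g3 \<otimes> root_reflection r" and "\<xi>4 = s r \<xi>3"
          have 4: "g4 \<in> carrier W" "\<xi>4 \<in> sub_pos U" "lam (act g4 \<xi>4) < 0"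
            "\<And>v. act g4 v = act z (s \<kappa> (s r (s r' (s r v))))"
            using n4 3(4) by (auto simp: g4_def \<xi>4_def)
          \<comment> \<open>The alternative \<kappa> is excluded by one more transport step, after
            which none of the three canonical roots has a negative image.\<close>
          have z4: "lam (act g4 r') < 0"
          proof (rule ccontr)
            assume nz: "\<not> lam (act g4 r') < 0"
            have g4r: "act g4 r = - act z \<nu>3" using z(1) by (simp add: 4(4) s_val(1) slin \<nu>3_def act_minus)
            then have "lam (act g4 \<kappa>) < 0" using hit[OF 4(1-3)] nz z3 by (auto simp: lam_simps)
            have "\<xi>4 \<noteq> \<kappa>"
            proof
              assume "\<xi>4 = \<kappa>"
              then have e: "\<mu> = s \<kappa> (s r (s r' (s r \<kappa>)))"
                using ss[OF \<kappa>r(1), of \<mu>] ss[OF rt(1), of \<xi>1] ss[OF rt(2), of \<xi>2] ss[OF rt(1), of \<xi>3]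
                by (simp add: \<xi>4_def \<xi>3_def \<xi>2_def \<xi>1_def)
              have "s r (s r' (s r \<kappa>)) = s r (s r' r) + (r + \<kappa>)" by (simp add: sv slin)
              then have "\<mu> = \<nu>3 + r" using e by (simp add: slin \<nu>3_def sv s_val(3))
              then have "3 \<le> 2 * c * c" using \<mu>(3) i12 c2 by (simp add: v3 B_simps G cc)
              then show False using c2 by (simp add: power2_eq_square)
            qed
            note n5 = nxt[OF 4(1-3) \<kappa>(1) this]
            define g5 where "g5 = g4 \<otimes> root_reflection \<kappa>"
            have 5: "g5 \<in> carrier W" "s \<kappa> \<xi>4 \<in> sub_pos U" "lam (act g5 (s \<kappa> \<xi>4)) < 0" "\<And>v. act g5 v = act g4 (s \<kappa> v)"
              using n5 by (auto simp: g5_def)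
            have "act g5 r = act z r"
            proof -
              have "s r (s \<kappa> r) = \<kappa>" by (simp add: sv slin s_val(1))
              then show ?thesis by (simp add: 5(4) 4(4) sv(4) sr\<kappa>)
            qed
            moreover have "act g5 \<kappa> = - act g4 \<kappa>" using 4(1) by (simp add: 5(4) s_val(3) act_minus)
            moreover have "act g5 r' = act g4 r'" by (simp add: 5(4) sv)
            ultimately show False
              using hit[OF 5(1-3)] nz lamz \<open>lam (act g4 \<kappa>) < 0\<close> by (auto simp: lam_simps)
          qed
          define \<nu>4 where "\<nu>4 = s \<kappa> (s r (s r' (s r r')))"
          have v4: "\<nu>4 = (2 * c) *\<^sub>R \<nu>3 - \<nu>2"
            by (simp add: \<nu>4_def \<nu>3_def \<nu>2_def s_val(2,4) slin)
          have v4': "\<nu>4 = (2 * c) *\<^sub>R (r + \<kappa>) + 2 *\<^sub>R r'"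
          proof -
            have "\<nu>4 = (2 * c * 2 - 2 * c) *\<^sub>R (r + \<kappa>) + (4 * c\<^sup>2 - 1) *\<^sub>R r'"
              unfolding v4 v3 \<nu>2(3) scaleR_diff_left scaleR_add_right scaleR_scaleR power2_eq_square
              by (simp add: algebra_simps)
            then show ?thesis using c2 by simp
          qed
          have "0 < lam \<nu>4" using rt \<kappa>r ab(3) by (simp add: v4' lam_simps add_pos_pos)
          moreover have "\<nu>4 \<in> roots" using sroot rt \<kappa>r by (simp add: \<nu>4_def)
          moreover have "B \<nu>4 \<gamma> \<le> - 1"
            using i12 j0 c2 by (simp add: v4' \<gamma> ab1 B_simps G cc algebra_simps)
          moreover have "lam (act z \<nu>4) < 0" using z4 by (simp add: 4(4) \<nu>4_def)
          ultimately show ?thesis using witness by blast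
        qed
      qed
    qed
  qed
qed

text \<open>If the averaged functional vanishes on \<eta> too, the subspace has only finitely many
  positive roots, and any functional separating \<eta> from the plane will do.\<close>

lemma separating_functional:
  assumes \<rho>: "\<rho> \<in> roots" and \<sigma>: "\<sigma> \<in> roots" and b: "\<bar>B \<rho> \<sigma>\<bar> < 1"
    and \<eta>: "\<eta> \<notin> span {\<rho>, \<sigma>}" and ind: "independent {\<rho>, \<sigma>}"
  obtains \<Lambda> :: "'v \<Rightarrow> real" where "linear \<Lambda>" "\<Lambda> \<rho> = 0" "\<Lambda> \<sigma> = 0" "\<Lambda> \<eta> \<noteq> 0"
    "finite {\<beta> \<in> sub_pos (span {\<rho>, \<sigma>, \<eta>}). \<Lambda> \<beta> < 0}"
proof -
  obtain \<Lambda>0 :: "'v \<Rightarrow> real" where L: "linear \<Lambda>0" "\<Lambda>0 \<rho> = 0" "\<Lambda>0 \<sigma> = 0"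
    and fin: "finite {\<delta> \<in> roots. 0 < lam \<delta> \<and> \<Lambda>0 \<delta> \<le> 0}" using posdef_functional[OF \<rho> \<sigma> b] .
  show ?thesis
  proof (cases "\<Lambda>0 \<eta> = 0")
    case False
    have "finite {\<beta> \<in> sub_pos (span {\<rho>, \<sigma>, \<eta>}). \<Lambda>0 \<beta> < 0}"
      by (rule finite_subset[OF _ fin]) (auto simp: sub_pos_def)
    then show ?thesis using that L False by blast
  next
    case True
    have zero: "\<Lambda>0 x = 0" if x: "x \<in> span {\<rho>, \<sigma>, \<eta>}" for x
    proof -
      obtain p q t where "x = p *\<^sub>R \<rho> + q *\<^sub>R \<sigma> + t *\<^sub>R \<eta>" using x space_elem by blast
      then show ?thesis by (simp add: linear_add[OF L(1)] linear_cmul[OF L(1)] L True)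
    qed
    have "finite (sub_pos (span {\<rho>, \<sigma>, \<eta>}))"
      by (rule finite_subset[OF _ fin]) (auto simp: sub_pos_def zero)
    then have fin': "finite {\<beta> \<in> sub_pos (span {\<rho>, \<sigma>, \<eta>}). \<Lambda> \<beta> < 0}" for \<Lambda> :: "'v \<Rightarrow> real" by simp
    have "independent (insert \<eta> {\<rho>, \<sigma>})" using \<eta> ind by (rule independent_insertI)
    then obtain \<Lambda> :: "'v \<Rightarrow> real" where \<Lambda>: "linear \<Lambda>" "\<forall>x\<in>insert \<eta> {\<rho>, \<sigma>}. \<Lambda> x = (if x = \<eta> then 1 else 0)"
      using linear_independent_extend[of "insert \<eta> {\<rho>, \<sigma>}" "\<lambda>x. if x = \<eta> then 1 else 0"] by auto
    have "\<eta> \<noteq> \<rho>" "\<eta> \<noteq> \<sigma>" using \<eta> by (auto intro: span_base)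
    then show ?thesis using that[OF \<Lambda>(1) _ _ _ fin'] \<Lambda>(2) by auto
  qed
qed

text \<open>The conditions on \<open>k\<close> make \<open>dihedral \<sigma> \<rho> k\<close> a
  positive combination of both canonical roots. If \<rho> dominated another positive root, so would
  this one: in an infinite plane it dominates \<sigma>, otherwise \<open>bipodal_core\<close>
  supplies the dominated root.\<close>

lemma bipodal:
  assumes can: "\<rho> \<in> canonical (span {\<rho>, \<sigma>})" "\<sigma> \<in> canonical (span {\<rho>, \<sigma>})" "\<rho> \<noteq> \<sigma>"
    and k: "0 < k" and pos: "\<And>j. \<lbrakk>0 < j; j \<le> Suc k\<rbrakk> \<Longrightarrow> 0 < chebyshev_U (- B \<sigma> \<rho>) j"
    and small: "dihedral \<sigma> \<rho> k \<in> small_roots"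
  shows "\<rho> \<in> small_roots"
proof (rule ccontr)
  assume not_small: "\<rho> \<notin> small_roots"
  define P where "P = span {\<rho>, \<sigma>}"
  have P: "subspace P" "\<rho> \<in> canonical P" "\<sigma> \<in> canonical P" using can by (simp_all add: P_def)
  have rt: "\<rho> \<in> roots" "\<sigma> \<in> roots" "0 < lam \<rho>" "0 < lam \<sigma>" "\<rho> \<in> P" "\<sigma> \<in> P"
    using P canonical_sub_pos by (auto simp: sub_pos_def)
  define c where "c = - B \<sigma> \<rho>"
  have Bc: "B \<sigma> \<rho> = - c" "B \<rho> \<sigma> = - c" using B_sym[of \<rho> \<sigma>] by (auto simp: c_def)
  define \<epsilon> where "\<epsilon> = dihedral \<sigma> \<rho> k"
  have \<epsilon>: "\<epsilon> \<in> small_roots" "\<epsilon> \<in> roots" "0 < lam \<epsilon>" using small by (auto simp: \<epsilon>_def small_iff)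
  have \<epsilon>_eq: "\<epsilon> = chebyshev_U c k *\<^sub>R \<rho> + chebyshev_U c (Suc k) *\<^sub>R \<sigma>"
    by (simp add: \<epsilon>_def dihedral_def c_def add.commute del: chebyshev_U.simps)
  have c0: "0 \<le> c" using canonical_B_le_0[OF P(1,2,3) can(3)] Bc by simp
  show False
  proof (cases "1 \<le> c")
    case True
    \<comment> \<open>This difference is the Chebyshev polynomial of the first kind; for
      \<open>n = k\<close> it is the product of \<epsilon> and \<sigma>.\<close>
    have T: "1 \<le> chebyshev_U c (Suc n) - c * chebyshev_U c n" for n
    proof (induction n)
      case (Suc n)
      have "0 \<le> chebyshev_U c n" "0 \<le> chebyshev_U c (Suc n)"
        using chebyshev_U_increasing[OF True] by (meson of_nat_0_le_iff order_trans)+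
      then have "0 \<le> (c - 1) * chebyshev_U c (Suc n) + (c - 1) * chebyshev_U c n" using True by simp
      then show ?case using Suc by (simp add: algebra_simps)
    qed simp
    have "B \<epsilon> \<sigma> = chebyshev_U c (Suc k) - c * chebyshev_U c k"
      using rt Bc by (simp add: \<epsilon>_eq B_simps del: chebyshev_U.simps)
    then have "1 \<le> B \<epsilon> \<sigma>" using T by simp
    then have dom: "dominated_by \<epsilon> \<sigma> \<or> dominated_by \<sigma> \<epsilon>" by (rule B_ge_1_comparable[OF \<epsilon>(2) rt(2) _ \<epsilon>(3)])
    have ne: "\<epsilon> \<noteq> \<sigma>"
    proof
      assume "\<epsilon> = \<sigma>"
      then have "chebyshev_U c k *\<^sub>R \<rho> + chebyshev_U c (Suc k) *\<^sub>R \<sigma> = 0 *\<^sub>R \<rho> + 1 *\<^sub>R \<sigma>" using \<epsilon>_eq by simp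
      then have "chebyshev_U c k = 0" using canonical_independent_eq[OF P(1,2,3) can(3)] by blast
      then show False using pos[of k] k by (simp add: c_def)
    qed
    have "\<epsilon> \<in> sub_pos P" using \<epsilon> rt P(1) by (auto simp: sub_pos_def \<epsilon>_eq intro!: subspace_add subspace_scale)
    then have "0 < lam (act (root_reflection \<sigma>) \<epsilon>)" using canonical_permutes[OF P(1,3)] ne by (auto simp: sub_pos_def)
    moreover have "lam (act (root_reflection \<sigma>) \<sigma>) < 0" using rt by (simp add: root_reflection_self lam_simps)
    ultimately have "\<not> dominated_by \<epsilon> \<sigma>" using rt(2) \<epsilon>(2) root_reflection_closed[OF rt(2)] by (force simp: dominated_iff)
    then have "dominated_by \<sigma> \<epsilon>" using dom by blast
    then show False using \<epsilon>(1) rt ne by (auto simp: small_iff)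
  next
    case False
    then have c1: "c < 1" "\<bar>B \<rho> \<sigma>\<bar> < 1" "- 1 < B \<sigma> \<rho>" using c0 Bc by auto
    obtain \<eta> where \<eta>: "\<eta> \<in> roots" "0 < lam \<eta>" "dominated_by \<eta> \<rho>" "\<eta> \<noteq> \<rho>"
      using not_small rt by (auto simp: small_iff)
    have B\<eta>: "1 \<le> B \<eta> \<rho>" by (rule dominated_B_ge_1[OF \<eta>(1) rt(1) \<eta>(2,3)])
    \<comment> \<open>The form is positive definite on \<open>P\<close>, while the difference of
      \<rho> and \<eta> has nonpositive norm.\<close>
    have \<eta>P: "\<eta> \<notin> P"
    proof
      assume "\<eta> \<in> P"
      then have "\<rho> - \<eta> \<in> P" using rt P(1) by (intro subspace_diff)
      then obtain p q where pq: "\<rho> - \<eta> = p *\<^sub>R \<rho> + q *\<^sub>R \<sigma>" unfolding P_def using plane_elem by blast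
      have "B (\<rho> - \<eta>) (\<rho> - \<eta>) = 2 - 2 * B \<eta> \<rho>" using rt \<eta> B_sym[of \<rho> \<eta>] by (simp add: B_simps)
      then have le: "B (\<rho> - \<eta>) (\<rho> - \<eta>) \<le> 0" using B\<eta> by simp
      have "B (\<rho> - \<eta>) (\<rho> - \<eta>) = p * p + q * q + 2 * (p * q * B \<rho> \<sigma>)"
        unfolding pq using rt B_sym[of \<sigma> \<rho>] by (simp add: B_simps algebra_simps)
      then have "\<not> (p \<noteq> 0 \<or> q \<noteq> 0)" using posdef_plane[OF c1(2), of p q] le by linarith
      then show False using pq \<eta>(4) by simp
    qed
    define U where "U = span {\<rho>, \<sigma>, \<eta>}"
    have U: "subspace U" "P \<subseteq> U" "\<rho> \<in> U" "\<sigma> \<in> U" "\<eta> \<in> U"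
      by (auto simp: U_def P_def span_base intro!: span_mono)
    obtain \<Lambda> :: "'v \<Rightarrow> real" where \<Lambda>: "linear \<Lambda>" "\<Lambda> \<rho> = 0" "\<Lambda> \<sigma> = 0" "\<Lambda> \<eta> \<noteq> 0"
      "finite {\<beta> \<in> sub_pos U. \<Lambda> \<beta> < 0}"
      using separating_functional[OF rt(1,2) c1(2)] \<eta>P independent_canonical[OF P(1,2,3) can(3)]
      unfolding U_def P_def by blast
    have kernel: "x \<in> P" if "x \<in> U" "\<Lambda> x = 0" for x
    proof -
      obtain p q t where x: "x = p *\<^sub>R \<rho> + q *\<^sub>R \<sigma> + t *\<^sub>R \<eta>" using \<open>x \<in> U\<close> unfolding U_def space_elem by blast
      then have "t = 0" using \<open>\<Lambda> x = 0\<close> \<Lambda> by (simp add: linear_add[OF \<Lambda>(1)] linear_cmul[OF \<Lambda>(1)])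
      then show ?thesis using x by (auto simp: P_def plane_elem)
    qed
    obtain z where z: "z \<in> carrier W" "\<And>x. act z x \<in> U \<longleftrightarrow> x \<in> U" "\<And>\<beta>. \<beta> \<in> sub_pos U \<Longrightarrow> 0 \<le> \<Lambda> (act z \<beta>)"
      "\<And>\<beta>. \<beta> \<in> sub_pos U \<Longrightarrow> \<Lambda> \<beta> = 0 \<Longrightarrow> 0 < lam (act (inv z) \<beta>)"
      using chamber_conjugate[OF U(1) \<Lambda>(1,5)] by blast
    have zU: "act (inv z) x \<in> U \<longleftrightarrow> x \<in> U" for x using z(2)[of "act (inv z) x"] z(1) by simp
    \<comment> \<open>The wall clause of \<open>chamber_conjugate\<close> rules out that
      \<open>z\<close> makes such a root negative.\<close>
    have zP: "act z \<delta> \<in> sub_pos P" if \<delta>: "\<delta> \<in> sub_pos U" "\<Lambda> (act z \<delta>) = 0" for \<delta>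
    proof -
      have d: "act z \<delta> \<in> roots" "act z \<delta> \<in> U" using \<delta> z(1,2) root_act by (auto simp: sub_pos_def)
      have "0 < lam (act z \<delta>)"
      proof (rule ccontr)
        assume "\<not> 0 < lam (act z \<delta>)"
        then have "- act z \<delta> \<in> sub_pos U"
          using d root_lam_nz[OF d(1)] U(1) by (auto simp: sub_pos_def lam_simps subspace_neg)
        moreover have "\<Lambda> (- act z \<delta>) = 0" using \<delta>(2) by (simp add: linear_neg[OF \<Lambda>(1)])
        ultimately have "0 < lam (act (inv z) (- act z \<delta>))" by (rule z(4))
        then show False using \<delta>(1) z(1) by (simp add: act_minus lam_simps sub_pos_def)
      qed
      then show ?thesis using d kernel[OF d(2) \<delta>(2)] by (simp add: sub_pos_def)
    qed
    \<comment> \<open>A decomposition of the transported root in \<open>U\<close> would have both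
      parts on the wall, since the functional is nonnegative on them; moved back, it would decompose
      \<tau> in \<open>P\<close>.\<close>
    have canU: "act (inv z) \<tau> \<in> canonical U \<and> 0 < lam (act (inv z) \<tau>)" if \<tau>: "\<tau> \<in> canonical P" "\<Lambda> \<tau> = 0" for \<tau>
    proof -
      have \<tau>r: "\<tau> \<in> roots" "0 < lam \<tau>" "\<tau> \<in> U" using \<tau>(1) canonical_sub_pos U(2) by (auto simp: sub_pos_def)
      define r where "r = act (inv z) \<tau>"
      have zr: "act z r = \<tau>" using z(1) by (simp add: r_def)
      have r: "r \<in> sub_pos U" "0 < lam r"
        using z(1) z(4)[of \<tau>] \<tau> \<tau>r zU root_act by (auto simp: r_def sub_pos_def)
      have "r \<in> canonical U"
      proof (rule ccontr)
        assume "r \<notin> canonical U"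
        obtain \<delta> \<beta>' where d: "\<delta> \<in> canonical U" "\<beta>' \<in> sub_pos U" "\<beta>' = act (root_reflection \<delta>) r" "0 < B \<delta> r"
          using sub_pos_decompose[OF U(1) r(1) \<open>r \<notin> canonical U\<close>] by metis
        have dU: "\<delta> \<in> sub_pos U" "\<delta> \<in> roots" using d(1) canonical_sub_pos by (auto simp: sub_pos_def)
        have "r = \<beta>' + (2 * B \<delta> r) *\<^sub>R \<delta>" using d(3) dU by (simp add: act_root_reflection_apply)
        then have eq: "\<tau> = act z \<beta>' + (2 * B \<delta> r) *\<^sub>R act z \<delta>" using zr z(1) by (metis act_add act_scale)
        then have "\<Lambda> (act z \<beta>') + (2 * B \<delta> r) * \<Lambda> (act z \<delta>) = 0"
          using \<tau>(2) by (metis linear_add[OF \<Lambda>(1)] linear_cmul[OF \<Lambda>(1)] real_scaleR_def)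
        moreover have "0 \<le> \<Lambda> (act z \<beta>')" "0 \<le> (2 * B \<delta> r) * \<Lambda> (act z \<delta>)" using z(3) d dU by auto
        ultimately have "\<Lambda> (act z \<beta>') = 0" "(2 * B \<delta> r) * \<Lambda> (act z \<delta>) = 0" by linarith+
        then have "act z \<beta>' \<in> sub_pos P" "act z \<delta> \<in> sub_pos P" using zP d dU by auto
        then show False using canonical_indecomposable[OF P(1) \<tau>(1) _ _ _ eq] d(4) by simp
      qed
      then show ?thesis using r by (simp add: r_def)
    qed
    define r r' where "r = act (inv z) \<rho>" and "r' = act (inv z) \<sigma>"
    have zr: "act z r = \<rho>" "act z r' = \<sigma>" using z(1) by (simp_all add: r_def r'_def)
    have r: "r \<in> canonical U" "r' \<in> canonical U" "0 < lam r" "0 < lam r'"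
      using canU[OF P(2) \<Lambda>(2)] canU[OF P(3) \<Lambda>(3)] by (auto simp: r_def r'_def)
    have rr': "r \<noteq> r'" using zr can(3) by auto
    have rroot: "r \<in> roots" using r canonical_sub_pos by (auto simp: sub_pos_def)
    define \<mu> where "\<mu> = - act (inv z) \<eta>"
    have z\<mu>: "act z \<mu> = - \<eta>" using z(1) by (simp add: \<mu>_def act_minus)
    have \<eta>0: "act (inv z) \<eta> \<in> roots" "act (inv z) \<eta> \<in> U" using \<eta> z(1) root_act zU U by auto
    \<comment> \<open>If positive, this root would stay positive under the canonical reflection in
      \<open>r\<close>, which makes \<open>r\<close> negative, contradicting dominance.\<close>
    have "lam (act (inv z) \<eta>) < 0"
    proof (rule ccontr)
      assume "\<not> lam (act (inv z) \<eta>) < 0"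
      then have p: "act (inv z) \<eta> \<in> sub_pos U" using \<eta>0 root_lam_nz[OF \<eta>0(1)] by (simp add: sub_pos_def)
      have "act (inv z) \<eta> \<noteq> r" using \<eta>(4) z(1) act_eq_iff[of "inv z" \<eta> \<rho>] by (simp add: r_def)
      then have "0 < lam (act (root_reflection r) (act (inv z) \<eta>))"
        using canonical_permutes[OF U(1) r(1) p] by (simp add: sub_pos_def)
      moreover have "dominated_by (act (inv z) \<eta>) r"
        unfolding r_def using dominated_act[OF \<eta>(1) rt(1) _ \<eta>(3)] z(1) by simp
      moreover have "lam (act (root_reflection r) r) < 0" using rroot r(3) by (simp add: root_reflection_self lam_simps)
      ultimately show False
        using dominated_iff[OF \<eta>0(1) rroot] root_reflection_closed[OF rroot] by force
    qed
    then have \<mu>: "\<mu> \<in> sub_pos U" "lam (act z \<mu>) < 0"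
      using \<eta>0 U(1) \<eta>(2) z\<mu> by (auto simp: \<mu>_def sub_pos_def lam_simps subspace_neg)
    have "B \<mu> r = - B \<eta> \<rho>" using B_act[OF z(1), of \<mu> r] by (simp add: zr z\<mu> B_simps)
    then have B\<mu>: "B \<mu> r \<le> - 1" using B\<eta> by simp
    have Uspan: "U \<subseteq> span {r, r', \<mu>}"
    proof
      fix x assume "x \<in> U"
      then have "act z x \<in> U" using z(2) by simp
      then obtain p q t where "act z x = p *\<^sub>R \<rho> + q *\<^sub>R \<sigma> + t *\<^sub>R \<eta>" unfolding U_def space_elem by blast
      then have "act z x = act z (p *\<^sub>R r + q *\<^sub>R r' + (- t) *\<^sub>R \<mu>)"
        using z(1) by (simp add: act_add act_diff act_minus act_scale zr z\<mu>)
      then have "x = p *\<^sub>R r + q *\<^sub>R r' + (- t) *\<^sub>R \<mu>" by (simp only: act_eq_iff[OF z(1)])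
      then show "x \<in> span {r, r', \<mu>}" unfolding space_elem by blast
    qed
    have Brr': "B r r' = - c" using B_act[OF z(1), of r r'] by (simp add: zr Bc)
    obtain M where M: "chebyshev_U c (Suc (Suc M)) = 0" "chebyshev_U c (Suc M) = 1"
      "\<And>j. \<lbrakk>0 < j; j < Suc (Suc M)\<rbrakk> \<Longrightarrow> 0 < chebyshev_U c j"
      using chebyshev_U_period[OF P(1,3,2) can(3)[symmetric] c1(3)] unfolding c_def by metis
    have kM: "k < Suc M"
    proof (rule ccontr)
      assume "\<not> k < Suc M"
      then have "0 < chebyshev_U c (Suc (Suc M))" unfolding c_def by (intro pos) auto
      then show False using M(1) by simp
    qed
    note ab = chebyshev_U_consecutive[OF M(1,2) c1(1) M(3) k kM HOL.refl HOL.refl]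
    define \<gamma> where "\<gamma> = chebyshev_U c k *\<^sub>R r + chebyshev_U c (Suc k) *\<^sub>R r'"
    have z\<gamma>: "act z \<gamma> = \<epsilon>" using z(1) by (simp add: \<gamma>_def act_add act_scale zr \<epsilon>_eq del: chebyshev_U.simps)
    have "0 < chebyshev_U c k * lam r" "0 < chebyshev_U c (Suc k) * lam r'"
      using pos[of k] pos[of "Suc k"] k r(3,4) by (simp_all add: c_def del: chebyshev_U.simps)
    then have \<gamma>pos: "0 < lam \<gamma>" by (simp add: \<gamma>_def lam_simps del: chebyshev_U.simps)
    have "\<exists>\<nu>\<in>roots. 0 < lam \<nu> \<and> lam (act z \<nu>) < 0 \<and> B \<nu> \<gamma> \<le> - 1"
      by (rule bipodal_core[OF U(1) Uspan r(1,2) rr' Brr' c1(1) z(1) _ _ \<mu> B\<mu> _ _ _ _ \<gamma>_def])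
        (use ab zr rt in \<open>simp_all del: chebyshev_U.simps\<close>)
    then obtain \<nu> where \<nu>: "\<nu> \<in> roots" "0 < lam \<nu>" "lam (act z \<nu>) < 0" "B \<nu> \<gamma> \<le> - 1" by blast
    define \<eta>' where "\<eta>' = - act z \<nu>"
    have \<eta>': "\<eta>' \<in> roots" "0 < lam \<eta>'" using \<nu> z(1) root_act by (auto simp: \<eta>'_def lam_simps)
    have i: "act (inv z) \<eta>' = - \<nu>" "act (inv z) \<epsilon> = \<gamma>" using z(1) by (auto simp: \<eta>'_def act_minus z\<gamma>[symmetric])
    have "B \<eta>' \<epsilon> = - B \<nu> \<gamma>" using B_act[OF z(1), of \<nu> \<gamma>] by (simp add: \<eta>'_def z\<gamma> B_simps)
    then have "1 \<le> B \<eta>' \<epsilon>" using \<nu>(4) by simp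
    then have dom: "dominated_by \<eta>' \<epsilon> \<or> dominated_by \<epsilon> \<eta>'" by (rule B_ge_1_comparable[OF \<eta>'(1) \<epsilon>(2) _ \<eta>'(2)])
    have "\<not> dominated_by \<epsilon> \<eta>'"
    proof
      assume "dominated_by \<epsilon> \<eta>'"
      moreover have "lam (act (inv z) \<eta>') < 0" using \<nu>(2) by (simp add: i lam_simps)
      ultimately have "lam (act (inv z) \<epsilon>) < 0" using dominated_iff[OF \<epsilon>(2) \<eta>'(1)] z(1) by blast
      then show False using \<gamma>pos by (simp add: i)
    qed
    then have "\<eta>' = \<epsilon>" using dom \<epsilon>(1) \<eta>' by (auto simp: small_iff)
    then have "- \<nu> = \<gamma>" using i by simp
    then show False using \<gamma>pos \<nu>(2) by (metis lam_simps(3) less_asym neg_0_less_iff_less)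
  qed
qed

section \<open>Suffixes of low elements\<close>

text \<open>Each new reflection is the previous one conjugated by the current one, so the product of
  neighbours does not change along the chain.\<close>

lemma dihedral_reflections:
  assumes "\<gamma> \<in> roots" "\<delta> \<in> roots"
  shows "root_reflection (dihedral \<gamma> \<delta> k) \<otimes> root_reflection (dihedral \<gamma> \<delta> (Suc k)) =
    root_reflection \<delta> \<otimes> root_reflection \<gamma>"
proof (induction k)
  case 0
  have "dihedral \<gamma> \<delta> (Suc 0) = act (root_reflection \<gamma>) \<delta>"
    using assms by (simp add: dihedral_1 act_root_reflection_apply)
  then have "root_reflection (dihedral \<gamma> \<delta> (Suc 0)) = root_reflection \<gamma> \<otimes> root_reflection \<delta> \<otimes> root_reflection \<gamma>"
    using assms by (simp add: root_reflection_act root_reflection_inv)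
  then show ?case using assms by (simp add: m_assoc root_reflection_cancel)
next
  case (Suc k)
  let ?a = "dihedral \<gamma> \<delta> k" and ?b = "dihedral \<gamma> \<delta> (Suc k)"
  have r: "?a \<in> roots" "?b \<in> roots" and "B ?a ?b = - B \<gamma> \<delta>" using dihedral_root[OF assms] by blast+
  then have "dihedral \<gamma> \<delta> (Suc (Suc k)) = - act (root_reflection ?b) ?a"
    using B_sym[of ?a ?b] by (simp add: dihedral_Suc act_root_reflection_apply)
  moreover have "root_reflection (- x) = root_reflection x" if "x \<in> roots" for x
    by (rule root_reflection_unique) (use that in \<open>auto simp: act_root_reflection B_reflection_def B_simps fun_eq_iff\<close>)
  ultimately have "root_reflection (dihedral \<gamma> \<delta> (Suc (Suc k))) = root_reflection ?b \<otimes> root_reflection ?a \<otimes> root_reflection ?b"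
    using r root_act[of ?a "root_reflection ?b"] by (simp add: root_reflection_act root_reflection_inv)
  then show ?case using Suc r assms by (simp add: m_assoc root_reflection_cancel)
qed

text \<open>
  If \<open>\<beta>\<close> is a short inversion of \<open>v\<close> but \<open>s\<beta>\<close> is not one of \<open>sv\<close>, then \<open>\<beta>\<close> is canonical in the
  plane of \<open>\<alpha>\<^sub>s\<close> and \<open>\<beta>\<close>, and the last inversion of \<open>sv\<close> in that plane is short, because it starts a
  second chain of length 3 from \<open>sv\<close> down to \<open>s s\<^sub>\<beta> v\<close>.
\<close>

lemma low_left_division:
  assumes low: "s \<otimes> v \<in> low_elements" and s: "s \<in> S" and v: "v \<in> carrier W" and l: "len (s \<otimes> v) = len v + 1"
  shows "v \<in> low_elements"
proof -
  define w where "w = s \<otimes> v"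
  have w: "w \<in> carrier W" "len w = len v + 1" "N1 w \<subseteq> small_roots" using low s v l by (auto simp: w_def low_elements_def)
  have wv: "act (inv w) x = act (inv v) (act s x)" for x using s v by (simp add: w_def inv_mult_group S_inv act_mult)
  have \<alpha>v: "0 < lam (act (inv v) (\<alpha> s))" using lam_act_simple_inv_iff[OF v s] l by simp
  note sr = simple_root[OF s] lam_simple[OF s]
  have s\<alpha>: "act s (\<alpha> s) = - \<alpha> s" using s by (simp add: act_simple_apply B_diag scaleR_2)
  have "\<beta> \<in> small_roots" if \<beta>: "\<beta> \<in> N1 v" for \<beta>
  proof -
    have \<beta>v: "\<beta> \<in> inv_set v" "len (root_reflection \<beta> \<otimes> v) + 1 = len v" using \<beta> N1_iff[OF v] by auto
    then have \<beta>r: "\<beta> \<in> roots" "0 < lam \<beta>" "lam (act (inv v) \<beta>) < 0" by (auto simp: inv_set_def)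
    have ne: "\<beta> \<noteq> \<alpha> s" using \<beta>r \<alpha>v by auto
    have s\<beta>: "0 < lam (act s \<beta>)" "act s \<beta> \<in> roots" using simple_permutes[OF s \<beta>r(1,2) ne] root_act \<beta>r(1) s by auto
    show ?thesis
    proof (cases "act s \<beta> \<in> N1 w")
      \<comment> \<open>A root dominated by \<beta> cannot be \<open>\<alpha> s\<close>, which
        \<open>inv v\<close> keeps positive; so \<open>s\<close> carries it to a positive root
        dominated by the small root s\<beta>.\<close>
      case True
      then have sm: "act s \<beta> \<in> small_roots" using w(3) by blast
      have "\<eta> = \<beta>" if \<eta>: "\<eta> \<in> roots" "0 < lam \<eta>" "dominated_by \<eta> \<beta>" for \<eta>
      proof -
        have "\<eta> \<noteq> \<alpha> s"
        proof
          assume "\<eta> = \<alpha> s"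
          then have "lam (act (inv v) (\<alpha> s)) < 0" using \<eta> \<beta>r v by (simp add: dominated_iff)
          then show False using \<alpha>v by simp
        qed
        then have "0 < lam (act s \<eta>)" "act s \<eta> \<in> roots" using simple_permutes[OF s \<eta>(1,2)] root_act \<eta>(1) s by auto
        moreover have "dominated_by (act s \<eta>) (act s \<beta>)" using dominated_act[OF \<eta>(1) \<beta>r(1) _ \<eta>(3)] s by blast
        ultimately have "act s \<eta> = act s \<beta>" using sm by (simp add: small_iff)
        then show ?thesis using s by (simp add: act_eq_iff)
      qed
      then show ?thesis using \<beta>r by (simp add: small_iff)
    next
      case False
      define v1 where "v1 = root_reflection \<beta> \<otimes> v"
      define y where "y = s \<otimes> v1"
      have v1: "v1 \<in> carrier W" "len v1 + 1 = len v" using \<beta>v \<beta>r v by (auto simp: v1_def)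
      have y: "y \<in> carrier W" using s v1 by (simp add: y_def)
      have "root_reflection (act s \<beta>) \<otimes> w = y"
        using s \<beta>r v by (simp add: root_reflection_act S_inv w_def y_def v1_def m_assoc S_cancel)
      moreover have "act s \<beta> \<in> inv_set w" using s\<beta> \<beta>r s by (simp add: inv_set_def wv)
      ultimately have "len y + 1 \<noteq> len w" using False N1_iff[OF w(1)] by auto
      then have ly: "len y + 1 = len v1" using len_mult_simple[OF s v1(1)] v1(2) w(2) by (auto simp: y_def)
      have \<alpha>v1: "lam (act (inv v1) (\<alpha> s)) < 0"
        using simple_inversion_iff[OF s v1(1)] ly by (simp add: y_def inv_set_def)
      have v1act: "act (inv v1) x = act (inv v) (act (root_reflection \<beta>) x)" for x
        using act_inv_reflection_mult[OF \<beta>r(1) v] by (simp add: v1_def)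
      have \<beta>v1: "0 < lam (act (inv v1) \<beta>)" using \<beta>r v by (simp add: v1act root_reflection_self act_minus lam_simps)
      define P where "P = span {\<alpha> s, \<beta>}"
      have P: "subspace P" "\<alpha> s \<in> P" "\<beta> \<in> P" by (auto simp: P_def span_base)
      have can_s: "\<alpha> s \<in> canonical P" using simple_canonical[OF s P(2)] .
      \<comment> \<open>Let \<delta> be a canonical inversion of \<open>v\<close> in the plane. If
        it differed from \<beta>, multiplying \<open>v1\<close> by its reflection would increase the
        length, and going from there to \<open>v\<close> would add at least two more; but
        \<open>v\<close> is only one longer than \<open>v1\<close>.\<close>
      have can_\<beta>: "\<beta> \<in> canonical P"
      proof -
        obtain \<delta> where \<delta>: "\<delta> \<in> canonical P" "\<delta> \<in> inv_set v" using canonical_inversion[OF P(1) v \<beta>v(1) P(3)] .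
        have \<delta>r: "\<delta> \<in> roots" "0 < lam \<delta>" "\<delta> \<in> P" "lam (act (inv v) \<delta>) < 0"
          using \<delta> canonical_sub_pos by (auto simp: sub_pos_def inv_set_def)
        have \<delta>s: "\<alpha> s \<noteq> \<delta>" using \<delta>r \<alpha>v by auto
        have "\<delta> = \<beta>"
        proof (rule ccontr)
          assume "\<delta> \<noteq> \<beta>"
          have "span {\<alpha> s, \<beta>} \<subseteq> span {\<alpha> s, \<delta>}"
          proof (rule span_exchange)
            show "independent {\<alpha> s, \<delta>}" by (rule independent_canonical[OF P(1) can_s \<delta>(1) \<delta>s])
            show "card {\<alpha> s, \<beta>} \<le> card {\<alpha> s, \<delta>}" using \<delta>s by (simp add: card_insert_if)
          qed (use P \<delta>r in \<open>auto simp: P_def\<close>)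
          then obtain p q where pq: "\<beta> = p *\<^sub>R \<alpha> s + q *\<^sub>R \<delta>" using P(3) plane_elem unfolding P_def by blast
          have pq0: "0 \<le> p" "0 \<le> q" using plane_coherent[OF P(1) can_s \<delta>(1) \<delta>s \<beta>r(1,2) pq] by auto
          have "\<not> lam (act (inv v1) \<delta>) < 0"
          proof
            assume "lam (act (inv v1) \<delta>) < 0"
            then have "p * lam (act (inv v1) (\<alpha> s)) + q * lam (act (inv v1) \<delta>) \<le> 0"
              using pq0 \<alpha>v1 by (intro add_nonpos_nonpos mult_nonneg_nonpos) auto
            moreover have "lam (act (inv v1) \<beta>) = p * lam (act (inv v1) (\<alpha> s)) + q * lam (act (inv v1) \<delta>)"
              using v1(1) by (subst pq) (simp add: act_add act_scale lam_simps)
            ultimately show False using \<beta>v1 by simp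
          qed
          then have "\<not> len (root_reflection \<delta> \<otimes> v1) < len v1" using len_reflection_less_iff[OF \<delta>r(1,2) v1(1)] by simp
          then have l1: "len v1 < len (root_reflection \<delta> \<otimes> v1)"
            using root_reflection_parity[OF \<delta>r(1) v1(1)] by (metis linorder_neqE_nat)
          have l2: "len (root_reflection \<delta> \<otimes> v) < len v" using len_reflection_less[OF \<delta>r(1,2) v \<delta>r(4)] .
          define \<zeta> where "\<zeta> = act (root_reflection \<delta>) \<beta>"
          have "\<beta> \<in> sub_pos P" using \<beta>r P by (simp add: sub_pos_def)
          then have \<zeta>: "\<zeta> \<in> roots" "0 < lam \<zeta>"
            using canonical_permutes[OF P(1) \<delta>(1)] \<open>\<delta> \<noteq> \<beta>\<close> by (auto simp: \<zeta>_def sub_pos_def)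
          have "act (root_reflection \<delta>) \<zeta> = \<beta>"
            using \<delta>r(1) by (simp add: \<zeta>_def act_root_reflection reflection_involutive)
          then have "lam (act (inv (root_reflection \<delta> \<otimes> v)) \<zeta>) < 0"
            using \<beta>r(3) act_inv_reflection_mult[OF \<delta>r(1) v] by simp
          then have "len (root_reflection \<zeta> \<otimes> (root_reflection \<delta> \<otimes> v)) < len (root_reflection \<delta> \<otimes> v)"
            using len_reflection_less[OF \<zeta>] \<delta>r(1) v by simp
          moreover have "root_reflection \<zeta> \<otimes> (root_reflection \<delta> \<otimes> v) = root_reflection \<delta> \<otimes> v1"
            using \<delta>r(1) \<beta>r(1) v by (simp add: \<zeta>_def v1_def root_reflection_act root_reflection_inv m_assoc root_reflection_cancel)
          ultimately show False using l1 l2 v1(2) by simp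
        qed
        then show ?thesis using \<delta> by simp
      qed
      define E where "E = dihedral (\<alpha> s) \<beta>"
      let ?u = "chebyshev_U (- B (\<alpha> s) \<beta>)"
      have E_eq: "E k = ?u (Suc k) *\<^sub>R \<alpha> s + ?u k *\<^sub>R \<beta>" for k by (simp only: E_def dihedral_def)
      have Er: "E k \<in> roots" for k using dihedral_root[OF sr(1) \<beta>r(1)] by (simp add: E_def)
      have E0: "E 0 = \<alpha> s" and E1: "E 1 = act s \<beta>"
        using s by (simp_all add: E_def dihedral_1 act_simple_apply)
      have E2: "E 2 = act s (act (root_reflection \<beta>) (\<alpha> s))"
        using s \<beta>r(1) B_sym[of \<beta> "\<alpha> s"] E1 E0 s\<alpha>
        by (simp add: E_def numeral_2_eq_2 dihedral_Suc act_root_reflection_apply act_diff act_scale)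
      have "act (root_reflection \<beta>) (\<alpha> s) \<in> sub_pos P"
        using canonical_permutes[OF P(1) can_\<beta> canonical_sub_pos[OF can_s]] ne by auto
      moreover have "act (root_reflection \<beta>) (\<alpha> s) \<noteq> \<alpha> s" using \<alpha>v1 \<alpha>v by (auto simp: v1act)
      ultimately have E2pos: "0 < lam (E 2)" unfolding E2 using simple_permutes[OF s] by (simp add: sub_pos_def)
      have wE2: "lam (act (inv w) (E 2)) < 0" using \<alpha>v1 s by (simp add: E2 wv v1act)
      have E012: "E 0 \<in> inv_set w" "E 1 \<in> inv_set w" "E 2 \<in> inv_set w"
        using Er E0 E1 sr s\<beta> \<beta>r \<alpha>v s\<alpha> s v E2pos wE2 Er[of 0] Er[of 1] Er[of 2]
        by (simp_all add: inv_set_def wv act_minus lam_simps del: One_nat_def)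
      \<comment> \<open>In a finite plane some member of the chain is nonpositive under
        \<open>lam\<close>; in an infinite one the chain is injective, while \<open>w\<close> has
        finitely many inversions.\<close>
      have "\<exists>k. E k \<notin> inv_set w"
      proof (cases "- B (\<alpha> s) \<beta> < 1")
        case True
        have "\<exists>k. lam (E k) \<le> 0"
          by (rule chebyshev_not_always_pos[OF True]) (simp add: E_def dihedral_Suc lam_simps)
        then show ?thesis by (auto simp: inv_set_def not_less[symmetric])
      next
        case False
        then have "inj E" unfolding E_def using dihedral_inj[OF sr(1) \<beta>r(1) _ sr(2) \<beta>r(2)] by simp
        then have "infinite (range E)" by (simp add: range_inj_infinite)
        then show ?thesis using inv_set_card(1)[OF w(1)] finite_subset[of "range E" "inv_set w"] by blast
      qed
      define K where "K = (LEAST k. E k \<notin> inv_set w)"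
      have K: "E K \<notin> inv_set w" unfolding K_def by (rule LeastI_ex, fact)
      have below: "E k \<in> inv_set w" if "k < K" for k using not_less_Least[of k "\<lambda>k. E k \<notin> inv_set w"] that by (auto simp: K_def)
      have "K \<noteq> 0" "K \<noteq> 1" "K \<noteq> 2" using E012 K by metis+
      then obtain N where N: "K = Suc (Suc N)" "0 < N" by (metis One_nat_def Suc_1 neq0_conv not0_implies_Suc)
      have coh: "0 \<le> ?u (Suc k) \<and> 0 \<le> ?u k" if "0 < lam (E k)" for k
        using plane_coherent[OF P(1) can_s can_\<beta> ne[symmetric] Er that E_eq] .
      have posK: "0 < lam (E k)" if "k < K" for k using below[OF that] by (simp add: inv_set_def)
      \<comment> \<open>If \<open>E K\<close> is itself negative, the nonnegative coefficient of
        \<beta> known from the previous index leaves only \<open>E K = - \<alpha> s\<close>.\<close>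
      have wK: "0 < lam (act (inv w) (E K))"
      proof (cases "0 < lam (E K)")
        case True
        then show ?thesis using K Er[of K] root_lam_nz[of "act (inv w) (E K)"] root_act w(1) by (force simp: inv_set_def)
      next
        case False
        then have "0 < lam (- E K)" using root_lam_nz[OF Er[of K]] by (simp add: lam_simps)
        moreover have "- E K = (- ?u (Suc K)) *\<^sub>R \<alpha> s + (- ?u K) *\<^sub>R \<beta>" by (simp add: E_eq del: chebyshev_U.simps)
        ultimately have "0 \<le> - ?u (Suc K)" "0 \<le> - ?u K"
          using plane_coherent[OF P(1) can_s can_\<beta> ne[symmetric] root_minus[OF Er]] by blast+
        moreover have "0 \<le> ?u K" using coh[of "Suc N"] posK[of "Suc N"] N(1) by simp
        ultimately have "- E K = (- ?u (Suc K)) *\<^sub>R \<alpha> s" "0 \<le> - ?u (Suc K)" by (simp_all add: E_eq del: chebyshev_U.simps)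
        then have "- E K = \<alpha> s" using root_multiple[OF root_minus[OF Er] sr(1)] by blast
        then have "E K = - \<alpha> s" by (metis minus_minus)
        then show ?thesis using s\<alpha> \<alpha>v s v by (simp add: wv act_minus)
      qed
      define \<epsilon> where "\<epsilon> = E (Suc N)"
      have \<epsilon>w: "\<epsilon> \<in> inv_set w" unfolding \<epsilon>_def by (rule below) (simp add: N)
      have \<epsilon>r: "\<epsilon> \<in> roots" "0 < lam \<epsilon>" "lam (act (inv w) \<epsilon>) < 0" using \<epsilon>w by (auto simp: inv_set_def)
      define w1 where "w1 = root_reflection \<epsilon> \<otimes> w"
      have w1: "w1 \<in> carrier W" "len w1 < len w" using \<epsilon>r w(1) len_reflection_less[OF \<epsilon>r(1,2) w(1)] by (auto simp: w1_def)
      have w1act: "act (inv w1) x = act (inv w) (act (root_reflection \<epsilon>) x)" for x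
        using act_inv_reflection_mult[OF \<epsilon>r(1) w(1)] by (simp add: w1_def)
      have EN: "E N \<in> roots" "0 < lam (E N)" using Er posK[of N] N by auto
      have "B \<epsilon> (E N) = - B (\<alpha> s) \<beta>"
        using dihedral_root[OF sr(1) \<beta>r(1), of N] B_sym[of "E N" \<epsilon>] by (simp add: E_def \<epsilon>_def)
      then have "act (root_reflection \<epsilon>) (E N) = - E K"
        using \<epsilon>r(1) by (simp add: act_root_reflection_apply N(1)) (simp add: E_def \<epsilon>_def dihedral_Suc)
      then have "lam (act (inv w1) (E N)) < 0" using wK w(1) by (simp add: w1act act_minus lam_simps)
      then have u1: "len (root_reflection (E N) \<otimes> w1) < len w1" using len_reflection_less[OF EN w1(1)] by blast
      define u1 where "u1 = root_reflection (E N) \<otimes> w1"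
      have u1c: "u1 \<in> carrier W" using EN w1 by (simp add: u1_def)
      \<comment> \<open>This constant rotation takes \<open>w\<close> to \<open>v1\<close>, which is
        two shorter than \<open>w\<close>. Both reflections on the way decrease the length, so each
        does so by exactly one.\<close>
      have rot: "root_reflection (E N) \<otimes> root_reflection \<epsilon> = root_reflection \<beta> \<otimes> s"
        using dihedral_reflections[OF sr(1) \<beta>r(1), of N] s by (simp add: E_def \<epsilon>_def root_reflection_simple)
      have "u1 = root_reflection (E N) \<otimes> root_reflection \<epsilon> \<otimes> w" using EN \<epsilon>r w(1) by (simp add: u1_def w1_def m_assoc)
      also have "\<dots> = root_reflection \<beta> \<otimes> v" unfolding rot using s v \<beta>r by (simp add: w_def m_assoc S_cancel)
      finally have "u1 = v1" by (simp add: v1_def)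
      then have "len w1 + 1 = len w" using u1 w1(2) v1(2) w(2) by (simp add: u1_def)
      then have "\<epsilon> \<in> N1 w" using \<epsilon>w N1_iff[OF w(1)] by (simp add: w1_def)
      then have sm: "\<epsilon> \<in> small_roots" using w(3) by blast
      have upos: "0 < ?u j" if j: "0 < j" "j \<le> Suc N" for j
      proof (rule ccontr)
        assume "\<not> 0 < ?u j"
        then have z: "?u j = 0" using coh[of j] posK[of j] j N(1) by simp
        obtain i where i: "j = Suc i" using j(1) by (cases j) auto
        have "E j = ?u (Suc j) *\<^sub>R \<alpha> s" using z by (simp add: E_eq del: chebyshev_U.simps)
        then have "0 < ?u (Suc j) * lam (\<alpha> s)" using posK[of j] j N(1) by (simp add: lam_simps)
        then have "0 < ?u (Suc j)" using sr(2) by (simp add: zero_less_mult_iff)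
        moreover have "?u (Suc j) = - ?u i" using z by (simp add: i)
        moreover have "0 \<le> ?u i" using coh[of i] posK[of i] i j N(1) by simp
        ultimately show False by simp
      qed
      show ?thesis
      \<comment> \<open>The coefficient of \<open>\<alpha> s\<close> in \<epsilon>: if it vanishes,
        \<epsilon> is \<beta> itself; otherwise \<epsilon> lies strictly between the canonical roots
        and bipodality applies.\<close>
      proof (cases "?u (Suc (Suc N)) = 0")
        case True
        then have "\<epsilon> = ?u (Suc N) *\<^sub>R \<beta>" by (simp add: \<epsilon>_def E_eq del: chebyshev_U.simps)
        then have "\<epsilon> = \<beta>" using root_multiple[OF \<epsilon>r(1) \<beta>r(1)] upos[of "Suc N"] by force
        then show ?thesis using sm by simp
      next
        case False
        then have "0 < ?u (Suc (Suc N))" using coh[of "Suc N"] posK[of "Suc N"] N(1) by simp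
        then have "0 < ?u j" if "0 < j" "j \<le> Suc (Suc N)" for j using upos[of j] that by (cases "j = Suc (Suc N)") auto
        then show ?thesis
          using bipodal[of \<beta> "\<alpha> s" "Suc N"] can_\<beta> can_s ne sm by (simp add: P_def insert_commute E_def \<epsilon>_def)
      qed
    qed
  qed
  then show ?thesis using v by (auto simp: low_elements_def)
qed

theorem low_suffix:
  assumes "w \<in> low_elements" "is_suffix v w"
  shows "v \<in> low_elements"
proof -
  have v: "v \<in> carrier W" using assms(2) by (simp add: is_suffix_def)
  have "v \<in> low_elements" if "u \<in> carrier W" "u \<otimes> v \<in> low_elements" "len (u \<otimes> v) = len u + len v" for u
    using that
  proof (induction "len u" arbitrary: u rule: less_induct)
    case less
    show ?case
    proof (cases "u = \<one>")
      case True
      then show ?thesis using less.prems v by simp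
    next
      case False
      then obtain s where s: "s \<in> S" "len (s \<otimes> u) + 1 = len u" using left_descent_exists less.prems(1) by blast
      define u' where "u' = s \<otimes> u"
      have u': "u' \<in> carrier W" "u \<otimes> v = s \<otimes> (u' \<otimes> v)" "len u' < len u"
        using s less.prems(1) v by (auto simp: u'_def m_assoc S_cancel)
      have "len (u' \<otimes> v) \<le> len u' + len v" using len_mult_le u' v by blast
      moreover have "len (u \<otimes> v) \<le> len (u' \<otimes> v) + 1" using len_mult_simple[OF s(1), of "u' \<otimes> v"] u' v by auto
      ultimately have l: "len (u' \<otimes> v) = len u' + len v" "len (s \<otimes> (u' \<otimes> v)) = len (u' \<otimes> v) + 1"
        using less.prems(3) s(2) u'(2) by (auto simp: u'_def)
      have "u' \<otimes> v \<in> low_elements"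
        using low_left_division[OF _ s(1) _ l(2)] less.prems(2) u' v by simp
      then show ?thesis using less.hyps[OF u'(3,1) _ l(1)] by blast
    qed
  qed
  then show ?thesis using assms by (auto simp: is_suffix_def)
qed

end

theorem theorem1p2:
  fixes W :: "('w, 'x) monoid_scheme"
    and S :: "'w set"
    and m :: "'w \<Rightarrow> 'w \<Rightarrow> enat"
    and B :: "'v::real_vector \<Rightarrow> 'v \<Rightarrow> real"
    and \<alpha> :: "'w \<Rightarrow> 'v"
  defines "L \<equiv> based_root_system.low_elements W S B \<alpha>"
  assumes "based_root_system W S m B \<alpha>"
    and "finite S"
  shows "S \<subseteq> L
    \<and> finite L
    \<and> (\<forall>u \<in> L. \<forall>v \<in> L. \<forall>j. coxeter_system.is_join W S j u v \<longrightarrow> j \<in> L)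
    \<and> (\<forall>w \<in> L. \<forall>v. coxeter_system.is_suffix W S v w \<longrightarrow> v \<in> L)"
proof -
  interpret finite_based_root_system W S m B \<alpha>
    using assms(2,3) by (simp add: finite_based_root_system_def finite_based_root_system_axioms_def)
  show ?thesis
    unfolding L_def using simple_low finite_low_elements low_join low_suffix by blast
qed

end
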